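(* Let $N\ge1$ and define, on operators of an $N\times N$-mode fermionic system, $$\mathcal T^*_{C^{res}_N}[\rho]=\frac1{|C^{res}_N|}\sum_{c\in C^{res}_N}(c\wedge c^* )\rho(c^\dagger\wedge(c^* )^\dagger),$$ where $c^*$ is the entrywise complex conjugate of $c$, and let $(\mathcal T^*_{C^{res}_N})^\dagger[\rho]=\frac1{|C^{res}_N|}\sum_{c\in C^{res}_N}(c^\dagger\wedge(c^* )^\dagger)\rho(c\wedge c^* )$. Then: 1. $\mathcal T^*_{C^{res}_N}=(\mathcal T^*_{C^{res}_N})^\dagger$. 2. $\mathcal T^*_{C^{res}_N}[\mathbb I_N\wedge\mathbb I_N]=\mathbb I_N\wedge\mathbb I_N$ and $\mathcal T^*_{C^{res}_N}[\mathbb S_z\wedge\mathbb S_z]=\mathbb S_z\wedge\mathbb S_z$, where $\mathbb S_z=\sigma_z^f\wedge\dots\wedge\sigma_z^f$ ($N$ factors). 3. $\mathcal T^*_{C^{res}_N}[\Psi_N^{|E\rangle\langle E|}]=\Psi_N^{|E\rangle\langle E|}$ and $\mathcal T^*_{C^{res}_N}[\Psi_N^{|E\rangle\langle O|}]=\Psi_N^{|E\rangle\langle O|}$. 4. For every $N\times N$-mode fermionic state $\rho^f$, $\mathcal T^*_{C^{res}_N}[\rho^f]$ is a linear combination of $\mathbb I^{|E\rangle\langle E|}$, $\mathbb I^{|O\rangle\langle O|}$, $\Psi_N^{|E\rangle\langle E|}$ and $\Psi_N^{|E\rangle\langle O|}$.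
   Context: Fermionic setting. An $N$-mode fermionic system has the $d=2^N$ dimensional Fock space with orthonormal occupation-number basis $f_{j_1}^\dagger\cdots f_{j_k}^\dagger|\Omega\rangle$ ($j_1<\dots<j_k$). The basis vectors with $k$ even are denoted $|E_1\rangle,\dots,|E_{d/2}\rangle$ and those with $k$ odd $|O_1\rangle,\dots,|O_{d/2}\rangle$; complex conjugates and transposes are taken in this basis. An operator is block-diagonal (BD) if it lies in the span of the $|E_i\rangle\langle E_j|$, $|O_i\rangle\langle O_j|$, and anti-block-diagonal (ABD) if it lies in the span of the $|E_i\rangle\langle O_j|$, $|O_i\rangle\langle E_j|$. For a composite system $AB$, the vectors $|x\rangle\wedge|y\rangle$ ($x,y$ ranging over the bases of $A$ and $B$; creation operators of $A$ to the left of those of $B$, applied to the vacuum) form an orthonormal basis; $\langle x|\wedge\langle y|$ is the bra dual to $|x\rangle\wedge|y\rangle$; and the wedge product of operators is the bilinear extension of $|x\rangle\langle x'|\wedge|y\rangle\langle y'|=(|x\rangle\wedge|y\rangle)(\langle x'|\wedge\langle y'|)$ (iterated for more factors). A fermionic state is a density operator commuting with total fermion parity (parity superselection rule). $\mathbb I_N$ is the identity on $N$ modes. Pauli and Clifford groups. On one mode, with $|E\rangle=|\Omega\rangle$, $|O\rangle=f^\dagger|\Omega\rangle$: $\sigma_z^f=|E\rangle\langle E|-|O\rangle\langle O|$, $\sigma_x^f=|E\rangle\langle O|+|O\rangle\langle E|$, $\sigma_y^f=-i|E\rangle\langle O|+i|O\rangle\langle E|$. The fermionic Pauli group $P_N$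 consists of all $N$-fold wedge products of elements of $\{\mathbb I,\sigma_x^f,\sigma_y^f,\sigma_z^f\}$ multiplied by a factor in $\{\pm1,\pm i\}$. The Clifford group $C_N$ is the normalizer of $P_N$ in the unitary group (elements counted modulo global phase). Let $\Xi^{BD}$, $\Xi^{ABD}$ be the sets of BD, respectively ABD, elements of $P_N$. The restricted Clifford set is $$C_N^{res}=\{C\in C_N:\ C\Gamma C^\dagger\in\Xi^{BD}\ \forall\,\Gamma\in\Xi^{BD}\ \text{and}\ C\Gamma C^\dagger\in\Xi^{ABD}\ \forall\,\Gamma\in\Xi^{ABD}\}.$$ Operators on $N\times N$ modes: $\mathbb I^{|E\rangle\langle E|}=\sum_{ij}(|E_i\rangle\langle E_i|\wedge|E_j\rangle\langle E_j|+|O_i\rangle\langle O_i|\wedge|O_j\rangle\langle O_j|)$, $\mathbb I^{|O\rangle\langle O|}=\sum_{ij}(|E_i\rangle\langle E_i|\wedge|O_j\rangle\langle O_j|+|O_i\rangle\langle O_i|\wedge|E_j\rangle\langle E_j|)$, $H_N^{|E\rangle\langle E|}=\sum_{ij}(|E_i\rangle\langle E_j|\wedge|E_j\rangle\langle E_i|+|O_i\rangle\langle O_j|\wedge|O_j\rangle\langle O_i|)$, $H_N^{|O\rangle\langle O|}=\sum_{ij}(|E_i\rangle\langle O_j|\wedge|O_j\rangle\langle E_i|+|O_i\rangle\langle E_j|\wedge|E_j\rangle\langle O_i|)$. The partial transpose $\mathbb I_N\wedge\mathbb T_f$ is the linear map $|x\rangle\langle x'|\wedge|y\rangle\langle y'|\mapsto|x\rangle\langle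 x'|\wedge|y'\rangle\langle y|$, and $\Psi_N^{|E\rangle\langle E|}=(\mathbb I_N\wedge\mathbb T_f)H_N^{|E\rangle\langle E|}$, $\Psi_N^{|E\rangle\langle O|}=(\mathbb I_N\wedge\mathbb T_f)H_N^{|O\rangle\langle O|}$. *)

theory Defs
  imports
    "Jordan_Normal_Form.Schur_Decomposition"
    "HOL-Library.Nat_Bijection"
begin

section \<open>Fock space\<close>

text \<open>
  The Fock space of \<open>N\<close> modes \<open>0, \<dots>, N - 1\<close> is \<open>\<complex>\<^bsup>2^N\<^esup>\<close>.  Coordinate \<open>x < 2 ^ N\<close> belongs to
  the occupation-number basis vector whose set of occupied modes is \<open>set_decode x\<close> (the positions
  of the ones in the binary expansion of \<open>x\<close>); coordinate \<open>0\<close> is the vacuum.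
  The matrix below is the creation operator of mode \<open>k\<close>, with the sign forced by the canonical
  anticommutation relations.
\<close>

definition creation :: "nat \<Rightarrow> nat \<Rightarrow> complex mat" where
  "creation N k = mat (2 ^ N) (2 ^ N) (\<lambda>(r, c).
     if k \<notin> set_decode c \<and> set_decode r = insert k (set_decode c)
     then (- 1) ^ card {j \<in> set_decode c. j < k} else 0)"

definition vacuum :: "nat \<Rightarrow> complex vec" where
  "vacuum N = unit_vec (2 ^ N) 0"

definition create_seq :: "nat \<Rightarrow> nat list \<Rightarrow> complex vec" where
  "create_seq N ks = foldr (\<lambda>k v. creation N k *\<^sub>v v) ks (vacuum N)"

definition modes :: "nat \<Rightarrow> nat list" where
  "modes x = sorted_list_of_set (set_decode x)"

definition ket :: "nat \<Rightarrow> nat \<Rightarrow> complex vec" where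
  "ket N x = create_seq N (modes x)"

text \<open>
  In a composite system the modes \<open>0, \<dots>, M - 1\<close> are those of the left factor and
  \<open>M, \<dots>, M + N - 1\<close> those of the right factor.
\<close>

definition wedge_ket :: "nat \<Rightarrow> nat \<Rightarrow> nat \<Rightarrow> nat \<Rightarrow> complex vec" where
  "wedge_ket M N x y = create_seq (M + N) (modes x @ map (\<lambda>k. M + k) (modes y))"

definition even_states :: "nat \<Rightarrow> nat set" where
  "even_states N = {x. x < 2 ^ N \<and> even (card (set_decode x))}"

definition odd_states :: "nat \<Rightarrow> nat set" where
  "odd_states N = {x. x < 2 ^ N \<and> odd (card (set_decode x))}"


section \<open>Operators and wedge products\<close>

abbreviation operators :: "nat \<Rightarrow> complex mat set" where
  "operators N \<equiv> carrier_mat (2 ^ N) (2 ^ N)"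

definition outer :: "complex vec \<Rightarrow> complex vec \<Rightarrow> complex mat" where
  "outer v w = mat (dim_vec v) (dim_vec w) (\<lambda>(r, c). v $ r * cnj (w $ c))"

abbreviation ketbra :: "nat \<Rightarrow> nat \<Rightarrow> nat \<Rightarrow> complex mat" where
  "ketbra N x x' \<equiv> outer (ket N x) (ket N x')"

text \<open>Type \<open>complex mat\<close> has no zero independent of the dimension, hence no \<open>sum\<close>.\<close>

definition op_sum :: "nat \<Rightarrow> ('i \<Rightarrow> complex mat) \<Rightarrow> 'i set \<Rightarrow> complex mat" where
  "op_sum N f I = mat (2 ^ N) (2 ^ N) (\<lambda>(r, c). \<Sum>i\<in>I. f i $$ (r, c))"

definition wedge :: "nat \<Rightarrow> nat \<Rightarrow> complex mat \<Rightarrow> complex mat \<Rightarrow> complex mat" where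
  "wedge M N A B = op_sum (M + N)
     (\<lambda>((x, x'), (y, y')).
        (A $$ (x, x') * B $$ (y, y')) \<cdot>\<^sub>m outer (wedge_ket M N x y) (wedge_ket M N x' y'))
     (({..<2 ^ M} \<times> {..<2 ^ M}) \<times> ({..<2 ^ N} \<times> {..<2 ^ N}))"

text \<open>Iterated wedge product of one-mode operators; the empty product is the identity on zero modes.\<close>

fun wedge_seq :: "complex mat list \<Rightarrow> complex mat" where
  "wedge_seq [] = 1\<^sub>m 1"
| "wedge_seq (A # As) = wedge 1 (length As) A (wedge_seq As)"

definition partial_transpose :: "nat \<Rightarrow> complex mat \<Rightarrow> complex mat" where
  "partial_transpose N X = op_sum (N + N)
     (\<lambda>((x, x'), (y, y')).
        ((X *\<^sub>v wedge_ket N N x' y') \<bullet>c wedge_ket N N x y)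
        \<cdot>\<^sub>m wedge N N (ketbra N x x') (ketbra N y' y))
     (({..<2 ^ N} \<times> {..<2 ^ N}) \<times> ({..<2 ^ N} \<times> {..<2 ^ N}))"

definition block_diagonal :: "nat \<Rightarrow> complex mat \<Rightarrow> bool" where
  "block_diagonal N A \<longleftrightarrow> (\<exists>\<alpha>. A = op_sum N (\<lambda>(x, y). \<alpha> x y \<cdot>\<^sub>m ketbra N x y)
     (even_states N \<times> even_states N \<union> odd_states N \<times> odd_states N))"

definition anti_block_diagonal :: "nat \<Rightarrow> complex mat \<Rightarrow> bool" where
  "anti_block_diagonal N A \<longleftrightarrow> (\<exists>\<alpha>. A = op_sum N (\<lambda>(x, y). \<alpha> x y \<cdot>\<^sub>m ketbra N x y)
     (even_states N \<times> odd_states N \<union> odd_states N \<times> even_states N))"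

definition conj_mat :: "complex mat \<Rightarrow> complex mat" where
  "conj_mat A = map_mat cnj A"

definition parity_op :: "nat \<Rightarrow> complex mat" where
  "parity_op N = op_sum N (\<lambda>x. (- 1) ^ card (set_decode x) \<cdot>\<^sub>m ketbra N x x) {..<2 ^ N}"

text \<open>
  In the third conjunct \<open>\<le>\<close> is the order of \<open>\<complex>\<close> in which \<open>0 \<le> z\<close> means that \<open>z\<close> is real and
  nonnegative.
\<close>

definition fermionic_state :: "nat \<Rightarrow> complex mat \<Rightarrow> bool" where
  "fermionic_state N \<rho> \<longleftrightarrow>
     \<rho> \<in> operators N \<and>
     mat_adjoint \<rho> = \<rho> \<and>
     (\<forall>v \<in> carrier_vec (2 ^ N). 0 \<le> (\<rho> *\<^sub>v v) \<bullet>c v) \<and>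
     (\<Sum>x<2 ^ N. \<rho> $$ (x, x)) = 1 \<and>
     \<rho> * parity_op N = parity_op N * \<rho>"


section \<open>Pauli group and restricted Clifford set\<close>

definition sigma_x :: "complex mat" where
  "sigma_x = ketbra 1 0 1 + ketbra 1 1 0"

definition sigma_y :: "complex mat" where
  "sigma_y = (- \<i>) \<cdot>\<^sub>m ketbra 1 0 1 + \<i> \<cdot>\<^sub>m ketbra 1 1 0"

definition sigma_z :: "complex mat" where
  "sigma_z = ketbra 1 0 0 - ketbra 1 1 1"

definition pauli_group :: "nat \<Rightarrow> complex mat set" where
  "pauli_group N = {\<alpha> \<cdot>\<^sub>m wedge_seq Ps | \<alpha> Ps.
     \<alpha> \<in> {1, - 1, \<i>, - \<i>} \<and> length Ps = N \<and> set Ps \<subseteq> {1\<^sub>m 2, sigma_x, sigma_y, sigma_z}}"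

definition unitary_group :: "nat \<Rightarrow> complex mat set" where
  "unitary_group N = {U \<in> operators N.
     U * mat_adjoint U = 1\<^sub>m (2 ^ N) \<and> mat_adjoint U * U = 1\<^sub>m (2 ^ N)}"

definition clifford_group :: "nat \<Rightarrow> complex mat set" where
  "clifford_group N = {C \<in> unitary_group N.
     (\<lambda>P. C * P * mat_adjoint C) ` pauli_group N = pauli_group N}"

definition pauli_BD :: "nat \<Rightarrow> complex mat set" where
  "pauli_BD N = {P \<in> pauli_group N. block_diagonal N P}"

definition pauli_ABD :: "nat \<Rightarrow> complex mat set" where
  "pauli_ABD N = {P \<in> pauli_group N. anti_block_diagonal N P}"

definition restricted_clifford :: "nat \<Rightarrow> complex mat set" where
  "restricted_clifford N = {C \<in> clifford_group N.
     (\<forall>P \<in> pauli_BD N. C * P * mat_adjoint C \<in> pauli_BD N) \<and>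
     (\<forall>P \<in> pauli_ABD N. C * P * mat_adjoint C \<in> pauli_ABD N)}"

definition phase_equiv :: "(complex mat \<times> complex mat) set" where
  "phase_equiv = {(U, V). \<exists>\<alpha>. cmod \<alpha> = 1 \<and> V = \<alpha> \<cdot>\<^sub>m U}"

definition restricted_clifford_classes :: "nat \<Rightarrow> complex mat set set" where
  "restricted_clifford_classes N = restricted_clifford N // phase_equiv"


section \<open>The twirl\<close>

text \<open>
  The sums run over classes modulo global phase; the summands do not depend on the
  representative picked by \<open>SOME\<close> (lemmas \<open>twirl_summand_phase\<close> and
  \<open>twirl_adj_summand_phase\<close> below).
\<close>

definition twirl_summand :: "nat \<Rightarrow> complex mat \<Rightarrow> complex mat \<Rightarrow> complex mat" where
  "twirl_summand N \<rho> c =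
     wedge N N c (conj_mat c) * \<rho> * wedge N N (mat_adjoint c) (mat_adjoint (conj_mat c))"

definition twirl_adj_summand :: "nat \<Rightarrow> complex mat \<Rightarrow> complex mat \<Rightarrow> complex mat" where
  "twirl_adj_summand N \<rho> c =
     wedge N N (mat_adjoint c) (mat_adjoint (conj_mat c)) * \<rho> * wedge N N c (conj_mat c)"

definition twirl :: "nat \<Rightarrow> complex mat \<Rightarrow> complex mat" where
  "twirl N \<rho> = (1 / of_nat (card (restricted_clifford_classes N))) \<cdot>\<^sub>m
     op_sum (N + N) (\<lambda>K. twirl_summand N \<rho> (SOME c. c \<in> K)) (restricted_clifford_classes N)"

definition twirl_adj :: "nat \<Rightarrow> complex mat \<Rightarrow> complex mat" where
  "twirl_adj N \<rho> = (1 / of_nat (card (restricted_clifford_classes N))) \<cdot>\<^sub>m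
     op_sum (N + N) (\<lambda>K. twirl_adj_summand N \<rho> (SOME c. c \<in> K)) (restricted_clifford_classes N)"


section \<open>Parity-resolved operators on \<open>N \<times> N\<close> modes\<close>

definition parity_string :: "nat \<Rightarrow> complex mat" where
  "parity_string N = wedge_seq (replicate N sigma_z)"

definition I_EE :: "nat \<Rightarrow> complex mat" where
  "I_EE N =
     op_sum (N + N) (\<lambda>(i, j). wedge N N (ketbra N i i) (ketbra N j j))
       (even_states N \<times> even_states N) +
     op_sum (N + N) (\<lambda>(i, j). wedge N N (ketbra N i i) (ketbra N j j))
       (odd_states N \<times> odd_states N)"

definition I_OO :: "nat \<Rightarrow> complex mat" where
  "I_OO N =
     op_sum (N + N) (\<lambda>(i, j). wedge N N (ketbra N i i) (ketbra N j j))
       (even_states N \<times> odd_states N) +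
     op_sum (N + N) (\<lambda>(i, j). wedge N N (ketbra N i i) (ketbra N j j))
       (odd_states N \<times> even_states N)"

definition H_EE :: "nat \<Rightarrow> complex mat" where
  "H_EE N =
     op_sum (N + N) (\<lambda>(i, j). wedge N N (ketbra N i j) (ketbra N j i))
       (even_states N \<times> even_states N) +
     op_sum (N + N) (\<lambda>(i, j). wedge N N (ketbra N i j) (ketbra N j i))
       (odd_states N \<times> odd_states N)"

definition H_OO :: "nat \<Rightarrow> complex mat" where
  "H_OO N =
     op_sum (N + N) (\<lambda>(i, j). wedge N N (ketbra N i j) (ketbra N j i))
       (even_states N \<times> odd_states N) +
     op_sum (N + N) (\<lambda>(i, j). wedge N N (ketbra N i j) (ketbra N j i))
       (odd_states N \<times> even_states N)"

definition Psi_EE :: "nat \<Rightarrow> complex mat" where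
  "Psi_EE N = partial_transpose N (H_EE N)"

definition Psi_EO :: "nat \<Rightarrow> complex mat" where
  "Psi_EO N = partial_transpose N (H_OO N)"


section \<open>Consistency of the conventions\<close>

text \<open>
  The kets built from creation operators are the coordinate vectors, so matrix entries
  are coefficients in the occupation-number basis.
\<close>

lemma set_decode_less_bound:
  assumes "x < 2 ^ N" "k \<in> set_decode x"
  shows "k < N"
proof (rule ccontr)
  assume "\<not> k < N"
  hence "(2::nat) ^ N \<le> 2 ^ k" by simp
  hence "x div 2 ^ k = 0" using assms(1) by (intro div_less) linarith
  thus False using assms(2) by (simp add: set_decode_def)
qed

lemma set_encode_bound:
  assumes "A \<subseteq> {..<N}"
  shows "set_encode A < 2 ^ N"
proof -
  have "set_encode A \<le> (\<Sum>i<N. 2 ^ i)"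
    unfolding set_encode_def using assms by (intro sum_mono2) auto
  also have "\<dots> = 2 ^ N - 1"
    using sum_power2[of N] by (simp add: lessThan_atLeast0)
  finally show ?thesis
    by (metis One_nat_def Suc_pred less_Suc_eq_le zero_less_numeral zero_less_power)
qed

lemma creation_unit_vec:
  assumes A: "A \<subseteq> {..<N}" and k: "k < N" "\<forall>j\<in>A. k < j"
  shows "creation N k *\<^sub>v unit_vec (2 ^ N) (set_encode A)
       = unit_vec (2 ^ N) (set_encode (insert k A))"
proof -
  have fin: "finite A" using A finite_subset by blast
  have b: "set_encode A < 2 ^ N" by (rule set_encode_bound[OF A])
  have sgn: "{j \<in> A. j < k} = {}" using k(2) by fastforce
  have notin: "k \<notin> A" using k(2) by auto
  have dec: "set_decode r = insert k A \<longleftrightarrow> r = set_encode (insert k A)" for r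
    using fin by (metis finite_insert set_decode_inverse set_encode_inverse)
  show ?thesis
  proof (rule eq_vecI)
    fix r assume "r < dim_vec (unit_vec (2 ^ N) (set_encode (insert k A)) :: complex vec)"
    hence r: "r < 2 ^ N" by simp
    have "(creation N k *\<^sub>v unit_vec (2 ^ N) (set_encode A)) $ r
        = creation N k $$ (r, set_encode A)"
      using r b by (simp add: creation_def)
    also have "\<dots> = (if r = set_encode (insert k A) then 1 else 0)"
      using r b fin notin by (simp add: creation_def sgn dec del: set_encode_insert)
    also have "\<dots> = unit_vec (2 ^ N) (set_encode (insert k A)) $ r"
      using r by (simp add: unit_vec_def del: set_encode_insert)
    finally show "(creation N k *\<^sub>v unit_vec (2 ^ N) (set_encode A)) $ r
        = unit_vec (2 ^ N) (set_encode (insert k A)) $ r" .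
  qed (simp add: creation_def)
qed

lemma create_seq_sorted:
  assumes "sorted_wrt (<) ks" "set ks \<subseteq> {..<N}"
  shows "create_seq N ks = unit_vec (2 ^ N) (set_encode (set ks))"
  using assms
proof (induction ks)
  case Nil
  then show ?case by (simp add: create_seq_def vacuum_def)
next
  case (Cons k ks)
  have "create_seq N (k # ks) = creation N k *\<^sub>v create_seq N ks"
    by (simp add: create_seq_def)
  also have "create_seq N ks = unit_vec (2 ^ N) (set_encode (set ks))"
    using Cons by simp
  also have "creation N k *\<^sub>v \<dots> = unit_vec (2 ^ N) (set_encode (insert k (set ks)))"
    using Cons.prems by (intro creation_unit_vec) auto
  finally show ?case by simp
qed

lemma ket_eq_unit_vec:
  assumes "x < 2 ^ N"
  shows "ket N x = unit_vec (2 ^ N) x"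
proof -
  have "create_seq N (modes x) = unit_vec (2 ^ N) (set_encode (set (modes x)))"
    using set_decode_less_bound[OF assms]
    by (intro create_seq_sorted) (auto simp: modes_def)
  thus ?thesis by (simp add: ket_def modes_def)
qed

lemma wedge_ket_eq_unit_vec:
  assumes x: "x < 2 ^ M" and y: "y < 2 ^ N"
  shows "wedge_ket M N x y = unit_vec (2 ^ (M + N)) (x + 2 ^ M * y)"
proof -
  let ?ks = "modes x @ map (\<lambda>k. M + k) (modes y)"
  have bx: "set_decode x \<subseteq> {..<M}" using set_decode_less_bound[OF x] by auto
  have by': "set_decode y \<subseteq> {..<N}" using set_decode_less_bound[OF y] by auto
  have srt: "sorted_wrt (<) ?ks"
    using bx by (auto simp: modes_def sorted_wrt_append sorted_wrt_map)
  have set: "set ?ks = set_decode x \<union> (\<lambda>k. M + k) ` set_decode y"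
    by (simp add: modes_def)
  have "set_encode (set ?ks) = set_encode (set_decode x) + sum ((^) 2) ((\<lambda>k. M + k) ` set_decode y)"
    unfolding set set_encode_def using bx by (intro sum.union_disjoint) auto
  also have "sum ((^) 2) ((\<lambda>k. M + k) ` set_decode y) = 2 ^ M * set_encode (set_decode y)"
    unfolding set_encode_def sum_distrib_left by (subst sum.reindex) (auto simp: power_add)
  finally have enc: "set_encode (set ?ks) = x + 2 ^ M * y" by simp
  have "set ?ks \<subseteq> {..<M + N}" unfolding set using bx by' by fastforce
  from create_seq_sorted[OF srt this] show ?thesis
    unfolding wedge_ket_def enc .
qed

lemma wedge_dim [simp]: "wedge M N A B \<in> operators (M + N)"
  by (simp add: wedge_def op_sum_def)

lemma wedge_index:
  assumes r: "r < 2 ^ (M + N)" and c: "c < 2 ^ (M + N)"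
  shows "wedge M N A B $$ (r, c)
       = A $$ (r mod 2 ^ M, c mod 2 ^ M) * B $$ (r div 2 ^ M, c div 2 ^ M)"
proof -
  let ?I = "({..<(2::nat) ^ M} \<times> {..<(2::nat) ^ M}) \<times> ({..<(2::nat) ^ N} \<times> {..<(2::nat) ^ N})"
  let ?t = "((r mod 2 ^ M, c mod 2 ^ M), (r div 2 ^ M, c div 2 ^ M))"
  let ?f = "\<lambda>((x, x'), (y, y')). (A $$ (x, x') * B $$ (y, y'))"
  have mem: "?t \<in> ?I"
    using r c by (auto simp: less_mult_imp_div_less power_add mult.commute)
  have bound: "x + 2 ^ M * y < 2 ^ (M + N)" if "x < 2 ^ M" "y < (2::nat) ^ N" for x y
  proof -
    have "x + 2 ^ M * y < 2 ^ M * (y + 1)" using that by simp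
    also have "\<dots> \<le> 2 ^ M * 2 ^ N" using that by (intro mult_left_mono) auto
    finally show ?thesis by (simp add: power_add)
  qed
  have split: "s = x + 2 ^ M * y \<longleftrightarrow> x = s mod 2 ^ M \<and> y = s div 2 ^ M"
    if "x < 2 ^ M" for s x y :: nat
    using that by auto
  have "wedge M N A B $$ (r, c) = (\<Sum>t\<in>?I. if t = ?t then ?f t else 0)"
    unfolding wedge_def op_sum_def index_mat(1)[OF r c] prod.case
  proof (rule sum.cong[OF refl])
    fix t assume "t \<in> ?I"
    then obtain x x' y y' where t: "t = ((x, x'), (y, y'))"
      and b: "x < 2 ^ M" "x' < 2 ^ M" "y < 2 ^ N" "y' < 2 ^ N"
      by auto
    have "outer (wedge_ket M N x y) (wedge_ket M N x' y') $$ (r, c)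
        = (if r = x + 2 ^ M * y \<and> c = x' + 2 ^ M * y' then 1 else 0)"
      using r c b by (simp add: wedge_ket_eq_unit_vec outer_def bound unit_vec_def)
    also have "\<dots> = (if t = ?t then 1 else 0)"
      unfolding split[OF b(1)] split[OF b(2)] t by auto
    finally show "(case t of (p, q) \<Rightarrow> (case p of (x, x') \<Rightarrow> \<lambda>(y, y').
        (A $$ (x, x') * B $$ (y, y')) \<cdot>\<^sub>m
        outer (wedge_ket M N x y) (wedge_ket M N x' y')) q) $$ (r, c)
      = (if t = ?t then ?f t else 0)"
      using r c b by (simp add: t outer_def wedge_ket_eq_unit_vec)
  qed
  also have "\<dots> = ?f ?t" using mem by (subst sum.delta) auto
  finally show ?thesis by simp
qed

lemma mat_adjoint_index:
  assumes "i < dim_col A" "j < dim_row A"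
  shows "mat_adjoint A $$ (i, j) = conjugate (A $$ (j, i))"
  using assms by (simp add: mat_adjoint_def mat_of_rows_index)

lemma mat_adjoint_dims [simp]:
  "dim_row (mat_adjoint A) = dim_col A" "dim_col (mat_adjoint A) = dim_row A"
  by (simp_all add: mat_adjoint_def)

lemma wedge_phase:
  assumes "A \<in> operators M" "B \<in> operators N" "\<alpha> * \<beta> = 1"
  shows "wedge M N (\<alpha> \<cdot>\<^sub>m A) (\<beta> \<cdot>\<^sub>m B) = wedge M N A B"
proof (rule eq_matI)
  fix r c assume "r < dim_row (wedge M N A B)" "c < dim_col (wedge M N A B)"
  hence rc: "r < 2 ^ (M + N)" "c < 2 ^ (M + N)" using wedge_dim[of M N A B] by auto
  hence "r div 2 ^ M < 2 ^ N" "c div 2 ^ M < 2 ^ N"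
    by (simp_all add: less_mult_imp_div_less power_add mult.commute)
  moreover have "\<alpha> * a * (\<beta> * b) = a * b" for a b
  proof -
    have "\<alpha> * a * (\<beta> * b) = \<alpha> * \<beta> * (a * b)" by simp
    thus ?thesis using assms(3) by simp
  qed
  ultimately show "wedge M N (\<alpha> \<cdot>\<^sub>m A) (\<beta> \<cdot>\<^sub>m B) $$ (r, c) = wedge M N A B $$ (r, c)"
    using assms(1,2) rc by (simp add: wedge_index)
qed (simp_all add: wedge_def op_sum_def)

lemma adjoint_phase:
  assumes "c \<in> operators N"
  shows "conj_mat (\<alpha> \<cdot>\<^sub>m c) = cnj \<alpha> \<cdot>\<^sub>m conj_mat c"
    and "mat_adjoint (\<alpha> \<cdot>\<^sub>m c) = cnj \<alpha> \<cdot>\<^sub>m mat_adjoint c"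
    and "mat_adjoint (conj_mat (\<alpha> \<cdot>\<^sub>m c)) = \<alpha> \<cdot>\<^sub>m mat_adjoint (conj_mat c)"
  using assms by (auto intro!: eq_matI simp: conj_mat_def mat_adjoint_index)

lemma
  assumes "c \<in> operators N" "cmod \<alpha> = 1"
  shows twirl_summand_phase: "twirl_summand N \<rho> (\<alpha> \<cdot>\<^sub>m c) = twirl_summand N \<rho> c"
    and twirl_adj_summand_phase: "twirl_adj_summand N \<rho> (\<alpha> \<cdot>\<^sub>m c) = twirl_adj_summand N \<rho> c"
proof -
  have a: "\<alpha> * cnj \<alpha> = 1" "cnj \<alpha> * \<alpha> = 1"
    using assms(2) complex_norm_square[of \<alpha>] by (simp_all add: mult.commute)
  have d: "conj_mat c \<in> operators N" "mat_adjoint c \<in> operators N"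
    "mat_adjoint (conj_mat c) \<in> operators N"
    using assms(1) by (auto simp: conj_mat_def intro!: carrier_matI)
  show "twirl_summand N \<rho> (\<alpha> \<cdot>\<^sub>m c) = twirl_summand N \<rho> c"
    "twirl_adj_summand N \<rho> (\<alpha> \<cdot>\<^sub>m c) = twirl_adj_summand N \<rho> c"
    using assms(1) d a
    by (simp_all add: twirl_summand_def twirl_adj_summand_def adjoint_phase wedge_phase)
qed

end

theory Submission
  imports Defs
begin

text \<open>
  The twirl is the projection onto the operators commuting with all \<open>c \<and> c\<^sup>*\<close>, so everything
  reduces to describing those.  Every Pauli operator lies in the restricted Clifford set, and
  invariance under it forces an operator into the span of the \<open>A \<and> A\<^sup>*\<close> with \<open>A\<close> a Pauli
  operator.  The coefficients are constant on the orbits of the restricted Clifford set on Pauli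
  operators modulo phase.  The gates \<open>(P + Q) / \<surd>2\<close>, for anticommuting Hermitian Pauli operators
  \<open>P\<close>, \<open>Q\<close> of equal parity, show that there are at most four orbits: the identity, the parity
  string, the other block-diagonal operators, and the anti-block-diagonal ones.  The operators
  \<open>1 \<and> 1\<close>, \<open>S \<and> S\<close> and the projectors onto the two maximally entangled vectors, the second twisted
  by the parity string \<open>S\<close>, realise all coefficient functions constant on the orbits, and they
  span the same space as the four parity-resolved operators.
\<close>


section \<open>Matrices and wedge products\<close>

text \<open>Because the creation operators of the left factor precede those of the right one,
  \<open>wedge\<close> has the entries of a Kronecker product, the left index being the low binary
  digits; no fermionic sign survives at the level of matrix entries. No operator is ever expanded in
  Pauli operators. Spanning is expressed through the trace pairing, so an operator vanishes once its
  traces against enough wedge products vanish. Conjugation by the doubled Pauli operator R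
  multiplies the wedge of A and conj B by the product of the two commutation signs; if A and B are
  not proportional, some R makes this product - 1, and the trace must vanish. For A = B a phase of A
  cancels against its conjugate, so what remains is a function on Pauli operators modulo phase. The
  orbits themselves are not determined. An upper bound suffices, because explicit invariants attain
  any prescribed values on the four classes, and an empty class only leaves a value free. This
  happens for N = 1, where any two block-diagonal Pauli operators commute. The assumption N \<ge> 1
  enters because the parity string must not be scalar.\<close>

lemma mult_mat_entry:
  assumes "i < dim_row A" "j < dim_col B" "dim_col A = dim_row B"
  shows "(A * B) $$ (i, j) = (\<Sum>k<dim_row B. A $$ (i, k) * B $$ (k, j))"
  using assms by (simp add: scalar_prod_def atLeast0LessThan)

lemma mat_mult_assoc:
  fixes A :: "'a :: semiring_0 mat"
  assumes "dim_col A = dim_row B" "dim_col B = dim_row C"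
  shows "A * B * C = A * (B * C)"
  using assms by (intro assoc_mult_mat[of _ "dim_row A" "dim_col A" _ "dim_col B" _ "dim_col C"]) auto

lemma mat_mult_smult:
  fixes A :: "'a :: comm_semiring_0 mat"
  assumes "dim_col A = dim_row B"
  shows "A * (k \<cdot>\<^sub>m B) = k \<cdot>\<^sub>m (A * B)" "(k \<cdot>\<^sub>m A) * B = k \<cdot>\<^sub>m (A * B)"
  using assms by (auto intro: mult_smult_distrib[of _ "dim_row A" "dim_col A" _ "dim_col B"]
      mult_smult_assoc_mat[of _ "dim_row A" "dim_col A" _ "dim_col B"])

lemma mat_mult_add:
  fixes A :: "'a :: semiring_0 mat"
  assumes "dim_col A = dim_row B" "dim_row B = dim_row C" "dim_col B = dim_col C"
  shows "A * (B + C) = A * B + A * C"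
  using assms by (intro mult_add_distrib_mat[of _ "dim_row A" "dim_col A" _ "dim_col C"]) auto

lemma mat_add_mult:
  fixes A :: "'a :: semiring_0 mat"
  assumes "dim_col A = dim_row C" "dim_row A = dim_row B" "dim_col A = dim_col B"
  shows "(A + B) * C = A * C + B * C"
  using assms by (intro add_mult_distrib_mat[of _ "dim_row A" "dim_col A" _ _ "dim_col C"]) auto

lemma smult_one_mat [simp]: "(1 :: 'a :: monoid_mult) \<cdot>\<^sub>m A = A"
  by (rule eq_matI) auto

lemma smult_smult_mat: "a \<cdot>\<^sub>m (b \<cdot>\<^sub>m A) = (a * b :: 'a :: semigroup_mult) \<cdot>\<^sub>m A"
  by (rule eq_matI) (auto simp: mult.assoc)

lemma adjoint_mult:
  fixes A B :: "complex mat"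
  assumes "dim_col A = dim_row B"
  shows "mat_adjoint (A * B) = mat_adjoint B * mat_adjoint A"
  using assms
  by (intro eq_matI) (simp_all add: mat_adjoint_index mult_mat_entry del: index_mult_mat(1), simp add: mult.commute)

lemma adjoint_adjoint [simp]: "mat_adjoint (mat_adjoint A) = (A :: complex mat)"
  by (rule eq_matI) (simp_all add: mat_adjoint_index)

lemma adjoint_smult: "mat_adjoint (k \<cdot>\<^sub>m A) = cnj k \<cdot>\<^sub>m mat_adjoint A"
  by (rule eq_matI) (simp_all add: mat_adjoint_index)

lemma adjoint_add:
  assumes "dim_row A = dim_row B" "dim_col A = dim_col B"
  shows "mat_adjoint (A + B) = mat_adjoint A + mat_adjoint (B :: complex mat)"
  using assms by (intro eq_matI) (simp_all add: mat_adjoint_index)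

lemma adjoint_one [simp]: "mat_adjoint (1\<^sub>m n) = (1\<^sub>m n :: complex mat)"
  by (rule eq_matI) (simp_all add: mat_adjoint_index)

lemma conj_mat_dims [simp]:
  "dim_row (conj_mat A) = dim_row A" "dim_col (conj_mat A) = dim_col A"
  by (simp_all add: conj_mat_def)

lemma conj_mat_index [simp]:
  "i < dim_row A \<Longrightarrow> j < dim_col A \<Longrightarrow> conj_mat A $$ (i, j) = cnj (A $$ (i, j))"
  by (simp add: conj_mat_def)

lemma conj_conj_mat [simp]: "conj_mat (conj_mat A) = A"
  by (rule eq_matI) simp_all

lemma conj_mat_mult:
  assumes "dim_col A = dim_row B"
  shows "conj_mat (A * B) = conj_mat A * conj_mat B"
  using assms by (intro eq_matI) (simp_all add: mult_mat_entry del: index_mult_mat(1))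

lemma conj_mat_smult: "conj_mat (k \<cdot>\<^sub>m A) = cnj k \<cdot>\<^sub>m conj_mat A"
  by (rule eq_matI) simp_all

lemma conj_mat_one [simp]: "conj_mat (1\<^sub>m n) = 1\<^sub>m n"
  by (rule eq_matI) simp_all

lemma adjoint_conj_mat: "mat_adjoint (conj_mat A) = conj_mat (mat_adjoint A)"
  by (rule eq_matI) (simp_all add: mat_adjoint_index)

section \<open>The trace and its cyclicity\<close>

definition mat_trace :: "complex mat \<Rightarrow> complex" where
  "mat_trace A = (\<Sum>i<dim_row A. A $$ (i, i))"

lemma mat_trace_mult:
  assumes "dim_col A = dim_row B" "dim_col B = dim_row A"
  shows "mat_trace (A * B) = (\<Sum>i<dim_row A. \<Sum>j<dim_row B. A $$ (i, j) * B $$ (j, i))"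
  using assms by (simp add: mat_trace_def mult_mat_entry del: index_mult_mat(1))

lemma mat_trace_comm:
  assumes "dim_col A = dim_row B" "dim_col B = dim_row A"
  shows "mat_trace (A * B) = mat_trace (B * A)"
  using assms by (subst (1 2) mat_trace_mult) (simp_all, subst sum.swap, simp add: mult.commute)

lemma mat_trace_smult: "dim_row A = dim_col A \<Longrightarrow> mat_trace (k \<cdot>\<^sub>m A) = k * mat_trace A"
  by (simp add: mat_trace_def sum_distrib_left)

lemma mat_trace_add:
  "dim_row A = dim_row B \<Longrightarrow> dim_row B = dim_col A \<Longrightarrow> dim_row B = dim_col B \<Longrightarrow>
   mat_trace (A + B) = mat_trace A + mat_trace B"
  by (simp add: mat_trace_def sum.distrib)

lemma mat_trace_one: "mat_trace (1\<^sub>m n) = of_nat n"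
  by (simp add: mat_trace_def)

lemma mat_trace_conj: "dim_row A = dim_col A \<Longrightarrow> mat_trace (conj_mat A) = cnj (mat_trace A)"
  by (simp add: mat_trace_def)

text \<open>An index below m * n is a pair of digits, so one sum over a composite system is a double
  sum over its factors.\<close>

lemma sum_mod_div:
  fixes g :: "nat \<Rightarrow> nat \<Rightarrow> 'a :: comm_monoid_add"
  assumes "m > 0"
  shows "(\<Sum>k<m * n. g (k mod m) (k div m)) = (\<Sum>i<m. \<Sum>j<n. g i j)"
proof -
  have "(\<Sum>k<m * n. g (k mod m) (k div m)) = (\<Sum>(i, j)\<in>{..<m} \<times> {..<n}. g i j)"
  proof (rule sum.reindex_bij_witness[where i = "\<lambda>(i, j). i + m * j" and j = "\<lambda>k. (k mod m, k div m)"])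
    fix b assume "b \<in> {..<m} \<times> {..<n}"
    then obtain i j where b: "b = (i, j)" "i < m" "j < n" by auto
    have "i + m * j < m * Suc j" using b by simp
    also have "\<dots> \<le> m * n" using b by (intro mult_left_mono) auto
    finally show "(case b of (i, j) \<Rightarrow> i + m * j) \<in> {..<m * n}" using b by simp
  qed (use assms in \<open>auto simp: less_mult_imp_div_less mult.commute\<close>)
  thus ?thesis by (simp add: sum.cartesian_product)
qed

section \<open>The wedge product as a Kronecker product\<close>

lemma wedge_dims [simp]:
  "dim_row (wedge M N A B) = 2 ^ (M + N)" "dim_col (wedge M N A B) = 2 ^ (M + N)"
  by (simp_all add: wedge_def op_sum_def)

lemma mod_div_less:
  assumes "r < 2 ^ (M + N)"
  shows "r mod 2 ^ M < (2 :: nat) ^ M" "r div 2 ^ M < (2 :: nat) ^ N"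
  using assms by (simp_all add: less_mult_imp_div_less power_add mult.commute)

lemma pair_index_less:
  assumes "x < 2 ^ M" "y < (2 :: nat) ^ N"
  shows "x + 2 ^ M * y < 2 ^ (M + N)"
proof -
  have "x + 2 ^ M * y < 2 ^ M * (y + 1)" using assms by simp
  also have "\<dots> \<le> 2 ^ M * 2 ^ N" using assms by (intro mult_left_mono) auto
  finally show ?thesis by (simp add: power_add)
qed

lemma wedge_mult:
  assumes "A \<in> operators M" "B \<in> operators N" "C \<in> operators M" "D \<in> operators N"
  shows "wedge M N A B * wedge M N C D = wedge M N (A * C) (B * D)"
proof (rule eq_matI)
  fix r c assume "r < dim_row (wedge M N (A * C) (B * D))" "c < dim_col (wedge M N (A * C) (B * D))"
  hence rc: "r < 2 ^ (M + N)" "c < 2 ^ (M + N)" by simp_all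
  note b = mod_div_less[OF rc(1)] mod_div_less[OF rc(2)]
  have "(wedge M N A B * wedge M N C D) $$ (r, c)
      = (\<Sum>k<2 ^ M * 2 ^ N. (A $$ (r mod 2 ^ M, k mod 2 ^ M) * C $$ (k mod 2 ^ M, c mod 2 ^ M)) *
          (B $$ (r div 2 ^ M, k div 2 ^ M) * D $$ (k div 2 ^ M, c div 2 ^ M)))"
    using rc by (subst mult_mat_entry) (auto simp: wedge_index power_add intro!: sum.cong)
  also have "\<dots> = (\<Sum>i<2 ^ M. \<Sum>j<2 ^ N. (A $$ (r mod 2 ^ M, i) * C $$ (i, c mod 2 ^ M)) *
          (B $$ (r div 2 ^ M, j) * D $$ (j, c div 2 ^ M)))"
    by (subst sum_mod_div[symmetric]) simp_all
  also have "\<dots> = (A * C) $$ (r mod 2 ^ M, c mod 2 ^ M) * (B * D) $$ (r div 2 ^ M, c div 2 ^ M)"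
    using assms b by (subst (1 2) mult_mat_entry) (auto simp: sum_product)
  also have "\<dots> = wedge M N (A * C) (B * D) $$ (r, c)"
    using rc by (simp add: wedge_index)
  finally show "(wedge M N A B * wedge M N C D) $$ (r, c) = wedge M N (A * C) (B * D) $$ (r, c)" .
qed simp_all

lemma wedge_one [simp]: "wedge M N (1\<^sub>m (2 ^ M)) (1\<^sub>m (2 ^ N)) = 1\<^sub>m (2 ^ (M + N))"
proof (rule eq_matI)
  fix r c :: nat assume "r < dim_row (1\<^sub>m (2 ^ (M + N)) :: complex mat)" "c < dim_col (1\<^sub>m (2 ^ (M + N)) :: complex mat)"
  hence rc: "r < 2 ^ (M + N)" "c < 2 ^ (M + N)" by simp_all
  have "r = c \<longleftrightarrow> r mod 2 ^ M = c mod 2 ^ M \<and> r div 2 ^ M = c div 2 ^ M"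
    by (metis div_mult_mod_eq)
  thus "wedge M N (1\<^sub>m (2 ^ M)) (1\<^sub>m (2 ^ N)) $$ (r, c) = 1\<^sub>m (2 ^ (M + N)) $$ (r, c)"
    using rc mod_div_less[OF rc(1)] mod_div_less[OF rc(2)] by (auto simp: wedge_index)
qed simp_all

lemma wedge_smult:
  assumes "A \<in> operators M" "B \<in> operators N"
  shows "wedge M N (a \<cdot>\<^sub>m A) (b \<cdot>\<^sub>m B) = (a * b) \<cdot>\<^sub>m wedge M N A B"
proof (rule eq_matI)
  fix r c assume "r < dim_row ((a * b) \<cdot>\<^sub>m wedge M N A B)" "c < dim_col ((a * b) \<cdot>\<^sub>m wedge M N A B)"
  hence rc: "r < 2 ^ (M + N)" "c < 2 ^ (M + N)" by simp_all
  thus "wedge M N (a \<cdot>\<^sub>m A) (b \<cdot>\<^sub>m B) $$ (r, c) = ((a * b) \<cdot>\<^sub>m wedge M N A B) $$ (r, c)"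
    using assms mod_div_less[OF rc(1)] mod_div_less[OF rc(2)] by (simp add: wedge_index)
qed simp_all

lemma wedge_adjoint:
  assumes "A \<in> operators M" "B \<in> operators N"
  shows "mat_adjoint (wedge M N A B) = wedge M N (mat_adjoint A) (mat_adjoint B)"
proof (rule eq_matI)
  fix r c assume "r < dim_row (wedge M N (mat_adjoint A) (mat_adjoint B))"
    "c < dim_col (wedge M N (mat_adjoint A) (mat_adjoint B))"
  hence rc: "r < 2 ^ (M + N)" "c < 2 ^ (M + N)" by simp_all
  thus "mat_adjoint (wedge M N A B) $$ (r, c) = wedge M N (mat_adjoint A) (mat_adjoint B) $$ (r, c)"
    using assms mod_div_less[OF rc(1)] mod_div_less[OF rc(2)]
    by (simp add: wedge_index mat_adjoint_index)
qed simp_all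

lemma mat_trace_wedge:
  assumes "A \<in> operators M" "B \<in> operators N"
  shows "mat_trace (wedge M N A B) = mat_trace A * mat_trace B"
proof -
  have "mat_trace (wedge M N A B)
      = (\<Sum>k<2 ^ M * 2 ^ N. A $$ (k mod 2 ^ M, k mod 2 ^ M) * B $$ (k div 2 ^ M, k div 2 ^ M))"
    unfolding mat_trace_def by (auto simp: wedge_index power_add intro!: sum.cong)
  also have "\<dots> = (\<Sum>i<2 ^ M. \<Sum>j<2 ^ N. A $$ (i, i) * B $$ (j, j))"
    by (subst sum_mod_div[symmetric]) simp_all
  also have "\<dots> = mat_trace A * mat_trace B"
    using assms by (auto simp: mat_trace_def sum_product)
  finally show ?thesis .
qed

text \<open>
  Spanning sets of the matrix algebra, in dual form: the trace pairing with the set has no kernel.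
\<close>

definition separating :: "nat \<Rightarrow> complex mat set \<Rightarrow> bool" where
  "separating n S \<longleftrightarrow>
     (\<forall>X \<in> carrier_mat n n. (\<forall>A \<in> S. mat_trace (A * X) = 0) \<longrightarrow> X = 0\<^sub>m n n)"

text \<open>Pairing X with a wedge product is done one factor at a time: trace out the right factor
  against B, then pair the result with A. Separation by S kills every such partial trace, and
  separation by T then kills every block of X.\<close>

lemma separating_wedge:
  assumes S: "S \<subseteq> operators M" "separating (2 ^ M) S"
    and T: "T \<subseteq> operators N" "separating (2 ^ N) T"
  shows "separating (2 ^ (M + N)) {wedge M N A B | A B. A \<in> S \<and> B \<in> T}"
  unfolding separating_def
proof (intro ballI impI)
  fix X :: "complex mat"
  assume X: "X \<in> carrier_mat (2 ^ (M + N)) (2 ^ (M + N))"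
    and 0: "\<forall>A\<in>{wedge M N A B | A B. A \<in> S \<and> B \<in> T}. mat_trace (A * X) = 0"
  \<comment> \<open>\<open>Y i j\<close> is the block of X with left indices i and j;
    \<open>Z B\<close> is the partial trace over the right factor of the product of 1 \<and> B with
    X.\<close>
  define Y where "Y = (\<lambda>i j. mat (2 ^ N) (2 ^ N) (\<lambda>(k, l). X $$ (i + 2 ^ M * k, j + 2 ^ M * l)))"
  define Z where "Z = (\<lambda>B. mat (2 ^ M) (2 ^ M) (\<lambda>(i, j). mat_trace (B * Y i j)))"
  have Yd[simp]: "dim_row (Y i j) = 2 ^ N" "dim_col (Y i j) = 2 ^ N" for i j
    by (simp_all add: Y_def)
  have Zd[simp]: "dim_row (Z B) = 2 ^ M" "dim_col (Z B) = 2 ^ M" for B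
    by (simp_all add: Z_def)
  have tr: "mat_trace (wedge M N A B * X) = mat_trace (A * Z B)"
    if A: "A \<in> operators M" and B: "B \<in> operators N" for A B
  proof -
    have "X $$ (s mod 2 ^ M + 2 ^ M * (s div 2 ^ M), r mod 2 ^ M + 2 ^ M * (r div 2 ^ M)) = X $$ (s, r)" for r s
      by (simp only: mod_mult_div_eq)
    hence "mat_trace (wedge M N A B * X)
       = (\<Sum>r<2^M * 2^N. \<Sum>s<2^M * 2^N. A $$ (r mod 2 ^ M, s mod 2 ^ M) * (B $$ (r div 2 ^ M, s div 2 ^ M)
            * X $$ (s mod 2 ^ M + 2 ^ M * (s div 2 ^ M), r mod 2 ^ M + 2 ^ M * (r div 2 ^ M))))"
      using X by (subst mat_trace_mult) (auto simp: wedge_index power_add mult.assoc intro!: sum.cong)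
    also have "\<dots> = (\<Sum>r<2^M * 2^N. \<Sum>j<2^M. \<Sum>l<2^N. A $$ (r mod 2 ^ M, j) * (B $$ (r div 2 ^ M, l)
            * X $$ (j + 2 ^ M * l, r mod 2 ^ M + 2 ^ M * (r div 2 ^ M))))"
      by (subst sum_mod_div[symmetric]) simp_all
    also have "\<dots> = (\<Sum>i<2^M. \<Sum>k<2^N. \<Sum>j<2^M. \<Sum>l<2^N. A $$ (i, j) * (B $$ (k, l)
            * X $$ (j + 2 ^ M * l, i + 2 ^ M * k)))"
      by (subst sum_mod_div[symmetric]) simp_all
    also have "\<dots> = (\<Sum>i<2^M. \<Sum>j<2^M. \<Sum>k<2^N. \<Sum>l<2^N. A $$ (i, j) * (B $$ (k, l)
            * X $$ (j + 2 ^ M * l, i + 2 ^ M * k)))"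
      by (rule sum.cong[OF refl], subst sum.swap) simp
    also have "\<dots> = (\<Sum>i<2^M. \<Sum>j<2^M. A $$ (i, j) * Z B $$ (j, i))"
      using B by (intro sum.cong refl)
        (simp add: Z_def mat_trace_mult Y_def sum_distrib_left)
    also have "\<dots> = mat_trace (A * Z B)"
      using A by (subst mat_trace_mult) auto
    finally show ?thesis .
  qed
  have "Z B = 0\<^sub>m (2 ^ M) (2 ^ M)" if "B \<in> T" for B
  proof -
    have "\<forall>A\<in>S. mat_trace (A * Z B) = 0"
    proof
      fix A assume A: "A \<in> S"
      hence "mat_trace (wedge M N A B * X) = 0" using that 0 by blast
      moreover have "A \<in> operators M" "B \<in> operators N" using A that S(1) T(1) by blast+
      ultimately show "mat_trace (A * Z B) = 0" using tr by simp
    qed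
    with S(2) show ?thesis unfolding separating_def by (metis Zd carrier_matI)
  qed
  hence "mat_trace (B * Y i j) = 0" if "B \<in> T" "i < 2 ^ M" "j < 2 ^ M" for B i j
    using that by (metis (no_types, lifting) Z_def case_prod_conv index_mat(1) index_zero_mat(1))
  hence Y0: "Y i j = 0\<^sub>m (2 ^ N) (2 ^ N)" if "i < 2 ^ M" "j < 2 ^ M" for i j
    using T(2) that unfolding separating_def by (metis Yd carrier_matI)
  show "X = 0\<^sub>m (2 ^ (M + N)) (2 ^ (M + N))"
  proof (rule eq_matI)
    fix r c :: nat assume "r < dim_row (0\<^sub>m (2 ^ (M + N)) (2 ^ (M + N)) :: complex mat)"
      "c < dim_col (0\<^sub>m (2 ^ (M + N)) (2 ^ (M + N)) :: complex mat)"
    hence rc: "r < 2 ^ (M + N)" "c < 2 ^ (M + N)" by simp_all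
    note b = mod_div_less[OF rc(1)] mod_div_less[OF rc(2)]
    have "X $$ (r, c) = Y (r mod 2 ^ M) (c mod 2 ^ M) $$ (r div 2 ^ M, c div 2 ^ M)"
      using b by (simp add: Y_def)
    also have "\<dots> = 0" using Y0[OF b(1) b(3)] b by simp
    finally show "X $$ (r, c) = 0\<^sub>m (2 ^ (M + N)) (2 ^ (M + N)) $$ (r, c)" using rc by simp
  qed (use X in simp_all)
qed

text \<open>The trace of conj A times X is the complex conjugate of the trace of A times conj
  X.\<close>

lemma separating_conj:
  assumes "separating n S" "S \<subseteq> carrier_mat n n"
  shows "separating n (conj_mat ` S)"
  unfolding separating_def
proof (intro ballI impI)
  fix X :: "complex mat"
  assume X: "X \<in> carrier_mat n n" and 0: "\<forall>A\<in>conj_mat ` S. mat_trace (A * X) = 0"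
  have "\<forall>A\<in>S. mat_trace (A * conj_mat X) = 0"
  proof
    fix A assume A: "A \<in> S"
    have "mat_trace (A * conj_mat X) = cnj (mat_trace (conj_mat A * X))"
      using A X assms(2) by (subst mat_trace_conj[symmetric]) (auto simp: conj_mat_mult)
    thus "mat_trace (A * conj_mat X) = 0" using 0 A by auto
  qed
  hence "conj_mat X = 0\<^sub>m n n"
    using assms(1) X unfolding separating_def by (auto simp: conj_mat_def)
  hence "conj_mat (conj_mat X) = conj_mat (0\<^sub>m n n)" by simp
  also have "\<dots> = 0\<^sub>m n n" by (rule eq_matI) auto
  finally show "X = 0\<^sub>m n n" by simp
qed


section \<open>The Pauli group\<close>

definition paulis :: "complex mat set" where
  "paulis = {1\<^sub>m 2, sigma_x, sigma_y, sigma_z}"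

definition phases :: "complex set" where
  "phases = {1, - 1, \<i>, - \<i>}"

lemma phases_mult: "\<alpha> \<in> phases \<Longrightarrow> \<beta> \<in> phases \<Longrightarrow> \<alpha> * \<beta> \<in> phases"
  by (auto simp: phases_def)

lemma phases_norm: "\<alpha> \<in> phases \<Longrightarrow> \<alpha> * cnj \<alpha> = 1"
  by (auto simp: phases_def)

lemma phases_cnj: "\<alpha> \<in> phases \<Longrightarrow> cnj \<alpha> \<in> phases"
  by (auto simp: phases_def)

lemma one_in_phases: "1 \<in> phases"
  by (simp add: phases_def)

lemma sigma_dims [simp]:
  "dim_row sigma_x = 2" "dim_col sigma_x = 2"
  "dim_row sigma_y = 2" "dim_col sigma_y = 2"
  "dim_row sigma_z = 2" "dim_col sigma_z = 2"
  by (simp_all add: sigma_x_def sigma_y_def sigma_z_def outer_def ket_eq_unit_vec)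

lemma sigma_index:
  assumes "r < 2" "c < 2"
  shows "sigma_x $$ (r, c) = (if r = c then 0 else 1)"
    and "sigma_y $$ (r, c) = (if r = c then 0 else if r = 0 then - \<i> else \<i>)"
    and "sigma_z $$ (r, c) = (if r = c then if r = 0 then 1 else - 1 else 0)"
  using assms
  by (auto simp: sigma_x_def sigma_y_def sigma_z_def outer_def ket_eq_unit_vec unit_vec_def less_2_cases_iff)

lemma mat2_eqI:
  assumes "dim_row A = 2" "dim_col A = 2" "dim_row B = 2" "dim_col B = 2"
    and "\<And>r c. r \<in> {0, 1} \<Longrightarrow> c \<in> {0, 1} \<Longrightarrow> A $$ (r, c) = B $$ (r, c)"
  shows "A = B"
  using assms by (intro eq_matI) (auto simp: less_2_cases_iff)

lemma sigma_mult:
  "sigma_x * sigma_x = 1\<^sub>m 2" "sigma_y * sigma_y = 1\<^sub>m 2" "sigma_z * sigma_z = 1\<^sub>m 2"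
  "sigma_x * sigma_y = \<i> \<cdot>\<^sub>m sigma_z" "sigma_y * sigma_x = (- \<i>) \<cdot>\<^sub>m sigma_z"
  "sigma_y * sigma_z = \<i> \<cdot>\<^sub>m sigma_x" "sigma_z * sigma_y = (- \<i>) \<cdot>\<^sub>m sigma_x"
  "sigma_z * sigma_x = \<i> \<cdot>\<^sub>m sigma_y" "sigma_x * sigma_z = (- \<i>) \<cdot>\<^sub>m sigma_y"
  by (rule mat2_eqI; force simp: mult_mat_entry sigma_index numeral_2_eq_2 simp del: index_mult_mat(1))+

lemma pauli_dims:
  assumes "A \<in> paulis"
  shows "dim_row A = 2" "dim_col A = 2" "A \<in> carrier_mat 2 2"
  using assms by (auto simp: paulis_def)

lemma one_in_paulis: "1\<^sub>m 2 \<in> paulis"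
  by (simp add: paulis_def)

lemma pauli_mult:
  assumes "A \<in> paulis" "B \<in> paulis"
  shows "\<exists>\<alpha>\<in>phases. \<exists>C\<in>paulis. A * B = \<alpha> \<cdot>\<^sub>m C"
proof (cases "A = B")
  case True
  hence "A * B = 1 \<cdot>\<^sub>m 1\<^sub>m 2" using assms by (auto simp: paulis_def sigma_mult)
  thus ?thesis using one_in_phases one_in_paulis by blast
next
  case False
  consider "A = 1\<^sub>m 2" | "B = 1\<^sub>m 2"
    | "A \<in> {sigma_x, sigma_y, sigma_z}" "B \<in> {sigma_x, sigma_y, sigma_z}"
    using assms unfolding paulis_def by blast
  thus ?thesis
  proof cases
    case 1
    hence "A * B = 1 \<cdot>\<^sub>m B" using pauli_dims[OF assms(2)] by simp
    with one_in_phases assms(2) show ?thesis by blast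
  next
    case 2
    hence "A * B = 1 \<cdot>\<^sub>m A" using pauli_dims[OF assms(1)] by simp
    with one_in_phases assms(1) show ?thesis by blast
  next
    case 3
    have "\<i> \<in> phases" "- \<i> \<in> phases" "sigma_x \<in> paulis" "sigma_y \<in> paulis" "sigma_z \<in> paulis"
      by (simp_all add: phases_def paulis_def)
    with 3 False sigma_mult(4-9) show ?thesis by (elim insertE emptyE; hypsubst) blast+
  qed
qed

lemma pauli_adjoint: "A \<in> paulis \<Longrightarrow> mat_adjoint A = A"
  by (rule mat2_eqI) (auto simp: paulis_def mat_adjoint_index sigma_index)

lemma pauli_square: "A \<in> paulis \<Longrightarrow> A * A = 1\<^sub>m 2"
  by (auto simp: paulis_def sigma_mult)

lemma pauli_comm:
  assumes "A \<in> paulis" "B \<in> paulis"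
  shows "\<exists>s\<in>{1, - 1}. A * B = s \<cdot>\<^sub>m (B * A)"
  using assms by (auto simp: paulis_def sigma_mult smult_smult_mat)

lemma pauli_anticomm:
  assumes "A \<in> paulis" "A \<noteq> 1\<^sub>m 2"
  shows "\<exists>B\<in>paulis. A * B = (- 1) \<cdot>\<^sub>m (B * A)"
  using assms by (auto simp: paulis_def sigma_mult smult_smult_mat)

text \<open>The traces against 1 and \<open>sigma_z\<close> are the sum and difference of the
  diagonal entries of X, those against \<open>sigma_x\<close> and \<open>sigma_y\<close> the sum
  and, up to a factor, the difference of the other two.\<close>

lemma separating_paulis: "separating 2 paulis"
  unfolding separating_def
proof (intro ballI impI)
  fix X :: "complex mat"
  assume X: "X \<in> carrier_mat 2 2" and 0: "\<forall>A\<in>paulis. mat_trace (A * X) = 0"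
  have tr: "mat_trace (A * X) = A $$ (0, 0) * X $$ (0, 0) + A $$ (0, 1) * X $$ (1, 0)
      + (A $$ (1, 0) * X $$ (0, 1) + A $$ (1, 1) * X $$ (1, 1))" if "A \<in> paulis" for A
    using X pauli_dims[OF that] by (subst mat_trace_mult) (auto simp: numeral_2_eq_2)
  have z: "mat_trace (1\<^sub>m 2 * X) = 0" "mat_trace (sigma_x * X) = 0"
    "mat_trace (sigma_y * X) = 0" "mat_trace (sigma_z * X) = 0"
    using 0 by (simp_all add: paulis_def)
  have e: "X $$ (0, 0) + X $$ (1, 1) = 0" "X $$ (1, 0) + X $$ (0, 1) = 0"
    "\<i> * X $$ (0, 1) - \<i> * X $$ (1, 0) = 0" "X $$ (0, 0) - X $$ (1, 1) = 0"
    subgoal using z(1) tr[of "1\<^sub>m 2"] by (simp add: paulis_def)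
    subgoal using z(2) tr[of sigma_x] by (simp add: paulis_def sigma_index)
    subgoal using z(3) tr[of sigma_y] by (simp add: paulis_def sigma_index)
    subgoal using z(4) tr[of sigma_z] by (simp add: paulis_def sigma_index)
    done
  have zero: "a = 0 \<and> b = 0" if "a + b = 0" "a - b = 0" for a b :: complex
  proof -
    have "a = b" using that(2) by simp
    with that(1) have "2 * b = 0" by (simp only: mult_2)
    with \<open>a = b\<close> show ?thesis by simp
  qed
  have "X $$ (1, 0) - X $$ (0, 1) = 0" using e(3) by (simp flip: right_diff_distrib)
  hence "X $$ (0, 0) = 0" "X $$ (1, 1) = 0" "X $$ (0, 1) = 0" "X $$ (1, 0) = 0"
    using zero e(1,2,4) by blast+
  thus "X = 0\<^sub>m 2 2" using X by (intro mat2_eqI) auto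
qed

text \<open>Representatives of the Pauli operators modulo phase. They are Hermitian involutions,
  which is what the gates (P + Q) / sqrt 2 require.\<close>

definition pauli_words :: "nat \<Rightarrow> complex mat set" where
  "pauli_words N = {wedge_seq As | As. length As = N \<and> set As \<subseteq> paulis}"

lemma pauli_words_0: "pauli_words 0 = {1\<^sub>m 1}"
  by (auto simp: pauli_words_def)

lemma pauli_words_Suc:
  "pauli_words (Suc N) = {wedge 1 N A B | A B. A \<in> paulis \<and> B \<in> pauli_words N}"
  unfolding pauli_words_def
proof (intro equalityI subsetI)
  fix W assume "W \<in> {wedge_seq As | As. length As = Suc N \<and> set As \<subseteq> paulis}"
  then obtain As where As: "W = wedge_seq As" "length As = Suc N" "set As \<subseteq> paulis" by blast
  then obtain A Bs where "As = A # Bs" by (cases As) auto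
  with As show "W \<in> {wedge 1 N A B | A B. A \<in> paulis \<and> B \<in> {wedge_seq As | As. length As = N \<and> set As \<subseteq> paulis}}"
    by auto
next
  fix W assume "W \<in> {wedge 1 N A B | A B. A \<in> paulis \<and> B \<in> {wedge_seq As | As. length As = N \<and> set As \<subseteq> paulis}}"
  then obtain A Bs where A: "A \<in> paulis" and Bs: "length Bs = N" "set Bs \<subseteq> paulis"
    and W: "W = wedge 1 N A (wedge_seq Bs)" by blast
  have "W = wedge_seq (A # Bs)" "length (A # Bs) = Suc N" "set (A # Bs) \<subseteq> paulis"
    using W A Bs by auto
  thus "W \<in> {wedge_seq As | As. length As = Suc N \<and> set As \<subseteq> paulis}" by blast
qed

lemma pauli_words_operators: "pauli_words N \<subseteq> operators N"
proof (cases N)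
  case (Suc n)
  thus ?thesis using wedge_dim[of 1 n] by (auto simp: pauli_words_Suc)
qed (auto simp: pauli_words_0)

lemma pauli_word_operator: "A \<in> pauli_words N \<Longrightarrow> A \<in> operators N"
  using pauli_words_operators by blast

lemma one_in_pauli_words: "1\<^sub>m (2 ^ N) \<in> pauli_words N"
proof (induction N)
  case (Suc N)
  have "wedge 1 N (1\<^sub>m 2) (1\<^sub>m (2 ^ N)) = 1\<^sub>m (2 ^ Suc N)"
    using wedge_one[of 1 N] by simp
  thus ?case unfolding pauli_words_Suc using Suc one_in_paulis by force
qed (simp add: pauli_words_0)

lemma pauli_words_mult:
  "A \<in> pauli_words N \<Longrightarrow> B \<in> pauli_words N \<Longrightarrow> \<exists>\<alpha>\<in>phases. \<exists>C\<in>pauli_words N. A * B = \<alpha> \<cdot>\<^sub>m C"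
proof (induction N arbitrary: A B)
  case 0
  hence "A * B = 1 \<cdot>\<^sub>m 1\<^sub>m 1" by (simp add: pauli_words_0)
  thus ?case unfolding pauli_words_0 using one_in_phases by blast
next
  case (Suc N)
  then obtain a A' b B' where AB: "A = wedge 1 N a A'" "B = wedge 1 N b B'"
    and ab: "a \<in> paulis" "b \<in> paulis" and AB': "A' \<in> pauli_words N" "B' \<in> pauli_words N"
    unfolding pauli_words_Suc by blast
  obtain \<alpha> c where c: "\<alpha> \<in> phases" "c \<in> paulis" "a * b = \<alpha> \<cdot>\<^sub>m c"
    using pauli_mult[OF ab] by blast
  obtain \<beta> C where C: "\<beta> \<in> phases" "C \<in> pauli_words N" "A' * B' = \<beta> \<cdot>\<^sub>m C"
    using Suc.IH[OF AB'] by blast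
  have "A * B = wedge 1 N (\<alpha> \<cdot>\<^sub>m c) (\<beta> \<cdot>\<^sub>m C)"
    unfolding AB using ab AB' by (simp add: wedge_mult pauli_dims pauli_word_operator c(3) C(3))
  also have "\<dots> = (\<alpha> * \<beta>) \<cdot>\<^sub>m wedge 1 N c C"
    using c C by (simp add: wedge_smult pauli_dims pauli_word_operator)
  finally have "A * B = (\<alpha> * \<beta>) \<cdot>\<^sub>m wedge 1 N c C" .
  moreover have "wedge 1 N c C \<in> pauli_words (Suc N)" using c C unfolding pauli_words_Suc by blast
  ultimately show ?case using phases_mult[OF c(1) C(1)] by blast
qed

lemma pauli_words_adjoint: "A \<in> pauli_words N \<Longrightarrow> mat_adjoint A = A"
proof (induction N arbitrary: A)
  case 0
  thus ?case by (simp add: pauli_words_0)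
next
  case (Suc N)
  then obtain a A' where "A = wedge 1 N a A'" "a \<in> paulis" "A' \<in> pauli_words N"
    unfolding pauli_words_Suc by blast
  thus ?case using Suc.IH by (simp add: wedge_adjoint pauli_dims pauli_word_operator pauli_adjoint)
qed

lemma pauli_words_square: "A \<in> pauli_words N \<Longrightarrow> A * A = 1\<^sub>m (2 ^ N)"
proof (induction N arbitrary: A)
  case 0
  thus ?case by (simp add: pauli_words_0)
next
  case (Suc N)
  then obtain a A' where "A = wedge 1 N a A'" "a \<in> paulis" "A' \<in> pauli_words N"
    unfolding pauli_words_Suc by blast
  thus ?case using Suc.IH wedge_one[of 1 N]
    by (simp add: wedge_mult pauli_dims pauli_word_operator pauli_square)
qed

lemma pauli_words_comm:
  "A \<in> pauli_words N \<Longrightarrow> B \<in> pauli_words N \<Longrightarrow> \<exists>s\<in>{1, - 1}. A * B = s \<cdot>\<^sub>m (B * A)"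
proof (induction N arbitrary: A B)
  case 0
  thus ?case by (simp add: pauli_words_0)
next
  case (Suc N)
  then obtain a A' b B' where AB: "A = wedge 1 N a A'" "B = wedge 1 N b B'"
    and ab: "a \<in> paulis" "b \<in> paulis" and AB': "A' \<in> pauli_words N" "B' \<in> pauli_words N"
    unfolding pauli_words_Suc by blast
  obtain s where s: "s \<in> {1, - 1}" "a * b = s \<cdot>\<^sub>m (b * a)"
    using pauli_comm[OF ab] by blast
  obtain t where t: "t \<in> {1, - 1}" "A' * B' = t \<cdot>\<^sub>m (B' * A')"
    using Suc.IH[OF AB'] by blast
  have d: "b * a \<in> carrier_mat 2 2" "B' * A' \<in> operators N"
    using pauli_dims(3) ab pauli_word_operator AB' mult_carrier_mat by blast+
  have "A * B = wedge 1 N (s \<cdot>\<^sub>m (b * a)) (t \<cdot>\<^sub>m (B' * A'))"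
    unfolding AB using ab AB' by (simp add: wedge_mult pauli_dims pauli_word_operator s(2) t(2))
  also have "\<dots> = (s * t) \<cdot>\<^sub>m (B * A)"
    unfolding AB using ab AB' d by (simp add: wedge_smult wedge_mult pauli_dims pauli_word_operator)
  finally have "A * B = (s * t) \<cdot>\<^sub>m (B * A)" .
  moreover have "s * t \<in> {1, - 1}" using s(1) t(1) by auto
  ultimately show ?case by blast
qed

text \<open>Some letter of A is not the identity: put an anticommuting letter in its place and
  identities elsewhere. In the induction the letter sits either in the head or in the tail.\<close>

lemma pauli_words_anticomm:
  "A \<in> pauli_words N \<Longrightarrow> A \<noteq> 1\<^sub>m (2 ^ N) \<Longrightarrow> \<exists>B\<in>pauli_words N. A * B = (- 1) \<cdot>\<^sub>m (B * A)"
proof (induction N arbitrary: A)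
  case 0
  thus ?case by (simp add: pauli_words_0)
next
  case (Suc N)
  then obtain a A' where A: "A = wedge 1 N a A'"
    and a: "a \<in> paulis" and A': "A' \<in> pauli_words N"
    unfolding pauli_words_Suc by blast
  have "a \<noteq> 1\<^sub>m 2 \<or> A' \<noteq> 1\<^sub>m (2 ^ N)"
    using Suc.prems(2) A wedge_one[of 1 N] by auto
  then obtain b B' where b: "b \<in> paulis" and B': "B' \<in> pauli_words N"
    and anti: "a * b = (- 1) \<cdot>\<^sub>m (b * a) \<and> A' * B' = 1 \<cdot>\<^sub>m (B' * A') \<or>
      a * b = 1 \<cdot>\<^sub>m (b * a) \<and> A' * B' = (- 1) \<cdot>\<^sub>m (B' * A')"
  proof
    assume "a \<noteq> 1\<^sub>m 2"
    then obtain b where "b \<in> paulis" "a * b = (- 1) \<cdot>\<^sub>m (b * a)" using pauli_anticomm[OF a] by blast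
    thus thesis using that[OF _ one_in_pauli_words] pauli_word_operator[OF A'] by simp
  next
    assume "A' \<noteq> 1\<^sub>m (2 ^ N)"
    then obtain B' where "B' \<in> pauli_words N" "A' * B' = (- 1) \<cdot>\<^sub>m (B' * A')" using Suc.IH[OF A'] by blast
    thus thesis using that[OF one_in_paulis] pauli_dims[OF a] by simp
  qed
  then obtain s t :: complex where st: "a * b = s \<cdot>\<^sub>m (b * a)" "A' * B' = t \<cdot>\<^sub>m (B' * A')" "s * t = - 1"
    by fastforce
  have d: "b * a \<in> carrier_mat 2 2" "B' * A' \<in> operators N"
    using pauli_dims(3) a b pauli_word_operator A' B' mult_carrier_mat by blast+
  have "A * wedge 1 N b B' = wedge 1 N (s \<cdot>\<^sub>m (b * a)) (t \<cdot>\<^sub>m (B' * A'))"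
    unfolding A using a b A' B' by (simp add: wedge_mult pauli_dims pauli_word_operator st(1,2))
  also have "\<dots> = (- 1) \<cdot>\<^sub>m (wedge 1 N b B' * A)"
    unfolding A using a b A' B' d by (simp add: wedge_smult wedge_mult pauli_dims pauli_word_operator st(3))
  finally have "A * wedge 1 N b B' = (- 1) \<cdot>\<^sub>m (wedge 1 N b B' * A)" .
  thus ?case using b B' unfolding pauli_words_Suc by blast
qed

lemma separating_pauli_words: "separating (2 ^ N) (pauli_words N)"
proof (induction N)
  case 0
  show ?case unfolding separating_def
  proof (intro ballI impI)
    fix X :: "complex mat" assume "X \<in> carrier_mat (2 ^ 0) (2 ^ 0)" "\<forall>A\<in>pauli_words 0. mat_trace (A * X) = 0"
    thus "X = 0\<^sub>m (2 ^ 0) (2 ^ 0)"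
      by (intro eq_matI) (auto simp: pauli_words_0 mat_trace_def)
  qed
next
  case (Suc N)
  have "paulis \<subseteq> operators 1" using pauli_dims(3) by (simp add: subset_iff)
  hence "separating (2 ^ (1 + N)) {wedge 1 N A B | A B. A \<in> paulis \<and> B \<in> pauli_words N}"
    by (rule separating_wedge) (use Suc separating_paulis pauli_words_operators in \<open>auto\<close>)
  thus ?case by (simp add: pauli_words_Suc)
qed

lemma finite_pauli_words: "finite (pauli_words N)"
proof -
  have "finite paulis" by (simp add: paulis_def)
  moreover have "pauli_words N = wedge_seq ` {As. set As \<subseteq> paulis \<and> length As = N}"
    by (auto simp: pauli_words_def)
  ultimately show ?thesis using finite_lists_length_eq[of paulis N] by simp
qed

section \<open>The Pauli group with its phases\<close>

lemma pauli_group_eq: "pauli_group N = {\<alpha> \<cdot>\<^sub>m W | \<alpha> W. \<alpha> \<in> phases \<and> W \<in> pauli_words N}"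
  unfolding pauli_group_def pauli_words_def phases_def paulis_def by blast

lemma pauli_words_subset_group: "pauli_words N \<subseteq> pauli_group N"
proof
  fix W assume "W \<in> pauli_words N"
  moreover have "W = 1 \<cdot>\<^sub>m W" by simp
  ultimately show "W \<in> pauli_group N" unfolding pauli_group_eq using one_in_phases by blast
qed

lemma pauli_groupE:
  assumes "P \<in> pauli_group N"
  obtains \<alpha> W where "\<alpha> \<in> phases" "W \<in> pauli_words N" "P = \<alpha> \<cdot>\<^sub>m W"
  using assms unfolding pauli_group_eq by blast

lemma pauli_group_operator: "P \<in> pauli_group N \<Longrightarrow> P \<in> operators N"
  using pauli_word_operator by (auto elim!: pauli_groupE)

lemma pauli_group_dims:
  assumes "P \<in> pauli_group N"
  shows "dim_row P = 2 ^ N" "dim_col P = 2 ^ N"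
  using pauli_group_operator[OF assms] by auto

lemma pauli_group_one: "1\<^sub>m (2 ^ N) \<in> pauli_group N"
  using one_in_pauli_words pauli_words_subset_group by blast

lemma pauli_group_smult:
  assumes "P \<in> pauli_group N" "\<alpha> \<in> phases"
  shows "\<alpha> \<cdot>\<^sub>m P \<in> pauli_group N"
proof -
  obtain \<beta> W where W: "\<beta> \<in> phases" "W \<in> pauli_words N" "P = \<beta> \<cdot>\<^sub>m W"
    using assms(1) by (rule pauli_groupE)
  have "\<alpha> \<cdot>\<^sub>m P = (\<alpha> * \<beta>) \<cdot>\<^sub>m W" by (simp add: W(3) smult_smult_mat)
  thus ?thesis unfolding pauli_group_eq using phases_mult[OF assms(2) W(1)] W(2) by blast
qed

lemma pauli_group_mult:
  assumes "P \<in> pauli_group N" "Q \<in> pauli_group N"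
  shows "P * Q \<in> pauli_group N"
proof -
  obtain \<alpha> V where V: "\<alpha> \<in> phases" "V \<in> pauli_words N" "P = \<alpha> \<cdot>\<^sub>m V"
    using assms(1) by (rule pauli_groupE)
  obtain \<beta> W where W: "\<beta> \<in> phases" "W \<in> pauli_words N" "Q = \<beta> \<cdot>\<^sub>m W"
    using assms(2) by (rule pauli_groupE)
  obtain \<gamma> U where U: "\<gamma> \<in> phases" "U \<in> pauli_words N" "V * W = \<gamma> \<cdot>\<^sub>m U"
    using pauli_words_mult[OF V(2) W(2)] by blast
  have "P * Q = \<alpha> \<cdot>\<^sub>m (\<beta> \<cdot>\<^sub>m (\<gamma> \<cdot>\<^sub>m U))"
    unfolding V(3) W(3) using pauli_word_operator[OF V(2)] pauli_word_operator[OF W(2)]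
    by (simp add: mat_mult_smult smult_smult_mat ac_simps U(3)[symmetric])
  moreover have "U \<in> pauli_group N" using U pauli_words_subset_group by blast
  ultimately show ?thesis using U V W by (metis pauli_group_smult)
qed

lemma pauli_group_adjoint:
  assumes "P \<in> pauli_group N"
  shows "mat_adjoint P \<in> pauli_group N"
    and "P * mat_adjoint P = 1\<^sub>m (2 ^ N)" "mat_adjoint P * P = 1\<^sub>m (2 ^ N)"
proof -
  obtain \<alpha> W where W: "\<alpha> \<in> phases" "W \<in> pauli_words N" "P = \<alpha> \<cdot>\<^sub>m W"
    using assms by (rule pauli_groupE)
  have a: "mat_adjoint P = cnj \<alpha> \<cdot>\<^sub>m W"
    by (simp add: W(3) adjoint_smult pauli_words_adjoint[OF W(2)])
  show "mat_adjoint P \<in> pauli_group N"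
    unfolding a using W phases_cnj pauli_words_subset_group by (blast intro: pauli_group_smult)
  have n: "\<alpha> * cnj \<alpha> = 1" "cnj \<alpha> * \<alpha> = 1" using phases_norm[OF W(1)] by (simp_all add: mult.commute)
  show "P * mat_adjoint P = 1\<^sub>m (2 ^ N)" "mat_adjoint P * P = 1\<^sub>m (2 ^ N)"
    unfolding a unfolding W(3) using pauli_word_operator[OF W(2)] n pauli_words_square[OF W(2)]
    by (simp_all add: mat_mult_smult smult_smult_mat)
qed

lemma pauli_group_comm:
  assumes "P \<in> pauli_group N" "Q \<in> pauli_group N"
  shows "P * Q = Q * P \<or> P * Q = (- 1) \<cdot>\<^sub>m (Q * P)"
proof -
  obtain \<alpha> V where V: "\<alpha> \<in> phases" "V \<in> pauli_words N" "P = \<alpha> \<cdot>\<^sub>m V"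
    using assms(1) by (rule pauli_groupE)
  obtain \<beta> W where W: "\<beta> \<in> phases" "W \<in> pauli_words N" "Q = \<beta> \<cdot>\<^sub>m W"
    using assms(2) by (rule pauli_groupE)
  obtain s where s: "s \<in> {1, - 1}" "V * W = s \<cdot>\<^sub>m (W * V)"
    using pauli_words_comm[OF V(2) W(2)] by blast
  have "P * Q = s \<cdot>\<^sub>m (Q * P)"
    unfolding V(3) W(3) using pauli_word_operator[OF V(2)] pauli_word_operator[OF W(2)]
    by (simp add: mat_mult_smult smult_smult_mat s(2) ac_simps)
  thus ?thesis using s(1) by auto
qed

lemma finite_pauli_group: "finite (pauli_group N)"
proof -
  have "pauli_group N = (\<lambda>(\<alpha>, W). \<alpha> \<cdot>\<^sub>m W) ` (phases \<times> pauli_words N)"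
    unfolding pauli_group_eq by auto
  thus ?thesis using finite_pauli_words by (simp add: phases_def)
qed

text \<open>In other words the centre of the Pauli group consists of its scalars. The phase is
  irrelevant, and the underlying word is not the identity.\<close>

lemma pauli_group_nonscalar_anticomm:
  assumes "P \<in> pauli_group N" "\<And>\<alpha>. \<alpha> \<in> phases \<Longrightarrow> P \<noteq> \<alpha> \<cdot>\<^sub>m 1\<^sub>m (2 ^ N)"
  shows "\<exists>R\<in>pauli_group N. P * R = (- 1) \<cdot>\<^sub>m (R * P)"
proof -
  obtain \<alpha> W where W: "\<alpha> \<in> phases" "W \<in> pauli_words N" "P = \<alpha> \<cdot>\<^sub>m W"
    using assms(1) by (rule pauli_groupE)
  then obtain R where R: "R \<in> pauli_words N" "W * R = (- 1) \<cdot>\<^sub>m (R * W)"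
    using pauli_words_anticomm[OF W(2)] assms(2) by blast
  have "P * R = (- 1) \<cdot>\<^sub>m (R * P)"
    unfolding W(3) using pauli_word_operator[OF W(2)] pauli_word_operator[OF R(1)]
    by (simp add: mat_mult_smult smult_smult_mat R(2))
  thus ?thesis using R pauli_words_subset_group by blast
qed

section \<open>Fermion parity of basis states and of operators\<close>

lemma set_decode_split: "set_decode x = (if odd x then {0} else {}) \<union> Suc ` set_decode (x div 2)"
proof (rule Set.set_eqI)
  fix n show "n \<in> set_decode x \<longleftrightarrow> n \<in> (if odd x then {0} else {}) \<union> Suc ` set_decode (x div 2)"
    by (cases n) (auto simp: set_decode_0 set_decode_Suc simp del: set_decode_div_2)
qed

lemma even_card_set_decode:
  "even (card (set_decode x)) \<longleftrightarrow> (x mod 2 = 0 \<longleftrightarrow> even (card (set_decode (x div 2))))"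
proof -
  have "card (Suc ` set_decode (x div 2)) = card (set_decode (x div 2))"
    by (rule card_image) simp
  hence "card (set_decode x) = (if odd x then 1 else 0) + card (set_decode (x div 2))"
    unfolding set_decode_split[of x] by (subst card_Un_disjoint) (auto simp del: set_decode_div_2)
  moreover have "x mod 2 = 0 \<longleftrightarrow> even x" by presburger
  ultimately show ?thesis by (cases "even x") (simp_all del: set_decode_div_2)
qed

abbreviation even_weight :: "nat \<Rightarrow> bool" where
  "even_weight x \<equiv> even (card (set_decode x))"

lemma parity_string_word: "parity_string N \<in> pauli_words N"
  unfolding parity_string_def pauli_words_def
  by (intro CollectI exI[of _ "replicate N sigma_z"]) (auto simp: paulis_def)

text \<open>The first factor of a \<open>wedge_seq\<close> acts on the lowest bit, so peeling it off
  contributes a sign exactly when that mode is occupied. The string is therefore the total parity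
  operator.\<close>

lemma parity_string_index:
  "r < 2 ^ N \<Longrightarrow> c < 2 ^ N \<Longrightarrow>
     parity_string N $$ (r, c) = (if r = c then if even_weight r then 1 else - 1 else 0)"
proof (induction N arbitrary: r c)
  case 0
  thus ?case by (simp add: parity_string_def)
next
  case (Suc N)
  have "parity_string (Suc N) = wedge 1 N sigma_z (parity_string N)"
    by (simp add: parity_string_def)
  moreover have "r = c \<longleftrightarrow> r mod 2 = c mod 2 \<and> r div 2 = c div 2"
    by (metis div_mult_mod_eq)
  ultimately show ?case
    using Suc.prems Suc.IH[of "r div 2" "c div 2"] even_card_set_decode[of r]
    by (auto simp: wedge_index sigma_index simp del: set_decode_div_2)
qed

lemma parity_string_dims [simp]:
  "dim_row (parity_string N) = 2 ^ N" "dim_col (parity_string N) = 2 ^ N"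
  using pauli_word_operator[OF parity_string_word] by auto

lemma parity_string_group: "parity_string N \<in> pauli_group N"
  using parity_string_word pauli_words_subset_group by blast

lemma parity_string_mult_index:
  assumes "A \<in> operators N" "r < 2 ^ N" "c < 2 ^ N"
  shows "(parity_string N * A) $$ (r, c) = (if even_weight r then 1 else - 1) * A $$ (r, c)"
    and "(A * parity_string N) $$ (r, c) = (if even_weight c then 1 else - 1) * A $$ (r, c)"
proof -
  have "(parity_string N * A) $$ (r, c)
      = (\<Sum>k<2 ^ N. if k = r then (if even_weight r then 1 else - 1) * A $$ (r, c) else 0)"
    using assms by (subst mult_mat_entry) (auto simp: parity_string_index simp del: sum.delta sum.delta' intro!: sum.cong)
  thus "(parity_string N * A) $$ (r, c) = (if even_weight r then 1 else - 1) * A $$ (r, c)"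
    using assms by simp
  have "(A * parity_string N) $$ (r, c)
      = (\<Sum>k<2 ^ N. if k = c then (if even_weight c then 1 else - 1) * A $$ (r, c) else 0)"
    using assms by (subst mult_mat_entry) (auto simp: parity_string_index simp del: sum.delta sum.delta' intro!: sum.cong)
  thus "(A * parity_string N) $$ (r, c) = (if even_weight c then 1 else - 1) * A $$ (r, c)"
    using assms by simp
qed

text \<open>Multiplying by a diagonal sign matrix on the left or on the right scales the entry (r,
  c) by the sign of r or of c, so (anti)commutation restricts which entries can be nonzero.\<close>

lemma parity_commute_iff:
  assumes "A \<in> operators N"
  shows "parity_string N * A = A * parity_string N \<longleftrightarrow>
      (\<forall>r<2 ^ N. \<forall>c<2 ^ N. A $$ (r, c) \<noteq> 0 \<longrightarrow> (even_weight r \<longleftrightarrow> even_weight c))"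
    and "parity_string N * A = (- 1) \<cdot>\<^sub>m (A * parity_string N) \<longleftrightarrow>
      (\<forall>r<2 ^ N. \<forall>c<2 ^ N. A $$ (r, c) \<noteq> 0 \<longrightarrow> (even_weight r \<longleftrightarrow> \<not> even_weight c))"
proof -
  have d: "dim_row A = 2 ^ N" "dim_col A = 2 ^ N" using assms by auto
  have "parity_string N * A = A * parity_string N \<longleftrightarrow>
    (\<forall>r<2 ^ N. \<forall>c<2 ^ N. (parity_string N * A) $$ (r, c) = (A * parity_string N) $$ (r, c))"
    unfolding mat_eq_iff using d by simp
  also have "\<dots> \<longleftrightarrow> (\<forall>r<2 ^ N. \<forall>c<2 ^ N. A $$ (r, c) \<noteq> 0 \<longrightarrow> (even_weight r \<longleftrightarrow> even_weight c))"
    using parity_string_mult_index[OF assms] by auto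
  finally show "parity_string N * A = A * parity_string N \<longleftrightarrow>
      (\<forall>r<2 ^ N. \<forall>c<2 ^ N. A $$ (r, c) \<noteq> 0 \<longrightarrow> (even_weight r \<longleftrightarrow> even_weight c))" .
  have "parity_string N * A = (- 1) \<cdot>\<^sub>m (A * parity_string N) \<longleftrightarrow>
    (\<forall>r<2 ^ N. \<forall>c<2 ^ N. (parity_string N * A) $$ (r, c) = - ((A * parity_string N) $$ (r, c)))"
    unfolding mat_eq_iff using d by simp
  also have "\<dots> \<longleftrightarrow> (\<forall>r<2 ^ N. \<forall>c<2 ^ N. A $$ (r, c) \<noteq> 0 \<longrightarrow> (even_weight r \<longleftrightarrow> \<not> even_weight c))"
    using parity_string_mult_index[OF assms] by auto
  finally show "parity_string N * A = (- 1) \<cdot>\<^sub>m (A * parity_string N) \<longleftrightarrow>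
      (\<forall>r<2 ^ N. \<forall>c<2 ^ N. A $$ (r, c) \<noteq> 0 \<longrightarrow> (even_weight r \<longleftrightarrow> \<not> even_weight c))" .
qed

text \<open>Kets are unit vectors, so lying in a span of ket-bras is a condition on the positions of
  nonzero entries.\<close>

lemma op_sum_ketbra_iff:
  assumes "I \<subseteq> {..<2 ^ N} \<times> {..<2 ^ N}"
  shows "(\<exists>\<alpha>. A = op_sum N (\<lambda>(x, y). \<alpha> x y \<cdot>\<^sub>m ketbra N x y) I) \<longleftrightarrow>
    A \<in> operators N \<and> (\<forall>r<2 ^ N. \<forall>c<2 ^ N. A $$ (r, c) \<noteq> 0 \<longrightarrow> (r, c) \<in> I)"
proof -
  have fin: "finite I" using assms finite_subset by blast
  have e: "op_sum N (\<lambda>(x, y). \<alpha> x y \<cdot>\<^sub>m ketbra N x y) I $$ (r, c) = (if (r, c) \<in> I then \<alpha> r c else 0)"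
    if rc: "r < 2 ^ N" "c < 2 ^ N" for \<alpha> r c
  proof -
    have "op_sum N (\<lambda>(x, y). \<alpha> x y \<cdot>\<^sub>m ketbra N x y) I $$ (r, c)
        = (\<Sum>p\<in>I. if p = (r, c) then \<alpha> r c else 0)"
      unfolding op_sum_def index_mat(1)[OF rc] prod.case
    proof (rule sum.cong[OF refl])
      fix p assume p: "p \<in> I"
      then obtain x y where xy: "p = (x, y)" "x < 2 ^ N" "y < 2 ^ N" using assms by auto
      thus "(case p of (x, y) \<Rightarrow> \<alpha> x y \<cdot>\<^sub>m ketbra N x y) $$ (r, c) = (if p = (r, c) then \<alpha> r c else 0)"
        using rc by (auto simp: outer_def ket_eq_unit_vec unit_vec_def)
    qed
    thus ?thesis using fin by simp
  qed
  have d: "op_sum N f I \<in> operators N" for f :: "nat \<times> nat \<Rightarrow> complex mat" by (simp add: op_sum_def)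
  show ?thesis
  proof (intro iffI conjI allI impI; (elim exE conjE)?)
    assume *: "A \<in> operators N" "\<forall>r<2 ^ N. \<forall>c<2 ^ N. A $$ (r, c) \<noteq> 0 \<longrightarrow> (r, c) \<in> I"
    have "A = op_sum N (\<lambda>(x, y). A $$ (x, y) \<cdot>\<^sub>m ketbra N x y) I"
      using * e d[of "\<lambda>(x, y). A $$ (x, y) \<cdot>\<^sub>m ketbra N x y"] by (intro eq_matI) auto
    thus "\<exists>\<alpha>. A = op_sum N (\<lambda>(x, y). \<alpha> x y \<cdot>\<^sub>m ketbra N x y) I"
      by (rule exI[of _ "\<lambda>x y. A $$ (x, y)"])
  qed (use d e in \<open>auto split: if_splits\<close>)
qed

text \<open>Parity of an operator becomes commutation with a single Pauli operator, so that for
  Pauli operators it is one more commutation sign.\<close>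

lemma block_diagonal_iff:
  "block_diagonal N A \<longleftrightarrow> A \<in> operators N \<and> parity_string N * A = A * parity_string N"
proof -
  have "even_states N \<times> even_states N \<union> odd_states N \<times> odd_states N \<subseteq> {..<2 ^ N} \<times> {..<2 ^ N}"
    by (auto simp: even_states_def odd_states_def)
  from op_sum_ketbra_iff[OF this] show ?thesis
    unfolding block_diagonal_def using parity_commute_iff(1)[of A N]
    by (auto simp: even_states_def odd_states_def)
qed

lemma anti_block_diagonal_iff:
  "anti_block_diagonal N A \<longleftrightarrow> A \<in> operators N \<and> parity_string N * A = (- 1) \<cdot>\<^sub>m (A * parity_string N)"
proof -
  have "even_states N \<times> odd_states N \<union> odd_states N \<times> even_states N \<subseteq> {..<2 ^ N} \<times> {..<2 ^ N}"
    by (auto simp: even_states_def odd_states_def)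
  from op_sum_ketbra_iff[OF this] show ?thesis
    unfolding anti_block_diagonal_def using parity_commute_iff(2)[of A N]
    by (auto simp: even_states_def odd_states_def)
qed

text \<open>The vacuum and the state with one occupied mode have opposite signs; the second exists
  because N \<ge> 1.\<close>

lemma parity_string_nonscalar:
  assumes "N \<ge> 1"
  shows "parity_string N \<noteq> \<alpha> \<cdot>\<^sub>m 1\<^sub>m (2 ^ N)"
proof
  assume *: "parity_string N = \<alpha> \<cdot>\<^sub>m 1\<^sub>m (2 ^ N)"
  have "(1 :: nat) < 2 ^ N" using assms by (metis less_numeral_extra(4) not_one_le_zero one_less_power one_less_numeral_iff semiring_norm(76) gr0I)
  moreover have "set_decode 1 = {0}" using set_decode_plus_power_2[of 0 0] by simp
  ultimately show False
    using arg_cong[OF *, of "\<lambda>A. A $$ (0, 0)"] arg_cong[OF *, of "\<lambda>A. A $$ (1, 1)"]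
    by (simp add: parity_string_index)
qed


section \<open>The restricted Clifford set\<close>

lemma pauli_group_smult_cancel:
  assumes "P \<in> pauli_group N" "s \<cdot>\<^sub>m P = t \<cdot>\<^sub>m P"
  shows "s = t"
proof -
  have "(s \<cdot>\<^sub>m P) * mat_adjoint P = (t \<cdot>\<^sub>m P) * mat_adjoint P" using assms(2) by simp
  hence "s \<cdot>\<^sub>m 1\<^sub>m (2 ^ N) = t \<cdot>\<^sub>m (1\<^sub>m (2 ^ N) :: complex mat)"
    using pauli_group_dims[OF assms(1)] pauli_group_adjoint(2)[OF assms(1)]
    by (simp add: mat_mult_smult)
  from arg_cong[OF this, of "\<lambda>A. A $$ (0, 0)"] show ?thesis by simp
qed

text \<open>On Pauli operators modulo phase this is the symplectic form of binary vectors, written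
  multiplicatively. The value - 1 only records that the operators do not commute; for Pauli
  operators this means that they anticommute.\<close>

definition comm_sign :: "complex mat \<Rightarrow> complex mat \<Rightarrow> complex" where
  "comm_sign P Q = (if P * Q = Q * P then 1 else - 1)"

lemma comm_sign_cases: "comm_sign P Q = 1 \<or> comm_sign P Q = - 1"
  by (simp add: comm_sign_def)

lemma comm_sign_sq [simp]: "comm_sign P Q * comm_sign P Q = 1"
  by (simp add: comm_sign_def)

lemma comm_sign_mult_swap:
  assumes "P \<in> pauli_group N" "Q \<in> pauli_group N"
  shows "P * Q = comm_sign P Q \<cdot>\<^sub>m (Q * P)"
  using pauli_group_comm[OF assms] by (auto simp: comm_sign_def)

lemma comm_sign_eqI:
  assumes "P \<in> pauli_group N" "Q \<in> pauli_group N" "P * Q = s \<cdot>\<^sub>m (Q * P)"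
  shows "comm_sign P Q = s"
  using pauli_group_smult_cancel[OF pauli_group_mult[OF assms(2,1)]]
    comm_sign_mult_swap[OF assms(1,2)] assms(3) by metis

lemma comm_sign_sym: "comm_sign P Q = comm_sign Q P"
  by (auto simp: comm_sign_def)

text \<open>Moving P past Q and then past R collects one sign each time. Together with symmetry this
  makes \<open>comm_sign\<close> a bicharacter, so the sign of a product is read off from its
  factors.\<close>

lemma comm_sign_mult_right:
  assumes "P \<in> pauli_group N" "Q \<in> pauli_group N" "R \<in> pauli_group N"
  shows "comm_sign P (Q * R) = comm_sign P Q * comm_sign P R"
proof (rule comm_sign_eqI[OF assms(1) pauli_group_mult[OF assms(2,3)]])
  note d = assms[THEN pauli_group_dims(1)] assms[THEN pauli_group_dims(2)]
  have "P * (Q * R) = (P * Q) * R" using d by (simp add: mat_mult_assoc)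
  also have "\<dots> = comm_sign P Q \<cdot>\<^sub>m (Q * (P * R))"
    unfolding comm_sign_mult_swap[OF assms(1,2)] using d by (simp add: mat_mult_smult mat_mult_assoc)
  also have "\<dots> = (comm_sign P Q * comm_sign P R) \<cdot>\<^sub>m (Q * R * P)"
    unfolding comm_sign_mult_swap[OF assms(1,3)] using d
    by (simp add: mat_mult_smult mat_mult_assoc smult_smult_mat)
  finally show "P * (Q * R) = (comm_sign P Q * comm_sign P R) \<cdot>\<^sub>m (Q * R * P)" .
qed

lemma comm_sign_mult_left:
  assumes "P \<in> pauli_group N" "Q \<in> pauli_group N" "R \<in> pauli_group N"
  shows "comm_sign (P * Q) R = comm_sign P R * comm_sign Q R"
  using comm_sign_mult_right[OF assms(3,1,2)] by (simp add: comm_sign_sym)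

lemma comm_sign_self [simp]: "comm_sign P P = 1"
  by (simp add: comm_sign_def)

lemma comm_sign_smult_left:
  assumes "dim_row P = n" "dim_col P = n" "dim_row Q = n" "dim_col Q = n" "\<alpha> \<noteq> 0"
  shows "comm_sign (\<alpha> \<cdot>\<^sub>m P) Q = comm_sign P Q"
proof -
  have "\<alpha> \<cdot>\<^sub>m X = \<alpha> \<cdot>\<^sub>m Y \<longleftrightarrow> X = Y" for X Y :: "complex mat"
  proof
    assume "\<alpha> \<cdot>\<^sub>m X = \<alpha> \<cdot>\<^sub>m Y"
    hence "(1 / \<alpha>) \<cdot>\<^sub>m (\<alpha> \<cdot>\<^sub>m X) = (1 / \<alpha>) \<cdot>\<^sub>m (\<alpha> \<cdot>\<^sub>m Y)" by simp
    thus "X = Y" using assms(5) by (simp add: smult_smult_mat)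
  qed simp
  thus ?thesis using assms by (simp add: comm_sign_def mat_mult_smult)
qed

lemma phases_nonzero: "\<alpha> \<in> phases \<Longrightarrow> \<alpha> \<noteq> 0"
  by (auto simp: phases_def)

lemma comm_sign_phase_left:
  assumes "P \<in> pauli_group N" "Q \<in> pauli_group N" "\<alpha> \<in> phases"
  shows "comm_sign (\<alpha> \<cdot>\<^sub>m P) Q = comm_sign P Q"
  using assms by (intro comm_sign_smult_left[of _ "2 ^ N"]) (auto simp: pauli_group_dims phases_nonzero)

lemma comm_sign_phase_right:
  assumes "P \<in> pauli_group N" "Q \<in> pauli_group N" "\<alpha> \<in> phases"
  shows "comm_sign P (\<alpha> \<cdot>\<^sub>m Q) = comm_sign P Q"
  using comm_sign_phase_left[OF assms(2,1,3)] by (simp add: comm_sign_sym)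

lemma nonscalar_comm_sign:
  assumes "P \<in> pauli_group N" "\<And>\<alpha>. \<alpha> \<in> phases \<Longrightarrow> P \<noteq> \<alpha> \<cdot>\<^sub>m 1\<^sub>m (2 ^ N)"
  obtains R where "R \<in> pauli_group N" "comm_sign P R = - 1"
  using pauli_group_nonscalar_anticomm[OF assms] comm_sign_eqI[OF assms(1)] by metis

lemma pauli_BD_iff: "P \<in> pauli_BD N \<longleftrightarrow> P \<in> pauli_group N \<and> comm_sign (parity_string N) P = 1"
  unfolding pauli_BD_def block_diagonal_iff
  by (auto simp: pauli_group_operator comm_sign_def)

lemma pauli_ABD_iff: "P \<in> pauli_ABD N \<longleftrightarrow> P \<in> pauli_group N \<and> comm_sign (parity_string N) P = - 1"
  unfolding pauli_ABD_def anti_block_diagonal_iff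
  using comm_sign_eqI[OF parity_string_group] comm_sign_mult_swap[OF parity_string_group]
  by (auto dest: pauli_group_operator)

text \<open>
  If \<open>P\<close> and \<open>S P\<close> (with \<open>S\<close> the parity string) were both nonscalar, each would anticommute with
  some Pauli operator; both of these are anti-block-diagonal, and their product is a block-diagonal
  operator anticommuting with \<open>P\<close>.
\<close>

lemma pauli_BD_central:
  assumes P: "P \<in> pauli_group N" and c: "\<And>R. R \<in> pauli_BD N \<Longrightarrow> comm_sign P R = 1"
  shows "\<exists>\<alpha>\<in>phases. P = \<alpha> \<cdot>\<^sub>m 1\<^sub>m (2 ^ N) \<or> P = \<alpha> \<cdot>\<^sub>m parity_string N"
proof (rule ccontr)
  let ?S = "parity_string N"
  note S = parity_string_group[of N]
  assume *: "\<not> ?thesis"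
  then obtain R where R: "R \<in> pauli_group N" "comm_sign P R = - 1"
    using nonscalar_comm_sign[OF P] by metis
  \<comment> \<open>As S squares to 1, a scalar S P would make P a phase times S.\<close>
  have "?S * P \<noteq> \<alpha> \<cdot>\<^sub>m 1\<^sub>m (2 ^ N)" if "\<alpha> \<in> phases" for \<alpha>
  proof
    assume "?S * P = \<alpha> \<cdot>\<^sub>m 1\<^sub>m (2 ^ N)"
    hence "?S * (?S * P) = ?S * (\<alpha> \<cdot>\<^sub>m 1\<^sub>m (2 ^ N))" by simp
    hence "(?S * ?S) * P = \<alpha> \<cdot>\<^sub>m ?S"
      using pauli_group_dims[OF P] by (simp add: mat_mult_assoc mat_mult_smult)
    hence "P = \<alpha> \<cdot>\<^sub>m ?S"
      using pauli_group_dims[OF P] pauli_words_square[OF parity_string_word] by simp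
    thus False using * that by blast
  qed
  then obtain R' where R': "R' \<in> pauli_group N" "comm_sign (?S * P) R' = - 1"
    using nonscalar_comm_sign[OF pauli_group_mult[OF S P]] by metis
  have m: "comm_sign ?S R' * comm_sign P R' = - 1"
    using comm_sign_mult_left[OF S P R'(1)] R'(2) by simp
  have "comm_sign ?S R = - 1" using c[of R] R comm_sign_cases[of ?S R] by (auto simp: pauli_BD_iff)
  \<comment> \<open>By \<open>m\<close> exactly one of the two signs of \<open>R'\<close> is - 1. It
    is not the one with P, since \<open>R'\<close> would then be block-diagonal and commute with P
    by \<open>c\<close>.\<close>
  moreover have "comm_sign ?S R' = - 1" "comm_sign P R' = 1"
    using c[of R'] R'(1) m comm_sign_cases[of ?S R'] comm_sign_cases[of P R'] by (auto simp: pauli_BD_iff)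
  ultimately have "comm_sign ?S (R * R') = 1" "comm_sign P (R * R') = - 1"
    using comm_sign_mult_right[OF S R(1) R'(1)] comm_sign_mult_right[OF P R(1) R'(1)] R(2) by simp_all
  thus False using c[of "R * R'"] pauli_group_mult[OF R(1) R'(1)] by (auto simp: pauli_BD_iff)
qed

section \<open>The conjugation action of unitaries\<close>

definition conjugate_by :: "complex mat \<Rightarrow> complex mat \<Rightarrow> complex mat" where
  "conjugate_by c P = c * P * mat_adjoint c"

lemma unitary_groupD:
  assumes "c \<in> unitary_group N"
  shows "dim_row c = 2 ^ N" "dim_col c = 2 ^ N"
    "c * mat_adjoint c = 1\<^sub>m (2 ^ N)" "mat_adjoint c * c = 1\<^sub>m (2 ^ N)"
  using assms by (auto simp: unitary_group_def)

lemma unitary_cancel: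
  assumes "c \<in> unitary_group N" "dim_row X = 2 ^ N"
  shows "c * (mat_adjoint c * X) = X" "mat_adjoint c * (c * X) = X"
proof -
  note u = unitary_groupD[OF assms(1)]
  have "c * (mat_adjoint c * X) = (c * mat_adjoint c) * X" "mat_adjoint c * (c * X) = (mat_adjoint c * c) * X"
    using u(1,2) assms(2) by (simp_all only: mat_mult_assoc mat_adjoint_dims)
  thus "c * (mat_adjoint c * X) = X" "mat_adjoint c * (c * X) = X"
    using u assms(2) by simp_all
qed

lemma unitary_adjoint: "c \<in> unitary_group N \<Longrightarrow> mat_adjoint c \<in> unitary_group N"
  by (auto simp: unitary_group_def intro!: carrier_matI)

lemma unitary_mult:
  assumes "c \<in> unitary_group N" "d \<in> unitary_group N"
  shows "c * d \<in> unitary_group N"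
proof -
  note u = unitary_groupD[OF assms(1)] unitary_groupD[OF assms(2)]
  show ?thesis
    using u unitary_cancel[OF assms(1)] unitary_cancel[OF assms(2)]
    by (auto simp: unitary_group_def adjoint_mult mat_mult_assoc intro!: carrier_matI)
qed

lemma unitary_smult:
  assumes "c \<in> unitary_group N" "cmod \<alpha> = 1"
  shows "\<alpha> \<cdot>\<^sub>m c \<in> unitary_group N"
proof -
  have "\<alpha> * cnj \<alpha> = 1" "cnj \<alpha> * \<alpha> = 1"
    using assms(2) complex_norm_square[of \<alpha>] by (simp_all add: mult.commute)
  thus ?thesis using unitary_groupD[OF assms(1)]
    by (auto simp: unitary_group_def adjoint_smult mat_mult_smult smult_smult_mat intro!: carrier_matI)
qed

lemma conjugate_by_dims [simp]:
  "dim_row (conjugate_by c P) = dim_row c" "dim_col (conjugate_by c P) = dim_row c"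
  by (simp_all add: conjugate_by_def)

lemma conjugate_by_mult:
  assumes "c \<in> unitary_group N" "P \<in> operators N" "Q \<in> operators N"
  shows "conjugate_by c (P * Q) = conjugate_by c P * conjugate_by c Q"
  using unitary_groupD(1,2)[OF assms(1)] unitary_cancel[OF assms(1)] assms(2,3)
  by (simp add: conjugate_by_def mat_mult_assoc carrier_matD)

lemma conjugate_by_smult:
  assumes "c \<in> unitary_group N" "P \<in> operators N"
  shows "conjugate_by c (\<alpha> \<cdot>\<^sub>m P) = \<alpha> \<cdot>\<^sub>m conjugate_by c P"
  using unitary_groupD(1,2)[OF assms(1)] assms(2) by (simp add: conjugate_by_def mat_mult_smult carrier_matD)

lemma conjugate_by_one: "c \<in> unitary_group N \<Longrightarrow> conjugate_by c (1\<^sub>m (2 ^ N)) = 1\<^sub>m (2 ^ N)"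
  using unitary_groupD[of c N] by (simp add: conjugate_by_def)

lemma conjugate_by_comp:
  assumes "c \<in> unitary_group N" "d \<in> unitary_group N" "P \<in> operators N"
  shows "conjugate_by (c * d) P = conjugate_by c (conjugate_by d P)"
  using unitary_groupD(1,2)[OF assms(1)] unitary_groupD(1,2)[OF assms(2)] assms(3)
  by (simp add: conjugate_by_def mat_mult_assoc carrier_matD adjoint_mult)

lemma conjugate_by_adjoint:
  assumes "c \<in> unitary_group N" "P \<in> operators N"
  shows "conjugate_by (mat_adjoint c) (conjugate_by c P) = P"
    and "conjugate_by c (conjugate_by (mat_adjoint c) P) = P"
  using unitary_groupD[OF assms(1)] unitary_cancel[OF assms(1)] assms(2)
  by (simp_all add: conjugate_by_def mat_mult_assoc carrier_matD)

lemma conjugate_by_phase: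
  assumes "c \<in> unitary_group N" "P \<in> operators N" "cmod \<alpha> = 1"
  shows "conjugate_by (\<alpha> \<cdot>\<^sub>m c) P = conjugate_by c P"
proof -
  have "\<alpha> * cnj \<alpha> = 1" "cnj \<alpha> * \<alpha> = 1"
    using assms(3) complex_norm_square[of \<alpha>] by (simp_all add: mult.commute)
  thus ?thesis using unitary_groupD(1,2)[OF assms(1)] assms(2)
    by (simp add: conjugate_by_def adjoint_smult mat_mult_smult smult_smult_mat carrier_matD)
qed

lemma conjugate_by_inj:
  assumes "c \<in> unitary_group N" "S \<subseteq> operators N"
  shows "inj_on (conjugate_by c) S"
  by (rule inj_on_inverseI[of _ "conjugate_by (mat_adjoint c)"])
    (use assms conjugate_by_adjoint in blast)

lemma comm_sign_conjugate:
  assumes "c \<in> unitary_group N" "P \<in> operators N" "Q \<in> operators N"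
  shows "comm_sign (conjugate_by c P) (conjugate_by c Q) = comm_sign P Q"
proof -
  have "P * Q \<in> operators N" "Q * P \<in> operators N" using assms by auto
  hence "conjugate_by c (P * Q) = conjugate_by c (Q * P) \<longleftrightarrow> P * Q = Q * P"
    using conjugate_by_adjoint(1)[OF assms(1)] by metis
  thus ?thesis using assms by (simp add: comm_sign_def conjugate_by_mult[symmetric])
qed

section \<open>Membership criteria and closure properties of the restricted Clifford set\<close>

lemma pauli_group_split: "pauli_group N = pauli_BD N \<union> pauli_ABD N"
  unfolding set_eq_iff Un_iff pauli_BD_iff pauli_ABD_iff using comm_sign_cases by blast

text \<open>Both parity classes of Pauli operators are finite and conjugation is injective, so the
  inclusions in the definition are equalities. In this symmetric form closure under inverses is
  visible.\<close>

lemma restricted_clifford_iff: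
  "c \<in> restricted_clifford N \<longleftrightarrow> c \<in> unitary_group N \<and>
     conjugate_by c ` pauli_BD N = pauli_BD N \<and> conjugate_by c ` pauli_ABD N = pauli_ABD N"
proof
  assume c: "c \<in> restricted_clifford N"
  hence u: "c \<in> unitary_group N"
    and sub: "conjugate_by c ` pauli_BD N \<subseteq> pauli_BD N" "conjugate_by c ` pauli_ABD N \<subseteq> pauli_ABD N"
    by (auto simp: restricted_clifford_def clifford_group_def conjugate_by_def)
  have op: "pauli_BD N \<subseteq> operators N" "pauli_ABD N \<subseteq> operators N"
    using pauli_group_operator pauli_group_split by blast+
  have "finite (pauli_BD N)" "finite (pauli_ABD N)"
    using finite_pauli_group[of N] pauli_group_split[of N] by simp_all
  thus "c \<in> unitary_group N \<and>
     conjugate_by c ` pauli_BD N = pauli_BD N \<and> conjugate_by c ` pauli_ABD N = pauli_ABD N"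
    using u endo_inj_surj sub conjugate_by_inj[OF u] op by metis
next
  assume c: "c \<in> unitary_group N \<and>
     conjugate_by c ` pauli_BD N = pauli_BD N \<and> conjugate_by c ` pauli_ABD N = pauli_ABD N"
  hence "conjugate_by c ` pauli_group N = pauli_group N"
    unfolding pauli_group_split by (simp add: image_Un)
  with c show "c \<in> restricted_clifford N"
    unfolding restricted_clifford_def clifford_group_def conjugate_by_def by auto
qed

text \<open>Again by finiteness, it is enough that conjugation maps Pauli operators to Pauli
  operators of the same parity; surjectivity comes for free.\<close>

lemma restricted_cliffordI:
  assumes u: "c \<in> unitary_group N"
    and cl: "\<And>P. P \<in> pauli_group N \<Longrightarrow> conjugate_by c P \<in> pauli_group N"
    and sg: "\<And>P. P \<in> pauli_group N \<Longrightarrow>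
       comm_sign (parity_string N) (conjugate_by c P) = comm_sign (parity_string N) P"
  shows "c \<in> restricted_clifford N"
  unfolding restricted_clifford_iff
proof (intro conjI u endo_inj_surj)
  show "finite (pauli_BD N)" "finite (pauli_ABD N)"
    using finite_pauli_group[of N] pauli_group_split[of N] by simp_all
  show "conjugate_by c ` pauli_BD N \<subseteq> pauli_BD N" "conjugate_by c ` pauli_ABD N \<subseteq> pauli_ABD N"
    using cl sg by (auto simp: pauli_BD_iff pauli_ABD_iff)
  show "inj_on (conjugate_by c) (pauli_BD N)" "inj_on (conjugate_by c) (pauli_ABD N)"
    using pauli_group_operator pauli_group_split by (blast intro: conjugate_by_inj[OF u])+
qed

lemma restricted_cliffordD:
  assumes "c \<in> restricted_clifford N"
  shows "c \<in> unitary_group N"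
    and "P \<in> pauli_group N \<Longrightarrow> conjugate_by c P \<in> pauli_group N"
    and "P \<in> pauli_group N \<Longrightarrow>
      comm_sign (parity_string N) (conjugate_by c P) = comm_sign (parity_string N) P"
proof -
  have c: "conjugate_by c ` pauli_BD N \<subseteq> pauli_BD N" "conjugate_by c ` pauli_ABD N \<subseteq> pauli_ABD N"
    using assms unfolding restricted_clifford_iff by blast+
  show "c \<in> unitary_group N" using assms unfolding restricted_clifford_iff by blast
  assume P: "P \<in> pauli_group N"
  consider "P \<in> pauli_BD N" | "P \<in> pauli_ABD N" using P pauli_group_split by blast
  hence "conjugate_by c P \<in> pauli_BD N \<and> P \<in> pauli_BD N \<or>
      conjugate_by c P \<in> pauli_ABD N \<and> P \<in> pauli_ABD N"
    using c by cases blast+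
  thus "conjugate_by c P \<in> pauli_group N"
    "comm_sign (parity_string N) (conjugate_by c P) = comm_sign (parity_string N) P"
    by (auto simp: pauli_BD_iff pauli_ABD_iff)
qed

lemma restricted_clifford_adjoint:
  assumes "c \<in> restricted_clifford N"
  shows "mat_adjoint c \<in> restricted_clifford N"
proof -
  have u: "c \<in> unitary_group N" by (rule restricted_cliffordD(1)[OF assms])
  have *: "conjugate_by (mat_adjoint c) ` S = S" if "conjugate_by c ` S = S" "S \<subseteq> operators N" for S
  proof -
    have "conjugate_by (mat_adjoint c) ` conjugate_by c ` S = S"
      unfolding image_image using that(2) conjugate_by_adjoint(1)[OF u] by (force simp: subset_iff)
    thus ?thesis using that(1) by simp
  qed
  have "pauli_BD N \<subseteq> operators N" "pauli_ABD N \<subseteq> operators N"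
    using pauli_group_operator pauli_group_split by blast+
  with * show ?thesis
    using assms unitary_adjoint[OF u] by (simp add: restricted_clifford_iff)
qed

lemma restricted_clifford_mult:
  assumes "c \<in> restricted_clifford N" "d \<in> restricted_clifford N"
  shows "c * d \<in> restricted_clifford N"
proof (rule restricted_cliffordI)
  note c = restricted_cliffordD[OF assms(1)] and d = restricted_cliffordD[OF assms(2)]
  show "c * d \<in> unitary_group N" using c d by (blast intro: unitary_mult)
  fix P assume P: "P \<in> pauli_group N"
  show "conjugate_by (c * d) P \<in> pauli_group N"
    "comm_sign (parity_string N) (conjugate_by (c * d) P) = comm_sign (parity_string N) P"
    using conjugate_by_comp[OF c(1) d(1) pauli_group_operator[OF P]] c(2,3) d(2,3) P by simp_all
qed

lemma restricted_clifford_smult: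
  assumes "c \<in> restricted_clifford N" "cmod \<alpha> = 1"
  shows "\<alpha> \<cdot>\<^sub>m c \<in> restricted_clifford N"
proof (rule restricted_cliffordI)
  note c = restricted_cliffordD[OF assms(1)]
  show "\<alpha> \<cdot>\<^sub>m c \<in> unitary_group N" using c assms by (blast intro: unitary_smult)
  fix P assume P: "P \<in> pauli_group N"
  show "conjugate_by (\<alpha> \<cdot>\<^sub>m c) P \<in> pauli_group N"
    "comm_sign (parity_string N) (conjugate_by (\<alpha> \<cdot>\<^sub>m c) P) = comm_sign (parity_string N) P"
    using conjugate_by_phase[OF c(1) pauli_group_operator[OF P] assms(2)] c(2,3) P by simp_all
qed

lemma pauli_group_unitary: "P \<in> pauli_group N \<Longrightarrow> P \<in> unitary_group N"
  by (simp add: unitary_group_def pauli_group_operator pauli_group_adjoint)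

lemma conjugate_by_pauli:
  assumes "P \<in> pauli_group N" "Q \<in> pauli_group N"
  shows "conjugate_by P Q = comm_sign P Q \<cdot>\<^sub>m Q"
proof -
  note d = assms[THEN pauli_group_dims(1)] assms[THEN pauli_group_dims(2)]
  have "conjugate_by P Q = comm_sign P Q \<cdot>\<^sub>m (Q * (P * mat_adjoint P))"
    unfolding conjugate_by_def comm_sign_mult_swap[OF assms] using d
    by (simp add: mat_mult_smult mat_mult_assoc)
  thus ?thesis using d pauli_group_adjoint(2)[OF assms(1)] by simp
qed

lemma comm_sign_in_phases: "comm_sign P Q \<in> phases"
  by (simp add: comm_sign_def phases_def)

text \<open>Conjugation by P changes a Pauli operator only by a sign, which affects neither
  membership nor parity. In particular P itself may be anti-block-diagonal.\<close>

lemma pauli_restricted_clifford: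
  assumes "P \<in> pauli_group N"
  shows "P \<in> restricted_clifford N"
proof (rule restricted_cliffordI)
  show "P \<in> unitary_group N" by (rule pauli_group_unitary[OF assms])
  fix Q assume Q: "Q \<in> pauli_group N"
  show "conjugate_by P Q \<in> pauli_group N"
    "comm_sign (parity_string N) (conjugate_by P Q) = comm_sign (parity_string N) Q"
    unfolding conjugate_by_pauli[OF assms Q]
    by (simp_all add: pauli_group_smult Q comm_sign_in_phases comm_sign_phase_right[OF parity_string_group])
qed

text \<open>
  The gate \<open>(P + Q) / \<surd>2\<close> is the reflection that exchanges \<open>P\<close> and \<open>Q\<close>; it has definite
  parity because \<open>P\<close> and \<open>Q\<close> have the same parity.
\<close>

lemma conjugate_by_sum_paulis:
  assumes PQ: "P \<in> pauli_words N" "Q \<in> pauli_words N" "comm_sign P Q = - 1"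
    and par: "comm_sign (parity_string N) P = comm_sign (parity_string N) Q"
  defines "c \<equiv> complex_of_real (1 / sqrt 2) \<cdot>\<^sub>m (P + Q)"
  shows "c \<in> restricted_clifford N" "conjugate_by c P = Q"
proof -
  let ?k = "complex_of_real (1 / sqrt 2)"
  have "1 / sqrt 2 * (1 / sqrt 2) = 1 / 2" by simp
  hence "?k * ?k = complex_of_real (1 / 2)" by (simp only: of_real_mult[symmetric])
  hence k: "?k * ?k = 1 / 2" "cnj ?k = ?k" by (simp_all del: of_real_divide add: of_real_divide[of 1 2])
  have G: "P \<in> pauli_group N" "Q \<in> pauli_group N" using PQ(1,2) pauli_words_subset_group by blast+
  note d = G[THEN pauli_group_dims(1)] G[THEN pauli_group_dims(2)]
  note sq = PQ(1,2)[THEN pauli_words_square]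
  have QP: "Q * P = (- 1) \<cdot>\<^sub>m (P * Q)"
    using comm_sign_mult_swap[OF G(2,1)] PQ(3) by (simp add: comm_sign_sym)
  have dc: "dim_row c = 2 ^ N" "dim_col c = 2 ^ N" using d by (simp_all add: c_def)
  have adj: "mat_adjoint c = c"
    using d k(2) PQ(1,2)[THEN pauli_words_adjoint] by (simp only: c_def adjoint_smult adjoint_add)
  \<comment> \<open>Move P and Q to the right past R, with signs a and b. The squares contribute (a
    + b) R and the mixed products (a - b) R P Q, because Q P = - P Q. One of these vanishes and the
    other has a factor 2 or - 2, which the normalisation 1 / 2 compensates.\<close>
  have con: "c * R * c = (if comm_sign P R = comm_sign Q R then comm_sign P R \<cdot>\<^sub>m R
      else comm_sign P R \<cdot>\<^sub>m (R * (P * Q)))" if R: "R \<in> pauli_group N" for R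
  proof -
    define a b where ab: "a = comm_sign P R" "b = comm_sign Q R"
    note dR = pauli_group_dims[OF R]
    have s: "P * R = a \<cdot>\<^sub>m (R * P)" "Q * R = b \<cdot>\<^sub>m (R * Q)"
      unfolding ab using comm_sign_mult_swap[OF _ R] G by blast+
    have "(P + Q) * R = a \<cdot>\<^sub>m (R * P) + b \<cdot>\<^sub>m (R * Q)"
      using d dR s by (simp only: mat_add_mult)
    hence "c * R * c = (?k * ?k) \<cdot>\<^sub>m ((a \<cdot>\<^sub>m (R * P) + b \<cdot>\<^sub>m (R * Q)) * (P + Q))"
      unfolding c_def using d dR by (simp add: mat_mult_smult smult_smult_mat)
    also have "(a \<cdot>\<^sub>m (R * P) + b \<cdot>\<^sub>m (R * Q)) * (P + Q)
        = (a \<cdot>\<^sub>m R + b \<cdot>\<^sub>m ((- 1) \<cdot>\<^sub>m (R * (P * Q)))) + (a \<cdot>\<^sub>m (R * (P * Q)) + b \<cdot>\<^sub>m R)"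
      using d dR by (simp add: mat_mult_add mat_add_mult mat_mult_smult mat_mult_assoc QP sq)
    finally have eq: "c * R * c = (1 / 2) \<cdot>\<^sub>m
        ((a \<cdot>\<^sub>m R + b \<cdot>\<^sub>m ((- 1) \<cdot>\<^sub>m (R * (P * Q)))) + (a \<cdot>\<^sub>m (R * (P * Q)) + b \<cdot>\<^sub>m R))"
      unfolding k(1) .
    show ?thesis
    proof (cases "a = b")
      case True
      have "c * R * c = a \<cdot>\<^sub>m R"
        unfolding eq True[symmetric] using d dR by (intro eq_matI) (simp_all del: index_mult_mat(1))
      thus ?thesis using True by (simp add: ab)
    next
      case False
      hence b: "b = - a" unfolding ab using comm_sign_cases[of P R] comm_sign_cases[of Q R] by auto
      have "c * R * c = a \<cdot>\<^sub>m (R * (P * Q))"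
        unfolding eq b using d dR by (intro eq_matI) (simp_all del: index_mult_mat(1))
      thus ?thesis using False by (simp add: ab)
    qed
  qed
  have conR: "conjugate_by c R \<in> pauli_group N"
    "comm_sign (parity_string N) (conjugate_by c R) = comm_sign (parity_string N) R"
    if R: "R \<in> pauli_group N" for R
  proof -
    note S = parity_string_group[of N]
    have G': "P * Q \<in> pauli_group N" "R * (P * Q) \<in> pauli_group N"
      using R G pauli_group_mult by blast+
    show "conjugate_by c R \<in> pauli_group N"
      unfolding conjugate_by_def adj con[OF R]
      using pauli_group_smult[OF _ comm_sign_in_phases] R G' by simp
    \<comment> \<open>P and Q have equal parity, so their product is block-diagonal and multiplying
      R by it preserves the parity of R.\<close>
    have "comm_sign (parity_string N) (R * (P * Q)) = comm_sign (parity_string N) R"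
      using comm_sign_mult_right[OF S R G'(1)] comm_sign_mult_right[OF S G] par by simp
    thus "comm_sign (parity_string N) (conjugate_by c R) = comm_sign (parity_string N) R"
      unfolding conjugate_by_def adj con[OF R]
      using comm_sign_phase_right[OF S _ comm_sign_in_phases] R G' by simp
  qed
  \<comment> \<open>Unitarity of the Hermitian c is the case R = 1 of \<open>con\<close>, where both
    signs are 1.\<close>
  have "c * 1\<^sub>m (2 ^ N) * c = 1\<^sub>m (2 ^ N)"
    using con[OF pauli_group_one] d by (simp add: comm_sign_def)
  hence "c * c = 1\<^sub>m (2 ^ N)" using dc by simp
  hence "c \<in> unitary_group N" using dc by (auto simp: unitary_group_def adj)
  thus "c \<in> restricted_clifford N" using conR by (rule restricted_cliffordI)
  have "comm_sign P P = 1" "comm_sign Q P = - 1" "P * (P * Q) = Q"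
    using PQ(3) d sq mat_mult_assoc[of P P Q] by (simp_all add: comm_sign_sym)
  thus "conjugate_by c P = Q"
    unfolding conjugate_by_def adj using con[OF G(1)] by simp
qed

text \<open>An arbitrary function \<mu> constant on orbits stands in for the orbits; it will be the
  coefficient function of an invariant operator. Phases are stripped from P and Q because the gate
  exchanging them is built from Hermitian representatives.\<close>

lemma orbit_anticommuting:
  assumes \<mu>: "\<And>\<alpha> A. \<alpha> \<in> phases \<Longrightarrow> A \<in> pauli_group N \<Longrightarrow> \<mu> (\<alpha> \<cdot>\<^sub>m A) = \<mu> A"
      "\<And>c A. c \<in> restricted_clifford N \<Longrightarrow> A \<in> pauli_group N \<Longrightarrow> \<mu> (conjugate_by c A) = \<mu> A"
    and PQ: "P \<in> pauli_group N" "Q \<in> pauli_group N" "comm_sign P Q = - 1"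
      "comm_sign (parity_string N) P = comm_sign (parity_string N) Q"
  shows "\<mu> P = \<mu> Q"
proof -
  obtain \<alpha> V where V: "\<alpha> \<in> phases" "V \<in> pauli_words N" "P = \<alpha> \<cdot>\<^sub>m V"
    using PQ(1) by (rule pauli_groupE)
  obtain \<beta> W where W: "\<beta> \<in> phases" "W \<in> pauli_words N" "Q = \<beta> \<cdot>\<^sub>m W"
    using PQ(2) by (rule pauli_groupE)
  have G: "V \<in> pauli_group N" "W \<in> pauli_group N" using V W pauli_words_subset_group by blast+
  note S = parity_string_group[of N]
  have "comm_sign V W = - 1"
    using PQ(3) comm_sign_phase_left[OF G(1) PQ(2) V(1)] comm_sign_phase_right[OF G W(1)] V(3) W(3) by simp
  moreover have "comm_sign (parity_string N) V = comm_sign (parity_string N) W"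
    using PQ(4) comm_sign_phase_right[OF S G(1) V(1)] comm_sign_phase_right[OF S G(2) W(1)] V(3) W(3) by simp
  ultimately have "\<mu> W = \<mu> V"
    using conjugate_by_sum_paulis[OF V(2) W(2)] \<mu>(2)[OF _ G(1)] by metis
  thus ?thesis using \<mu>(1)[OF V(1) G(1)] \<mu>(1)[OF W(1) G(2)] V(3) W(3) by simp
qed

text \<open>
  For commuting \<open>P\<close> and \<open>Q\<close>, pass through \<open>S P\<close>, which anticommutes with both.
\<close>

lemma orbit_ABD:
  assumes \<mu>: "\<And>\<alpha> A. \<alpha> \<in> phases \<Longrightarrow> A \<in> pauli_group N \<Longrightarrow> \<mu> (\<alpha> \<cdot>\<^sub>m A) = \<mu> A"
      "\<And>c A. c \<in> restricted_clifford N \<Longrightarrow> A \<in> pauli_group N \<Longrightarrow> \<mu> (conjugate_by c A) = \<mu> A"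
    and P: "P \<in> pauli_ABD N" and Q: "Q \<in> pauli_ABD N"
  shows "\<mu> P = \<mu> Q"
proof -
  let ?S = "parity_string N"
  note S = parity_string_group[of N]
  have G: "P \<in> pauli_group N" "Q \<in> pauli_group N" and s: "comm_sign ?S P = - 1" "comm_sign ?S Q = - 1"
    using P Q by (simp_all add: pauli_ABD_iff)
  have orb: "\<mu> X = \<mu> Y" if "X \<in> pauli_group N" "Y \<in> pauli_group N" "comm_sign X Y = - 1"
    "comm_sign ?S X = comm_sign ?S Y" for X Y
    using orbit_anticommuting[of N \<mu> X Y] \<mu> that by blast
  show ?thesis
  proof (cases "comm_sign P Q = - 1")
    case True
    thus ?thesis using orb[OF G] s by simp
  next
    case False
    hence "comm_sign P Q = 1" using comm_sign_cases by blast
    moreover note SP = pauli_group_mult[OF S G(1)]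
    ultimately have "comm_sign P (?S * P) = - 1" "comm_sign (?S * P) Q = - 1" "comm_sign ?S (?S * P) = - 1"
      using comm_sign_mult_right[OF G(1) S G(1)] comm_sign_mult_left[OF S G] comm_sign_mult_right[OF S S G(1)] s
      by (simp_all add: comm_sign_sym[of P ?S])
    hence "\<mu> P = \<mu> (?S * P)" "\<mu> (?S * P) = \<mu> Q"
      using orb[OF G(1) SP] orb[OF SP G(2)] s by simp_all
    thus ?thesis by simp
  qed
qed

text \<open>
  One of \<open>P'\<close>, \<open>Q'\<close>, \<open>P' Q'\<close> anticommutes with both \<open>P\<close> and \<open>Q\<close>.
\<close>

lemma orbit_BD:
  assumes \<mu>: "\<And>\<alpha> A. \<alpha> \<in> phases \<Longrightarrow> A \<in> pauli_group N \<Longrightarrow> \<mu> (\<alpha> \<cdot>\<^sub>m A) = \<mu> A"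
      "\<And>c A. c \<in> restricted_clifford N \<Longrightarrow> A \<in> pauli_group N \<Longrightarrow> \<mu> (conjugate_by c A) = \<mu> A"
    and P: "P \<in> pauli_BD N" and P': "P' \<in> pauli_BD N" "comm_sign P P' = - 1"
    and Q: "Q \<in> pauli_BD N" and Q': "Q' \<in> pauli_BD N" "comm_sign Q Q' = - 1"
  shows "\<mu> P = \<mu> Q"
proof -
  let ?S = "parity_string N"
  note S = parity_string_group[of N]
  have G: "P \<in> pauli_group N" "P' \<in> pauli_group N" "Q \<in> pauli_group N" "Q' \<in> pauli_group N"
    and s: "comm_sign ?S P = 1" "comm_sign ?S P' = 1" "comm_sign ?S Q = 1" "comm_sign ?S Q' = 1"
    using P Q P' Q' by (simp_all add: pauli_BD_iff)
  obtain R where R: "R \<in> pauli_group N" "comm_sign ?S R = 1" "comm_sign P R = - 1" "comm_sign Q R = - 1"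
  proof -
    consider "comm_sign Q P' = - 1" | "comm_sign P Q' = - 1"
      | "comm_sign Q P' = 1" "comm_sign P Q' = 1"
      using comm_sign_cases by blast
    thus thesis
    proof cases
      case 3
      thus thesis
        using that[of "P' * Q'"] pauli_group_mult[OF G(2,4)] comm_sign_mult_right[OF S G(2,4)]
          comm_sign_mult_right[OF G(1,2,4)] comm_sign_mult_right[OF G(3,2,4)] s P'(2) Q'(2) by simp
    qed (use that G s P'(2) Q'(2) in auto)
  qed
  have orb: "\<mu> X = \<mu> Y" if "X \<in> pauli_group N" "Y \<in> pauli_group N" "comm_sign X Y = - 1"
    "comm_sign ?S X = comm_sign ?S Y" for X Y
    using orbit_anticommuting[of N \<mu> X Y] \<mu> that by blast
  have "\<mu> P = \<mu> R" "\<mu> R = \<mu> Q"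
    using orb[OF G(1) R(1)] orb[OF R(1) G(3)] R s by (simp_all add: comm_sign_sym[of R Q])
  thus ?thesis by simp
qed

text \<open>Conjugation by c permutes the block-diagonal Pauli operators, so the image of S still
  commutes with all of them; by \<open>pauli_BD_central\<close> it is a phase times 1 or S. A scalar
  image would pull back to a scalar S. Only the modulus of s matters for the invariants built from
  S.\<close>

lemma conjugate_by_parity_string:
  assumes N: "N \<ge> 1" and c: "c \<in> restricted_clifford N"
  shows "\<exists>s. s * cnj s = 1 \<and> conjugate_by c (parity_string N) = s \<cdot>\<^sub>m parity_string N"
proof -
  let ?S = "parity_string N"
  note S = parity_string_group[of N] and u = restricted_cliffordD(1)[OF c]
  note So = pauli_group_operator[OF S]
  have Q: "conjugate_by c ?S \<in> pauli_group N" by (rule restricted_cliffordD(2)[OF c S])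
  have "comm_sign (conjugate_by c ?S) R = 1" if R: "R \<in> pauli_BD N" for R
  proof -
    have "R \<in> conjugate_by c ` pauli_BD N" using c R unfolding restricted_clifford_iff by blast
    then obtain R' where R': "R' \<in> pauli_BD N" "R = conjugate_by c R'" by blast
    hence "R' \<in> pauli_group N" "comm_sign ?S R' = 1" by (simp_all add: pauli_BD_iff)
    thus ?thesis unfolding R'(2) using comm_sign_conjugate[OF u So] pauli_group_operator by simp
  qed
  from pauli_BD_central[OF Q this] obtain \<alpha> where \<alpha>: "\<alpha> \<in> phases"
    "conjugate_by c ?S = \<alpha> \<cdot>\<^sub>m 1\<^sub>m (2 ^ N) \<or> conjugate_by c ?S = \<alpha> \<cdot>\<^sub>m ?S" by blast
  have "conjugate_by c ?S \<noteq> \<alpha> \<cdot>\<^sub>m 1\<^sub>m (2 ^ N)"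
  proof
    assume *: "conjugate_by c ?S = \<alpha> \<cdot>\<^sub>m 1\<^sub>m (2 ^ N)"
    have "?S = conjugate_by (mat_adjoint c) (\<alpha> \<cdot>\<^sub>m 1\<^sub>m (2 ^ N))"
      unfolding *[symmetric] using conjugate_by_adjoint(1)[OF u So] by simp
    also have "\<dots> = \<alpha> \<cdot>\<^sub>m 1\<^sub>m (2 ^ N)"
      using unitary_adjoint[OF u] by (simp add: conjugate_by_smult conjugate_by_one)
    finally show False using parity_string_nonscalar[OF N] by blast
  qed
  thus ?thesis using \<alpha> phases_norm by blast
qed

section \<open>Irreducibility of the Pauli group\<close>

lemma mat_trace_anticommuting:
  assumes W: "W \<in> carrier_mat n n" and M: "M \<in> carrier_mat n n" and B: "B \<in> carrier_mat n n"
    and "B * B = 1\<^sub>m n" "W * B = (- 1) \<cdot>\<^sub>m (B * W)" "M * B = B * M"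
  shows "mat_trace (W * M) = 0"
proof -
  note d = carrier_matD[OF W] carrier_matD[OF M] carrier_matD[OF B]
  have "mat_trace (W * M) = mat_trace (W * M * (B * B))" using d assms(4) by simp
  also have "\<dots> = mat_trace ((W * M * B) * B)" using d by (simp add: mat_mult_assoc)
  also have "\<dots> = mat_trace (B * (W * M * B))" using d by (intro mat_trace_comm) simp_all
  also have "W * M * B = (W * B) * M" using d assms(6) by (simp add: mat_mult_assoc)
  also have "B * \<dots> = (- 1) \<cdot>\<^sub>m ((B * B) * (W * M))"
    unfolding assms(5) using d by (simp add: mat_mult_assoc mat_mult_smult)
  also have "mat_trace \<dots> = - mat_trace (W * M)"
    using d assms(4) by (simp add: mat_trace_smult)
  finally show ?thesis by simp
qed

lemma mat_trace_pauli_word: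
  assumes "W \<in> pauli_words N" "W \<noteq> 1\<^sub>m (2 ^ N)" "M \<in> operators N"
    and "\<And>B. B \<in> pauli_words N \<Longrightarrow> M * B = B * M"
  shows "mat_trace (W * M) = 0"
proof -
  obtain B where B: "B \<in> pauli_words N" "W * B = (- 1) \<cdot>\<^sub>m (B * W)"
    using pauli_words_anticomm[OF assms(1,2)] by blast
  show ?thesis
    using mat_trace_anticommuting[OF pauli_word_operator[OF assms(1)] assms(3) pauli_word_operator[OF B(1)]
        pauli_words_square[OF B(1)] B(2) assms(4)[OF B(1)]] .
qed

text \<open>Schur's lemma through traces: anticommutation makes M traceless against every word
  except the identity, and subtracting a suitable scalar removes that last trace as well.\<close>

lemma pauli_commutant:
  assumes M: "M \<in> operators N" and comm: "\<And>B. B \<in> pauli_words N \<Longrightarrow> M * B = B * M"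
  shows "\<exists>\<alpha>. M = \<alpha> \<cdot>\<^sub>m 1\<^sub>m (2 ^ N)"
proof -
  \<comment> \<open>This scalar has the same trace as M, so X pairs to zero with the identity
    word.\<close>
  define \<alpha> where "\<alpha> = mat_trace M / 2 ^ N"
  define X where "X = M + (- \<alpha>) \<cdot>\<^sub>m 1\<^sub>m (2 ^ N)"
  have X: "X \<in> operators N" using M by (simp add: X_def)
  have "mat_trace (W * X) = 0" if W: "W \<in> pauli_words N" for W
  proof -
    note dW = pauli_word_operator[OF W]
    have e: "mat_trace (W * X) = mat_trace (W * M) - \<alpha> * mat_trace (W * 1\<^sub>m (2 ^ N))"
      using M dW by (simp add: X_def mat_mult_add mat_mult_smult mat_trace_add mat_trace_smult carrier_matD)
    show ?thesis
    proof (cases "W = 1\<^sub>m (2 ^ N)")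
      case True
      thus ?thesis using M unfolding e by (simp add: \<alpha>_def mat_trace_one)
    next
      case False
      have "mat_trace (W * 1\<^sub>m (2 ^ N)) = 0"
        by (rule mat_trace_pauli_word[OF W False]) (auto dest: pauli_word_operator)
      moreover have "mat_trace (W * M) = 0"
        by (rule mat_trace_pauli_word[OF W False M comm])
      ultimately show ?thesis unfolding e by simp
    qed
  qed
  with separating_pauli_words X have 0: "X = 0\<^sub>m (2 ^ N) (2 ^ N)" unfolding separating_def by blast
  have "M = \<alpha> \<cdot>\<^sub>m 1\<^sub>m (2 ^ N)"
  proof (rule eq_matI)
    fix i j assume "i < dim_row (\<alpha> \<cdot>\<^sub>m 1\<^sub>m (2 ^ N))" "j < dim_col (\<alpha> \<cdot>\<^sub>m 1\<^sub>m (2 ^ N))"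
    hence ij: "i < 2 ^ N" "j < 2 ^ N" by simp_all
    have "X $$ (i, j) = 0" using 0 ij by simp
    thus "M $$ (i, j) = (\<alpha> \<cdot>\<^sub>m 1\<^sub>m (2 ^ N)) $$ (i, j)" using ij M by (simp add: X_def)
  qed (use M in auto)
  thus ?thesis by blast
qed

lemma unitary_scalar_norm:
  assumes "\<alpha> \<cdot>\<^sub>m 1\<^sub>m (2 ^ N) \<in> unitary_group N"
  shows "cmod \<alpha> = 1"
proof -
  have "(\<alpha> * cnj \<alpha>) \<cdot>\<^sub>m 1\<^sub>m (2 ^ N) = (1\<^sub>m (2 ^ N) :: complex mat)"
    using unitary_groupD(3)[OF assms] by (simp add: adjoint_smult mat_mult_smult smult_smult_mat mult.commute)
  from arg_cong[OF this, of "\<lambda>A. A $$ (0, 0)"] have "\<alpha> * cnj \<alpha> = 1" by simp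
  hence "(cmod \<alpha>)\<^sup>2 = 1" by (metis complex_norm_square of_real_eq_1_iff)
  moreover have "cmod \<alpha> \<noteq> - 1" using norm_ge_zero[of \<alpha>] by linarith
  ultimately show ?thesis by (simp add: power2_eq_1_iff)
qed

text \<open>The product of the adjoint of c with d commutes with every Pauli word, hence is a
  scalar, and being unitary it is a phase.\<close>

lemma conjugation_determines_phase:
  assumes c: "c \<in> unitary_group N" and d: "d \<in> unitary_group N"
    and eq: "\<And>P. P \<in> pauli_group N \<Longrightarrow> conjugate_by c P = conjugate_by d P"
  shows "\<exists>\<alpha>. cmod \<alpha> = 1 \<and> d = \<alpha> \<cdot>\<^sub>m c"
proof -
  define M where "M = mat_adjoint c * d"
  have M: "M \<in> unitary_group N" unfolding M_def using c d unitary_adjoint unitary_mult by blast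
  note u = unitary_groupD[OF c] unitary_groupD[OF d]
  have "M * B = B * M" if B: "B \<in> pauli_words N" for B
  proof -
    have G: "B \<in> pauli_group N" using B pauli_words_subset_group by blast
    note dB = pauli_group_dims[OF G]
    have "M * B = mat_adjoint c * (d * B * mat_adjoint d) * d"
      using u dB unitary_cancel[OF d] by (simp add: M_def mat_mult_assoc)
    also have "d * B * mat_adjoint d = c * B * mat_adjoint c"
      using eq[OF G] by (simp add: conjugate_by_def)
    also have "mat_adjoint c * \<dots> * d = B * M"
      using u dB unitary_cancel[OF c] by (simp add: M_def mat_mult_assoc)
    finally show ?thesis .
  qed
  moreover have "M \<in> operators N" using M by (simp add: unitary_group_def)
  ultimately obtain \<alpha> where \<alpha>: "M = \<alpha> \<cdot>\<^sub>m 1\<^sub>m (2 ^ N)" using pauli_commutant by blast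
  have "d = c * M" using u unitary_cancel[OF c] by (simp add: M_def)
  hence "d = \<alpha> \<cdot>\<^sub>m c" unfolding \<alpha> using u by (simp add: mat_mult_smult)
  moreover have "cmod \<alpha> = 1" using M unfolding \<alpha> by (rule unitary_scalar_norm)
  ultimately show ?thesis by blast
qed

lemma equiv_phase: "equiv UNIV phase_equiv"
proof (rule equivI)
  show "refl phase_equiv"
  proof (rule refl_onI)
    fix U :: "complex mat" show "(U, U) \<in> phase_equiv"
      unfolding phase_equiv_def by (auto intro: exI[of _ 1])
  qed
  show "sym phase_equiv"
  proof (rule symI)
    fix U V :: "complex mat" assume "(U, V) \<in> phase_equiv"
    then obtain \<alpha> where \<alpha>: "cmod \<alpha> = 1" "V = \<alpha> \<cdot>\<^sub>m U" by (auto simp: phase_equiv_def)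
    have "U = (1 / \<alpha>) \<cdot>\<^sub>m V" "cmod (1 / \<alpha>) = 1"
      using \<alpha> by (auto simp: smult_smult_mat norm_divide)
    thus "(V, U) \<in> phase_equiv" unfolding phase_equiv_def by blast
  qed
  show "trans phase_equiv"
  proof (rule transI)
    fix U V W :: "complex mat" assume "(U, V) \<in> phase_equiv" "(V, W) \<in> phase_equiv"
    then obtain \<alpha> \<beta> where "cmod \<alpha> = 1" "V = \<alpha> \<cdot>\<^sub>m U" "cmod \<beta> = 1" "W = \<beta> \<cdot>\<^sub>m V"
      by (auto simp: phase_equiv_def)
    hence "W = (\<beta> * \<alpha>) \<cdot>\<^sub>m U" "cmod (\<beta> * \<alpha>) = 1" by (auto simp: smult_smult_mat norm_mult)
    thus "(U, W) \<in> phase_equiv" unfolding phase_equiv_def by blast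
  qed
qed simp_all


section \<open>The twirl as a projection onto invariant operators\<close>

definition class_rep :: "complex mat set \<Rightarrow> complex mat" where
  "class_rep K = (SOME c. c \<in> K)"

lemma phase_equiv_restricted_clifford:
  "(c, d) \<in> phase_equiv \<Longrightarrow> c \<in> restricted_clifford N \<Longrightarrow> d \<in> restricted_clifford N"
  by (auto simp: phase_equiv_def restricted_clifford_smult)

lemma class_rep_mem:
  assumes "K \<in> restricted_clifford_classes N"
  shows "class_rep K \<in> restricted_clifford N" "phase_equiv `` {class_rep K} = K"
proof -
  obtain c where c: "c \<in> restricted_clifford N" "K = phase_equiv `` {c}"
    using assms unfolding restricted_clifford_classes_def by (blast elim: quotientE)
  have "c \<in> K" unfolding c(2) by (rule equiv_class_self[OF equiv_phase]) simp
  hence "class_rep K \<in> K" unfolding class_rep_def by (rule someI)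
  hence r: "(c, class_rep K) \<in> phase_equiv" unfolding c(2) by blast
  show "class_rep K \<in> restricted_clifford N"
    by (rule phase_equiv_restricted_clifford[OF r c(1)])
  show "phase_equiv `` {class_rep K} = K"
    unfolding c(2) using equiv_class_eq[OF equiv_phase r[unfolded c(2)]] by simp
qed

lemma class_rep_class:
  assumes "c \<in> restricted_clifford N"
  shows "phase_equiv `` {c} \<in> restricted_clifford_classes N"
    and "(class_rep (phase_equiv `` {c}), c) \<in> phase_equiv"
proof -
  show K: "phase_equiv `` {c} \<in> restricted_clifford_classes N"
    unfolding restricted_clifford_classes_def by (rule quotientI[OF assms])
  show "(class_rep (phase_equiv `` {c}), c) \<in> phase_equiv"
    using eq_equiv_class[OF class_rep_mem(2)[OF K] equiv_phase] by simp
qed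

text \<open>A class is determined by the self-map it induces on the finite Pauli group. Restricting
  the map to that group makes functions that agree there equal.\<close>

lemma finite_restricted_clifford_classes: "finite (restricted_clifford_classes N)"
proof (rule inj_on_finite)
  let ?f = "\<lambda>K. restrict (conjugate_by (class_rep K)) (pauli_group N)"
  show "inj_on ?f (restricted_clifford_classes N)"
  proof (rule inj_onI)
    fix K L assume K: "K \<in> restricted_clifford_classes N" and L: "L \<in> restricted_clifford_classes N"
      and eq: "?f K = ?f L"
    have "conjugate_by (class_rep K) P = conjugate_by (class_rep L) P" if "P \<in> pauli_group N" for P
      using fun_cong[OF eq, of P] that by simp
    hence "(class_rep K, class_rep L) \<in> phase_equiv"
      using conjugation_determines_phase[of _ N] restricted_cliffordD(1) class_rep_mem(1) K L
      unfolding phase_equiv_def by blast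
    hence "phase_equiv `` {class_rep K} = phase_equiv `` {class_rep L}"
      by (rule equiv_class_eq[OF equiv_phase])
    thus "K = L" using class_rep_mem(2) K L by metis
  qed
  show "?f ` restricted_clifford_classes N \<subseteq> pauli_group N \<rightarrow>\<^sub>E pauli_group N"
  proof
    fix h assume "h \<in> ?f ` restricted_clifford_classes N"
    then obtain K where K: "K \<in> restricted_clifford_classes N" "h = ?f K" by blast
    show "h \<in> pauli_group N \<rightarrow>\<^sub>E pauli_group N"
      unfolding K(2) using restricted_cliffordD(2)[OF class_rep_mem(1)[OF K(1)]] by simp
  qed
  show "finite (pauli_group N \<rightarrow>\<^sub>E pauli_group N)"
    by (rule finite_PiE) (simp_all add: finite_pauli_group)
qed

text \<open>The identity has a class. If the set were infinite or empty, \<open>card\<close> would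
  be 0 and the normalising factor 1 / 0 = 0 would annihilate the twirl.\<close>

lemma card_restricted_clifford_classes_nonzero: "card (restricted_clifford_classes N) \<noteq> 0"
  using class_rep_class(1)[OF pauli_restricted_clifford[OF pauli_group_one]]
    finite_restricted_clifford_classes by (auto simp: card_eq_0_iff)

text \<open>The map g permutes the classes but need not send chosen representatives to chosen
  representatives; F is constant on classes and does not see the difference.\<close>

lemma sum_classes_reindex:
  assumes g: "\<And>c. c \<in> restricted_clifford N \<Longrightarrow> g c \<in> restricted_clifford N"
      "\<And>c. c \<in> restricted_clifford N \<Longrightarrow> h (g c) = c"
      "\<And>c d. c \<in> restricted_clifford N \<Longrightarrow> (c, d) \<in> phase_equiv \<Longrightarrow> (g c, g d) \<in> phase_equiv"
    and h: "\<And>c. c \<in> restricted_clifford N \<Longrightarrow> h c \<in> restricted_clifford N"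
      "\<And>c. c \<in> restricted_clifford N \<Longrightarrow> g (h c) = c"
      "\<And>c d. c \<in> restricted_clifford N \<Longrightarrow> (c, d) \<in> phase_equiv \<Longrightarrow> (h c, h d) \<in> phase_equiv"
    and F: "\<And>c d. c \<in> restricted_clifford N \<Longrightarrow> (c, d) \<in> phase_equiv \<Longrightarrow> F c = F d"
  shows "(\<Sum>K\<in>restricted_clifford_classes N. F (g (class_rep K)))
       = (\<Sum>K\<in>restricted_clifford_classes N. F (class_rep K))"
proof -
  \<comment> \<open>Stated for arbitrary g and h, so that both composites of the two maps on classes
    are instances.\<close>
  have inv: "phase_equiv `` {h (class_rep (phase_equiv `` {g (class_rep K)}))} = K"
    if K: "K \<in> restricted_clifford_classes N"
      and g: "\<And>c. c \<in> restricted_clifford N \<Longrightarrow> g c \<in> restricted_clifford N"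
      "\<And>c. c \<in> restricted_clifford N \<Longrightarrow> h (g c) = c"
      and h: "\<And>c d. c \<in> restricted_clifford N \<Longrightarrow> (c, d) \<in> phase_equiv \<Longrightarrow> (h c, h d) \<in> phase_equiv"
    for K g h
  proof -
    let ?r = "class_rep K" and ?r' = "class_rep (phase_equiv `` {g (class_rep K)})"
    have r: "?r \<in> restricted_clifford N" by (rule class_rep_mem(1)[OF K])
    hence gr: "g ?r \<in> restricted_clifford N" by (rule g(1))
    have "?r' \<in> restricted_clifford N" by (rule class_rep_mem(1)[OF class_rep_class(1)[OF gr]])
    hence "(h ?r', h (g ?r)) \<in> phase_equiv" by (rule h) (rule class_rep_class(2)[OF gr])
    hence "phase_equiv `` {h ?r'} = phase_equiv `` {?r}"
      unfolding g(2)[OF r] by (rule equiv_class_eq[OF equiv_phase])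
    thus ?thesis using class_rep_mem(2)[OF K] by simp
  qed
  show ?thesis
  proof (rule sum.reindex_bij_witness[where
        i = "\<lambda>K. phase_equiv `` {h (class_rep K)}" and j = "\<lambda>K. phase_equiv `` {g (class_rep K)}"])
    fix K assume K: "K \<in> restricted_clifford_classes N"
    have r: "class_rep K \<in> restricted_clifford N" by (rule class_rep_mem(1)[OF K])
    show "phase_equiv `` {h (class_rep (phase_equiv `` {g (class_rep K)}))} = K"
      by (rule inv[OF K g(1,2) h(3)])
    show "phase_equiv `` {g (class_rep (phase_equiv `` {h (class_rep K)}))} = K"
      by (rule inv[OF K h(1,2) g(3)])
    show "phase_equiv `` {g (class_rep K)} \<in> restricted_clifford_classes N"
      "phase_equiv `` {h (class_rep K)} \<in> restricted_clifford_classes N"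
      by (rule class_rep_class(1)[OF g(1)[OF r]], rule class_rep_class(1)[OF h(1)[OF r]])
    let ?r' = "class_rep (phase_equiv `` {g (class_rep K)})"
    show "F ?r' = F (g (class_rep K))"
      by (rule F[OF class_rep_mem(1)[OF class_rep_class(1)[OF g(1)[OF r]]] class_rep_class(2)[OF g(1)[OF r]]])
  qed
qed

section \<open>The representation pairing c with its complex conjugate\<close>

definition doubled :: "nat \<Rightarrow> complex mat \<Rightarrow> complex mat" where
  "doubled N c = wedge N N c (conj_mat c)"

lemma doubled_dims [simp]:
  "dim_row (doubled N c) = 2 ^ (N + N)" "dim_col (doubled N c) = 2 ^ (N + N)"
  by (simp_all add: doubled_def)

lemma conj_mat_carrier [simp]: "conj_mat A \<in> carrier_mat n m \<longleftrightarrow> A \<in> carrier_mat n m"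
  by (metis carrier_matD carrier_matI conj_mat_dims)

lemma mat_adjoint_carrier [simp]: "mat_adjoint (A :: complex mat) \<in> carrier_mat n m \<longleftrightarrow> A \<in> carrier_mat m n"
  by (metis carrier_matD carrier_matI mat_adjoint_dims)

lemma unitary_operator: "c \<in> unitary_group N \<Longrightarrow> c \<in> operators N"
  by (simp add: unitary_group_def)

lemma doubled_mult:
  assumes "A \<in> operators N" "B \<in> operators N"
  shows "doubled N A * doubled N B = doubled N (A * B)"
proof -
  have "conj_mat A * conj_mat B = conj_mat (A * B)" using assms by (intro conj_mat_mult[symmetric]) auto
  thus ?thesis using assms by (simp add: doubled_def wedge_mult)
qed

lemma doubled_smult: "A \<in> operators N \<Longrightarrow> doubled N (\<alpha> \<cdot>\<^sub>m A) = (\<alpha> * cnj \<alpha>) \<cdot>\<^sub>m doubled N A"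
  by (simp add: doubled_def conj_mat_smult wedge_smult)

lemma doubled_adjoint: "A \<in> operators N \<Longrightarrow> mat_adjoint (doubled N A) = doubled N (mat_adjoint A)"
  by (simp add: doubled_def wedge_adjoint adjoint_conj_mat)

lemma doubled_unitary:
  assumes "c \<in> unitary_group N"
  shows "doubled N c \<in> unitary_group (N + N)"
proof -
  have "c * mat_adjoint c = 1\<^sub>m (2 ^ N)" "mat_adjoint c * c = 1\<^sub>m (2 ^ N)" "c \<in> operators N"
    using unitary_groupD(3,4)[OF assms] unitary_operator[OF assms] by blast+
  moreover have "doubled N (1\<^sub>m (2 ^ N)) = 1\<^sub>m (2 ^ (N + N))"
    using wedge_one[of N N] by (simp add: doubled_def)
  ultimately show ?thesis
    by (auto simp: unitary_group_def doubled_adjoint doubled_mult intro!: carrier_matI)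
qed

text \<open>The second factor is transformed by conj c, so writing it as \<open>conj_mat B\<close>
  turns the action into the same conjugation by c on A and on B.\<close>

lemma conjugate_by_wedge:
  assumes c: "c \<in> operators N" and "A \<in> operators N" "B \<in> operators N"
  shows "conjugate_by (doubled N c) (wedge N N A (conj_mat B))
       = wedge N N (conjugate_by c A) (conj_mat (conjugate_by c B))"
proof -
  have "conj_mat (conjugate_by c B) = conj_mat c * conj_mat B * conj_mat (mat_adjoint c)"
    using assms by (simp add: conjugate_by_def conj_mat_mult carrier_matD)
  moreover have "c * A \<in> operators N" "conj_mat c * conj_mat B \<in> operators N" using assms by auto
  ultimately show ?thesis using assms
    unfolding conjugate_by_def[of "doubled N c"] doubled_adjoint[OF c]
    by (simp add: doubled_def wedge_mult conjugate_by_def[of c A])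
qed

lemma mat_trace_conjugate_by:
  assumes "c \<in> unitary_group N" "X \<in> operators N"
  shows "mat_trace (conjugate_by c X) = mat_trace X"
proof -
  note u = unitary_groupD[OF assms(1)]
  have "mat_trace (conjugate_by c X) = mat_trace (mat_adjoint c * (c * X))"
    unfolding conjugate_by_def using u assms(2) by (intro mat_trace_comm) auto
  thus ?thesis using unitary_cancel[OF assms(1)] assms(2) by simp
qed

lemma twirl_summand_conjugate:
  assumes "c \<in> operators N"
  shows "twirl_summand N \<rho> c = conjugate_by (doubled N c) \<rho>"
    "twirl_adj_summand N \<rho> c = conjugate_by (doubled N (mat_adjoint c)) \<rho>"
  using assms unfolding twirl_summand_def twirl_adj_summand_def conjugate_by_def
  by (simp_all add: doubled_adjoint) (simp_all add: doubled_def adjoint_conj_mat)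

lemma op_sum_cong: "(\<And>i. i \<in> I \<Longrightarrow> f i = g i) \<Longrightarrow> op_sum N f I = op_sum N g I"
  unfolding op_sum_def by (intro eq_matI) (auto intro!: sum.cong)

lemma op_sum_dims [simp]: "dim_row (op_sum N f I) = 2 ^ N" "dim_col (op_sum N f I) = 2 ^ N"
  by (simp_all add: op_sum_def)

lemma op_sum_index:
  "r < 2 ^ N \<Longrightarrow> c < 2 ^ N \<Longrightarrow> op_sum N f I $$ (r, c) = (\<Sum>i\<in>I. f i $$ (r, c))"
  by (simp add: op_sum_def)

section \<open>The twirl as a group average\<close>

definition twirl_norm :: "nat \<Rightarrow> complex" where
  "twirl_norm N = 1 / of_nat (card (restricted_clifford_classes N))"

lemma twirl_eq:
  "twirl N \<rho> = twirl_norm N \<cdot>\<^sub>m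
     op_sum (N + N) (\<lambda>K. conjugate_by (doubled N (class_rep K)) \<rho>) (restricted_clifford_classes N)"
  "twirl_adj N \<rho> = twirl_norm N \<cdot>\<^sub>m
     op_sum (N + N) (\<lambda>K. conjugate_by (doubled N (mat_adjoint (class_rep K))) \<rho>) (restricted_clifford_classes N)"
proof -
  have o: "class_rep K \<in> operators N" if "K \<in> restricted_clifford_classes N" for K
    by (rule unitary_operator[OF restricted_cliffordD(1)[OF class_rep_mem(1)[OF that]]])
  have "op_sum (N + N) (\<lambda>K. twirl_summand N \<rho> (class_rep K)) (restricted_clifford_classes N)
      = op_sum (N + N) (\<lambda>K. conjugate_by (doubled N (class_rep K)) \<rho>) (restricted_clifford_classes N)"
    by (rule op_sum_cong) (rule twirl_summand_conjugate(1)[OF o])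
  thus "twirl N \<rho> = twirl_norm N \<cdot>\<^sub>m
     op_sum (N + N) (\<lambda>K. conjugate_by (doubled N (class_rep K)) \<rho>) (restricted_clifford_classes N)"
    unfolding twirl_def twirl_norm_def class_rep_def[symmetric] by simp
  have "op_sum (N + N) (\<lambda>K. twirl_adj_summand N \<rho> (class_rep K)) (restricted_clifford_classes N)
      = op_sum (N + N) (\<lambda>K. conjugate_by (doubled N (mat_adjoint (class_rep K))) \<rho>)
          (restricted_clifford_classes N)"
    by (rule op_sum_cong) (rule twirl_summand_conjugate(2)[OF o])
  thus "twirl_adj N \<rho> = twirl_norm N \<cdot>\<^sub>m
     op_sum (N + N) (\<lambda>K. conjugate_by (doubled N (mat_adjoint (class_rep K))) \<rho>)
       (restricted_clifford_classes N)"
    unfolding twirl_adj_def twirl_norm_def class_rep_def[symmetric] by simp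
qed

lemma conjugate_by_doubled_phase:
  assumes "c \<in> restricted_clifford N" "(c, d) \<in> phase_equiv"
  shows "conjugate_by (doubled N c) \<rho> = conjugate_by (doubled N d) \<rho>"
proof -
  obtain \<alpha> where \<alpha>: "cmod \<alpha> = 1" "d = \<alpha> \<cdot>\<^sub>m c" using assms(2) by (auto simp: phase_equiv_def)
  have "\<alpha> * cnj \<alpha> = 1" using \<alpha>(1) complex_norm_square[of \<alpha>] by simp
  thus ?thesis
    using doubled_smult[OF unitary_operator[OF restricted_cliffordD(1)[OF assms(1)]]] \<alpha>(2) by simp
qed

lemma op_sum_classes_reindex:
  assumes g: "\<And>c. c \<in> restricted_clifford N \<Longrightarrow> g c \<in> restricted_clifford N"
      "\<And>c. c \<in> restricted_clifford N \<Longrightarrow> h (g c) = c"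
      "\<And>c d. c \<in> restricted_clifford N \<Longrightarrow> (c, d) \<in> phase_equiv \<Longrightarrow> (g c, g d) \<in> phase_equiv"
    and h: "\<And>c. c \<in> restricted_clifford N \<Longrightarrow> h c \<in> restricted_clifford N"
      "\<And>c. c \<in> restricted_clifford N \<Longrightarrow> g (h c) = c"
      "\<And>c d. c \<in> restricted_clifford N \<Longrightarrow> (c, d) \<in> phase_equiv \<Longrightarrow> (h c, h d) \<in> phase_equiv"
  shows "op_sum (N + N) (\<lambda>K. conjugate_by (doubled N (g (class_rep K))) \<rho>) (restricted_clifford_classes N)
    = op_sum (N + N) (\<lambda>K. conjugate_by (doubled N (class_rep K)) \<rho>) (restricted_clifford_classes N)"
proof (rule eq_matI; simp only: op_sum_dims)
  fix r s :: nat assume rs: "r < 2 ^ (N + N)" "s < 2 ^ (N + N)"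
  have F: "conjugate_by (doubled N c) \<rho> $$ (r, s) = conjugate_by (doubled N d) \<rho> $$ (r, s)"
    if "c \<in> restricted_clifford N" "(c, d) \<in> phase_equiv" for c d
    using conjugate_by_doubled_phase[OF that] by simp
  show "op_sum (N + N) (\<lambda>K. conjugate_by (doubled N (g (class_rep K))) \<rho>) (restricted_clifford_classes N) $$ (r, s)
    = op_sum (N + N) (\<lambda>K. conjugate_by (doubled N (class_rep K)) \<rho>) (restricted_clifford_classes N) $$ (r, s)"
    unfolding op_sum_index[OF rs]
    by (rule sum_classes_reindex[where F = "\<lambda>c. conjugate_by (doubled N c) \<rho> $$ (r, s)" and h = h])
      (fact g h F)+
qed

text \<open>The two sums differ by the substitution of c by its adjoint, that is its inverse, which
  permutes the classes.\<close>

lemma twirl_selfadjoint: "twirl N \<rho> = twirl_adj N \<rho>"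
proof -
  have ph: "(mat_adjoint c, mat_adjoint d) \<in> phase_equiv" if "(c, d) \<in> phase_equiv" for c d
  proof -
    obtain \<alpha> where "cmod \<alpha> = 1" "d = \<alpha> \<cdot>\<^sub>m c" using \<open>(c, d) \<in> phase_equiv\<close> by (auto simp: phase_equiv_def)
    hence "cmod (cnj \<alpha>) = 1" "mat_adjoint d = cnj \<alpha> \<cdot>\<^sub>m mat_adjoint c" by (simp_all add: adjoint_smult)
    thus ?thesis unfolding phase_equiv_def by blast
  qed
  show ?thesis
    unfolding twirl_eq
    by (subst op_sum_classes_reindex[where g = mat_adjoint and h = mat_adjoint])
      (simp_all add: restricted_clifford_adjoint ph)
qed

definition twirl_invariant :: "nat \<Rightarrow> complex mat \<Rightarrow> bool" where
  "twirl_invariant N X \<longleftrightarrow> X \<in> operators (N + N) \<and>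
     (\<forall>c \<in> restricted_clifford N. conjugate_by (doubled N c) X = X)"

lemma conjugate_by_op_sum:
  assumes "c \<in> operators N" "\<And>i. i \<in> I \<Longrightarrow> f i \<in> operators N"
  shows "conjugate_by c (op_sum N f I) = op_sum N (\<lambda>i. conjugate_by c (f i)) I"
proof (rule eq_matI)
  fix r s assume "r < dim_row (op_sum N (\<lambda>i. conjugate_by c (f i)) I)"
    "s < dim_col (op_sum N (\<lambda>i. conjugate_by c (f i)) I)"
  hence rs: "r < 2 ^ N" "s < 2 ^ N" by simp_all
  note d = carrier_matD[OF assms(1)]
  have "conjugate_by c (op_sum N f I) $$ (r, s)
      = (\<Sum>l<2 ^ N. \<Sum>k<2 ^ N. \<Sum>i\<in>I. c $$ (r, k) * f i $$ (k, l) * mat_adjoint c $$ (l, s))"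
    using rs d unfolding conjugate_by_def
    by (simp add: mult_mat_entry op_sum_index sum_distrib_left sum_distrib_right del: index_mult_mat(1))
  also have "\<dots> = (\<Sum>i\<in>I. \<Sum>l<2 ^ N. \<Sum>k<2 ^ N. c $$ (r, k) * f i $$ (k, l) * mat_adjoint c $$ (l, s))"
    by (subst sum.swap[of _ I], subst sum.swap[of _ I]) (rule refl)
  also have "\<dots> = (\<Sum>i\<in>I. conjugate_by c (f i) $$ (r, s))"
  proof (rule sum.cong[OF refl])
    fix i assume i: "i \<in> I"
    note di = carrier_matD[OF assms(2)[OF i]]
    show "(\<Sum>l<2 ^ N. \<Sum>k<2 ^ N. c $$ (r, k) * f i $$ (k, l) * mat_adjoint c $$ (l, s))
        = conjugate_by c (f i) $$ (r, s)"
      using rs d di unfolding conjugate_by_def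
      by (simp add: mult_mat_entry sum_distrib_right del: index_mult_mat(1))
  qed
  finally show "conjugate_by c (op_sum N f I) $$ (r, s) = op_sum N (\<lambda>i. conjugate_by c (f i)) I $$ (r, s)"
    using rs by (simp add: op_sum_index)
qed (use assms in simp_all)

lemma op_sum_operator [simp]: "op_sum N f I \<in> operators N"
  by (simp add: op_sum_def)

text \<open>Conjugating by d replaces each c in the average by d c, and left multiplication by d
  permutes the classes.\<close>

lemma twirl_is_invariant:
  assumes \<rho>: "\<rho> \<in> operators (N + N)"
  shows "twirl_invariant N (twirl N \<rho>)"
  unfolding twirl_invariant_def
proof (intro conjI ballI)
  show "twirl N \<rho> \<in> operators (N + N)" by (simp add: twirl_eq)
  fix d assume d: "d \<in> restricted_clifford N"
  note u = restricted_cliffordD(1)[OF d]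
  note dd = doubled_unitary[OF u]
  note a = restricted_clifford_adjoint[OF d]
  have comp: "conjugate_by (doubled N d) (conjugate_by (doubled N c) \<rho>) = conjugate_by (doubled N (d * c)) \<rho>"
    if c: "c \<in> restricted_clifford N" for c
    using conjugate_by_comp[OF dd doubled_unitary[OF restricted_cliffordD(1)[OF c]] \<rho>]
      doubled_mult[OF unitary_operator[OF u] unitary_operator[OF restricted_cliffordD(1)[OF c]]] by simp
  have ph: "(e * c, e * c') \<in> phase_equiv"
    if "e \<in> restricted_clifford N" "c \<in> restricted_clifford N" "(c, c') \<in> phase_equiv" for e c c'
  proof -
    obtain \<alpha> where \<alpha>: "cmod \<alpha> = 1" "c' = \<alpha> \<cdot>\<^sub>m c"
      using \<open>(c, c') \<in> phase_equiv\<close> by (auto simp: phase_equiv_def)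
    have "e * c' = \<alpha> \<cdot>\<^sub>m (e * c)"
      unfolding \<alpha>(2) using that(1,2)[THEN restricted_cliffordD(1), THEN unitary_groupD(1)]
        that(1,2)[THEN restricted_cliffordD(1), THEN unitary_groupD(2)] by (simp add: mat_mult_smult)
    thus ?thesis using \<alpha>(1) unfolding phase_equiv_def by blast
  qed
  have "conjugate_by (doubled N d) (twirl N \<rho>) = twirl_norm N \<cdot>\<^sub>m
     op_sum (N + N) (\<lambda>K. conjugate_by (doubled N d) (conjugate_by (doubled N (class_rep K)) \<rho>))
       (restricted_clifford_classes N)"
    unfolding twirl_eq conjugate_by_smult[OF dd op_sum_operator]
    by (subst conjugate_by_op_sum[OF unitary_operator[OF dd]]) (auto intro!: carrier_matI)
  also have "op_sum (N + N) (\<lambda>K. conjugate_by (doubled N d) (conjugate_by (doubled N (class_rep K)) \<rho>))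
       (restricted_clifford_classes N)
     = op_sum (N + N) (\<lambda>K. conjugate_by (doubled N (d * class_rep K)) \<rho>) (restricted_clifford_classes N)"
    by (rule op_sum_cong) (simp add: comp class_rep_mem(1))
  also have "\<dots> = op_sum (N + N) (\<lambda>K. conjugate_by (doubled N (class_rep K)) \<rho>) (restricted_clifford_classes N)"
  proof (rule op_sum_classes_reindex[where h = "\<lambda>c. mat_adjoint d * c"])
    fix c assume c: "c \<in> restricted_clifford N"
    note dc = unitary_groupD(1)[OF restricted_cliffordD(1)[OF c]]
    show "mat_adjoint d * (d * c) = c" "d * (mat_adjoint d * c) = c"
      using unitary_cancel[OF u dc] by simp_all
  qed (use d a ph restricted_clifford_mult in auto)
  finally show "conjugate_by (doubled N d) (twirl N \<rho>) = twirl N \<rho>"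
    by (simp add: twirl_eq)
qed

lemma twirl_fixes_invariant:
  assumes "twirl_invariant N X"
  shows "twirl N X = X"
proof -
  have X: "X \<in> operators (N + N)" using assms by (simp add: twirl_invariant_def)
  have "op_sum (N + N) (\<lambda>K. conjugate_by (doubled N (class_rep K)) X) (restricted_clifford_classes N)
      = op_sum (N + N) (\<lambda>K. X) (restricted_clifford_classes N)"
    using assms class_rep_mem(1) unfolding twirl_invariant_def by (intro op_sum_cong) blast
  also have "twirl_norm N \<cdot>\<^sub>m \<dots> = X"
    using X card_restricted_clifford_classes_nonzero[of N]
    by (intro eq_matI) (auto simp: op_sum_index twirl_norm_def)
  finally show ?thesis unfolding twirl_eq .
qed

lemma conjugate_by_add:
  assumes "c \<in> operators N" "X \<in> operators N" "Y \<in> operators N"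
  shows "conjugate_by c (X + Y) = conjugate_by c X + conjugate_by c Y"
  using assms by (simp add: conjugate_by_def mat_mult_add mat_add_mult carrier_matD)

lemma twirl_invariant_add:
  assumes "twirl_invariant N X" "twirl_invariant N Y"
  shows "twirl_invariant N (X + Y)"
  using assms unfolding twirl_invariant_def
  by (auto simp: conjugate_by_add[OF unitary_operator[OF doubled_unitary[OF restricted_cliffordD(1)]]])

lemma twirl_invariant_smult:
  assumes "twirl_invariant N X"
  shows "twirl_invariant N (k \<cdot>\<^sub>m X)"
  using assms unfolding twirl_invariant_def
  by (auto simp: conjugate_by_smult[OF doubled_unitary[OF restricted_cliffordD(1)]])

text \<open>
  By irreducibility of the Pauli group an invariant operator is determined by these coefficients:
  those on \<open>A \<and> B\<^sup>*\<close> with \<open>A\<close>, \<open>B\<close> not proportional vanish.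
\<close>

definition pauli_coeff :: "nat \<Rightarrow> complex mat \<Rightarrow> complex mat \<Rightarrow> complex" where
  "pauli_coeff N X A = mat_trace (doubled N A * X)"

text \<open>Conjugate the whole product by \<open>doubled N c\<close>: X is fixed and the trace does
  not change.\<close>

lemma trace_wedge_invariant:
  assumes X: "twirl_invariant N X" and c: "c \<in> restricted_clifford N"
    and AB: "A \<in> operators N" "B \<in> operators N"
  shows "mat_trace (wedge N N (conjugate_by c A) (conj_mat (conjugate_by c B)) * X)
       = mat_trace (wedge N N A (conj_mat B) * X)"
proof -
  note u = restricted_cliffordD(1)[OF c]
  note du = doubled_unitary[OF u]
  have Xo: "X \<in> operators (N + N)" and Xi: "conjugate_by (doubled N c) X = X"
    using X c by (auto simp: twirl_invariant_def)
  let ?W = "wedge N N A (conj_mat B)"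
  have "wedge N N (conjugate_by c A) (conj_mat (conjugate_by c B)) * X
      = conjugate_by (doubled N c) ?W * conjugate_by (doubled N c) X"
    using conjugate_by_wedge[OF unitary_operator[OF u] AB] Xi by simp
  also have "\<dots> = conjugate_by (doubled N c) (?W * X)"
    by (rule conjugate_by_mult[OF du wedge_dim Xo, symmetric])
  finally show ?thesis using mat_trace_conjugate_by[OF du mult_carrier_mat[OF wedge_dim Xo]] by simp
qed

lemma pauli_coeff_invariant:
  assumes "twirl_invariant N X" "c \<in> restricted_clifford N" "A \<in> operators N"
  shows "pauli_coeff N X (conjugate_by c A) = pauli_coeff N X A"
  using trace_wedge_invariant[OF assms(1,2,3,3)] by (simp add: pauli_coeff_def doubled_def)

lemma pauli_coeff_phase:
  assumes "A \<in> operators N" "\<alpha> \<in> phases"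
  shows "pauli_coeff N X (\<alpha> \<cdot>\<^sub>m A) = pauli_coeff N X A"
  using doubled_smult[OF assms(1)] phases_norm[OF assms(2)] by (simp add: pauli_coeff_def)

text \<open>The uniqueness half of the argument: an invariant operator is determined by its
  coefficients, and those fall into four families.\<close>

lemma twirl_invariant_eq_zero:
  assumes X: "twirl_invariant N X"
    and z1: "pauli_coeff N X (1\<^sub>m (2 ^ N)) = 0"
    and zS: "pauli_coeff N X (parity_string N) = 0"
    and zA: "\<And>A. A \<in> pauli_ABD N \<Longrightarrow> pauli_coeff N X A = 0"
    and zB: "\<And>A R. A \<in> pauli_BD N \<Longrightarrow> R \<in> pauli_BD N \<Longrightarrow> comm_sign A R = - 1 \<Longrightarrow> pauli_coeff N X A = 0"
  shows "X = 0\<^sub>m (2 ^ (N + N)) (2 ^ (N + N))"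
proof -
  have Xo: "X \<in> operators (N + N)" using X by (simp add: twirl_invariant_def)
  \<comment> \<open>If A anticommutes with a block-diagonal operator, \<open>zA\<close> or
    \<open>zB\<close> applies according to the parity of A; otherwise A is a phase times 1 or
    S.\<close>
  have z: "pauli_coeff N X A = 0" if A: "A \<in> pauli_group N" for A
  proof (cases "\<exists>R\<in>pauli_BD N. comm_sign A R \<noteq> 1")
    case True
    then obtain R where "R \<in> pauli_BD N" "comm_sign A R = - 1" using comm_sign_cases by blast
    thus ?thesis using A zA zB pauli_group_split by blast
  next
    case False
    then obtain \<alpha> where "\<alpha> \<in> phases" "A = \<alpha> \<cdot>\<^sub>m 1\<^sub>m (2 ^ N) \<or> A = \<alpha> \<cdot>\<^sub>m parity_string N"
      using pauli_BD_central[OF A] by blast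
    thus ?thesis
      using z1 zS pauli_coeff_phase[OF one_carrier_mat, of \<alpha> N X]
        pauli_coeff_phase[OF pauli_word_operator[OF parity_string_word], of \<alpha> N X] by auto
  qed
  have zz: "mat_trace (wedge N N V (conj_mat W) * X) = 0" if V: "V \<in> pauli_words N" and W: "W \<in> pauli_words N" for V W
  proof -
    have G: "V \<in> pauli_group N" "W \<in> pauli_group N" using V W pauli_words_subset_group by blast+
    note o = pauli_word_operator[OF V] pauli_word_operator[OF W]
    note d = carrier_matD[OF o(1)] carrier_matD[OF o(2)]
    show ?thesis
    proof (cases "\<exists>\<alpha>\<in>phases. V * W = \<alpha> \<cdot>\<^sub>m 1\<^sub>m (2 ^ N)")
      case True
      then obtain \<alpha> where "V * W = \<alpha> \<cdot>\<^sub>m 1\<^sub>m (2 ^ N)" by blast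
      hence "V * W * W = \<alpha> \<cdot>\<^sub>m W" using d by (simp add: mat_mult_smult)
      hence "V = \<alpha> \<cdot>\<^sub>m W" using d pauli_words_square[OF W] by (simp add: mat_mult_assoc)
      hence "wedge N N V (conj_mat W) = \<alpha> \<cdot>\<^sub>m doubled N W"
        using wedge_smult[OF o(2), of "conj_mat W" N \<alpha> 1] o by (simp add: doubled_def)
      thus ?thesis using z[OF G(2)] Xo
        by (simp add: pauli_coeff_def mat_mult_smult mat_trace_smult carrier_matD)
    next
      case False
      \<comment> \<open>As R anticommutes with V W, it anticommutes with exactly one of V and W.
        Conjugation by R therefore negates the wedge product, so the trace equals its own
        negative.\<close>
      then obtain R where R: "R \<in> pauli_group N" "comm_sign (V * W) R = - 1"
        using nonscalar_comm_sign[OF pauli_group_mult[OF G]] by metis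
      let ?s = "comm_sign R V" and ?t = "comm_sign R W"
      have st: "?s * ?t = - 1"
        using comm_sign_mult_left[OF G R(1)] R(2) by (simp add: comm_sign_sym[of R])
      have "cnj ?t = ?t" by (simp add: comm_sign_def)
      hence "wedge N N (conjugate_by R V) (conj_mat (conjugate_by R W)) = (- 1) \<cdot>\<^sub>m wedge N N V (conj_mat W)"
        using o st by (simp add: conjugate_by_pauli[OF R(1)] G conj_mat_smult wedge_smult)
      hence "- mat_trace (wedge N N V (conj_mat W) * X) = mat_trace (wedge N N V (conj_mat W) * X)"
        using trace_wedge_invariant[OF X pauli_restricted_clifford[OF R(1)] o] Xo
        by (simp add: mat_mult_smult mat_trace_smult carrier_matD)
      thus ?thesis by simp
    qed
  qed
  have "separating (2 ^ (N + N)) {wedge N N V W | V W. V \<in> pauli_words N \<and> W \<in> conj_mat ` pauli_words N}"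
    by (intro separating_wedge separating_pauli_words separating_conj pauli_words_operators)
      (auto dest: pauli_word_operator)
  thus ?thesis using Xo zz unfolding separating_def by blast
qed

lemma pauli_group_trace:
  assumes "P \<in> pauli_group N" "R \<in> pauli_group N" "comm_sign P R = - 1"
  shows "mat_trace P = 0"
proof -
  obtain \<alpha> W where W: "\<alpha> \<in> phases" "W \<in> pauli_words N" "P = \<alpha> \<cdot>\<^sub>m W"
    using assms(1) by (rule pauli_groupE)
  have "W \<in> pauli_group N" using W pauli_words_subset_group by blast
  hence "comm_sign W R = - 1"
    using assms(3) comm_sign_phase_left[OF _ assms(2) W(1)] W(3) by simp
  hence "W \<noteq> 1\<^sub>m (2 ^ N)" using pauli_group_dims[OF assms(2)] by (auto simp: comm_sign_def)
  hence "mat_trace (W * 1\<^sub>m (2 ^ N)) = 0"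
    by (intro mat_trace_pauli_word[OF W(2)]) (auto dest: pauli_word_operator)
  thus ?thesis using W(3) pauli_word_operator[OF W(2)] by (simp add: mat_trace_smult carrier_matD)
qed


section \<open>The four invariant operators\<close>

lemma outer_ket_index:
  assumes "a < 2 ^ N" "b < 2 ^ N" "r < 2 ^ N" "c < 2 ^ N"
  shows "ketbra N a b $$ (r, c) = (if r = a \<and> c = b then 1 else 0)"
  using assms by (auto simp: outer_def ket_eq_unit_vec unit_vec_def)

lemma sum_wedge_ketbra_diag_index:
  assumes I: "I \<subseteq> {..<2 ^ N} \<times> {..<2 ^ N}" and rc: "r < 2 ^ (N + N)" "c < 2 ^ (N + N)"
  shows "op_sum (N + N) (\<lambda>(i, j). wedge N N (ketbra N i i) (ketbra N j j)) I $$ (r, c)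
    = (if r = c \<and> (r mod 2 ^ N, r div 2 ^ N) \<in> I then 1 else 0)"
proof -
  have fin: "finite I" using I finite_subset by blast
  note b = mod_div_less[OF rc(1)] mod_div_less[OF rc(2)]
  have eq: "r = c \<longleftrightarrow> r mod 2 ^ N = c mod 2 ^ N \<and> r div 2 ^ N = c div 2 ^ N"
    by (metis div_mult_mod_eq)
  have "op_sum (N + N) (\<lambda>(i, j). wedge N N (ketbra N i i) (ketbra N j j)) I $$ (r, c)
      = (\<Sum>p\<in>I. if p = (r mod 2 ^ N, r div 2 ^ N) then if r = c then 1 else 0 else 0)"
    unfolding op_sum_index[OF rc]
  proof (rule sum.cong[OF refl])
    fix p assume "p \<in> I"
    then obtain i j where p: "p = (i, j)" "i < 2 ^ N" "j < 2 ^ N" using I by auto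
    show "(case p of (i, j) \<Rightarrow> wedge N N (ketbra N i i) (ketbra N j j)) $$ (r, c)
        = (if p = (r mod 2 ^ N, r div 2 ^ N) then if r = c then 1 else 0 else 0)"
      using rc b p(2,3) by (auto simp: p(1) wedge_index outer_ket_index eq)
  qed
  thus ?thesis using fin by simp
qed

text \<open>Over all pairs the sum is the swap of the two factors; the set I only selects which of
  its entries are kept.\<close>

lemma sum_wedge_ketbra_swap_index:
  assumes I: "I \<subseteq> {..<2 ^ N} \<times> {..<2 ^ N}" and rc: "r < 2 ^ (N + N)" "c < 2 ^ (N + N)"
  shows "op_sum (N + N) (\<lambda>(i, j). wedge N N (ketbra N i j) (ketbra N j i)) I $$ (r, c)
    = (if r mod 2 ^ N = c div 2 ^ N \<and> r div 2 ^ N = c mod 2 ^ N \<and>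
         (r mod 2 ^ N, c mod 2 ^ N) \<in> I then 1 else 0)"
proof -
  have fin: "finite I" using I finite_subset by blast
  note b = mod_div_less[OF rc(1)] mod_div_less[OF rc(2)]
  have swap: "(if a = i \<and> k = j then 1 else 0) * (if l = j \<and> m = i then 1 else 0)
      = (if (i, j) = (a, k) then if a = m \<and> l = k then 1 else 0 else 0 :: complex)"
    for a k l m i j :: nat
    by (cases "a = i"; cases "k = j"; cases "m = i"; cases "l = j"; simp)
  have "op_sum (N + N) (\<lambda>(i, j). wedge N N (ketbra N i j) (ketbra N j i)) I $$ (r, c)
      = (\<Sum>p\<in>I. if p = (r mod 2 ^ N, c mod 2 ^ N) then
          if r mod 2 ^ N = c div 2 ^ N \<and> r div 2 ^ N = c mod 2 ^ N then 1 else 0 else 0)"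
    unfolding op_sum_index[OF rc]
  proof (rule sum.cong[OF refl])
    fix p assume "p \<in> I"
    then obtain i j where p: "p = (i, j)" "i < 2 ^ N" "j < 2 ^ N" using I by auto
    show "(case p of (i, j) \<Rightarrow> wedge N N (ketbra N i j) (ketbra N j i)) $$ (r, c)
        = (if p = (r mod 2 ^ N, c mod 2 ^ N) then
          if r mod 2 ^ N = c div 2 ^ N \<and> r div 2 ^ N = c mod 2 ^ N then 1 else 0 else 0)"
      using rc b p(2,3) by (simp only: p(1) prod.case wedge_index outer_ket_index swap)
  qed
  thus ?thesis using fin by simp
qed

text \<open>Transposing the right factor exchanges the high digits of row and column, which carry
  the right indices.\<close>

lemma partial_transpose_index:
  assumes X: "X \<in> operators (N + N)" and rc: "r < 2 ^ (N + N)" "c < 2 ^ (N + N)"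
  shows "partial_transpose N X $$ (r, c)
    = X $$ (r mod 2 ^ N + 2 ^ N * (c div 2 ^ N), c mod 2 ^ N + 2 ^ N * (r div 2 ^ N))"
proof -
  let ?I = "({..<(2::nat) ^ N} \<times> {..<(2::nat) ^ N}) \<times> ({..<(2::nat) ^ N} \<times> {..<(2::nat) ^ N})"
  let ?t = "((r mod 2 ^ N, c mod 2 ^ N), (c div 2 ^ N, r div 2 ^ N))"
  let ?x = "X $$ (r mod 2 ^ N + 2 ^ N * (c div 2 ^ N), c mod 2 ^ N + 2 ^ N * (r div 2 ^ N))"
  note b = mod_div_less[OF rc(1)] mod_div_less[OF rc(2)]
  have "partial_transpose N X $$ (r, c) = (\<Sum>t\<in>?I. if t = ?t then ?x else 0)"
    unfolding partial_transpose_def op_sum_index[OF rc]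
  proof (rule sum.cong[OF refl])
    fix t assume "t \<in> ?I"
    then obtain x x' y y' where t: "t = ((x, x'), (y, y'))"
      and l: "x < 2 ^ N" "x' < 2 ^ N" "y < 2 ^ N" "y' < 2 ^ N" by auto
    note p = pair_index_less[OF l(1,3)] pair_index_less[OF l(2,4)]
    have "(X *\<^sub>v wedge_ket N N x' y') \<bullet>c wedge_ket N N x y = X $$ (x + 2 ^ N * y, x' + 2 ^ N * y')"
    proof -
      have "conjugate (unit_vec (2 ^ (N + N)) (x + 2 ^ N * y)) = (unit_vec (2 ^ (N + N)) (x + 2 ^ N * y) :: complex vec)"
        by (rule eq_vecI) (auto simp: unit_vec_def)
      thus ?thesis using X p l by (simp add: wedge_ket_eq_unit_vec carrier_matD)
    qed
    thus "(case t of (p, q) \<Rightarrow> (case p of (x, x') \<Rightarrow> \<lambda>(y, y').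
          ((X *\<^sub>v wedge_ket N N x' y') \<bullet>c wedge_ket N N x y)
          \<cdot>\<^sub>m wedge N N (ketbra N x x') (ketbra N y' y)) q) $$ (r, c) = (if t = ?t then ?x else 0)"
      using rc b l by (auto simp: t wedge_index outer_ket_index)
  qed
  also have "\<dots> = ?x" using b by (subst sum.delta) auto
  finally show ?thesis .
qed

lemma state_products_subset:
  "even_states N \<times> even_states N \<subseteq> {..<2 ^ N} \<times> {..<2 ^ N}"
  "odd_states N \<times> odd_states N \<subseteq> {..<2 ^ N} \<times> {..<2 ^ N}"
  "even_states N \<times> odd_states N \<subseteq> {..<2 ^ N} \<times> {..<2 ^ N}"
  "odd_states N \<times> even_states N \<subseteq> {..<2 ^ N} \<times> {..<2 ^ N}"
  by (auto simp: even_states_def odd_states_def)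

lemma I_EE_index:
  assumes "r < 2 ^ (N + N)" "c < 2 ^ (N + N)"
  shows "I_EE N $$ (r, c) = (if r = c \<and> (even_weight (r mod 2 ^ N) \<longleftrightarrow> even_weight (r div 2 ^ N)) then 1 else 0)"
proof -
  note e = sum_wedge_ketbra_diag_index[OF state_products_subset(1) assms]
    sum_wedge_ketbra_diag_index[OF state_products_subset(2) assms]
  show ?thesis
    using assms mod_div_less[OF assms(1)] mod_div_less[OF assms(2)]
    by (simp add: I_EE_def e) (auto simp: even_states_def odd_states_def)
qed

lemma I_OO_index:
  assumes "r < 2 ^ (N + N)" "c < 2 ^ (N + N)"
  shows "I_OO N $$ (r, c) = (if r = c \<and> (even_weight (r mod 2 ^ N) \<longleftrightarrow> \<not> even_weight (r div 2 ^ N)) then 1 else 0)"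
proof -
  note e = sum_wedge_ketbra_diag_index[OF state_products_subset(3) assms]
    sum_wedge_ketbra_diag_index[OF state_products_subset(4) assms]
  show ?thesis
    using assms mod_div_less[OF assms(1)] mod_div_less[OF assms(2)]
    by (simp add: I_OO_def e) (auto simp: even_states_def odd_states_def)
qed

lemma H_EE_index:
  assumes "r < 2 ^ (N + N)" "c < 2 ^ (N + N)"
  shows "H_EE N $$ (r, c) = (if r mod 2 ^ N = c div 2 ^ N \<and> r div 2 ^ N = c mod 2 ^ N \<and>
    (even_weight (r mod 2 ^ N) \<longleftrightarrow> even_weight (c mod 2 ^ N)) then 1 else 0)"
proof -
  note e = sum_wedge_ketbra_swap_index[OF state_products_subset(1) assms]
    sum_wedge_ketbra_swap_index[OF state_products_subset(2) assms]
  show ?thesis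
    using assms mod_div_less[OF assms(1)] mod_div_less[OF assms(2)]
    by (simp add: H_EE_def e) (auto simp: even_states_def odd_states_def)
qed

lemma H_OO_index:
  assumes "r < 2 ^ (N + N)" "c < 2 ^ (N + N)"
  shows "H_OO N $$ (r, c) = (if r mod 2 ^ N = c div 2 ^ N \<and> r div 2 ^ N = c mod 2 ^ N \<and>
    (even_weight (r mod 2 ^ N) \<longleftrightarrow> \<not> even_weight (c mod 2 ^ N)) then 1 else 0)"
proof -
  note e = sum_wedge_ketbra_swap_index[OF state_products_subset(3) assms]
    sum_wedge_ketbra_swap_index[OF state_products_subset(4) assms]
  show ?thesis
    using assms mod_div_less[OF assms(1)] mod_div_less[OF assms(2)]
    by (simp add: H_OO_def e) (auto simp: even_states_def odd_states_def)
qed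

lemma parity_operator_dims [simp]:
  "dim_row (I_EE N) = 2 ^ (N + N)" "dim_col (I_EE N) = 2 ^ (N + N)"
  "dim_row (I_OO N) = 2 ^ (N + N)" "dim_col (I_OO N) = 2 ^ (N + N)"
  "dim_row (H_EE N) = 2 ^ (N + N)" "dim_col (H_EE N) = 2 ^ (N + N)"
  "dim_row (H_OO N) = 2 ^ (N + N)" "dim_col (H_OO N) = 2 ^ (N + N)"
  "dim_row (Psi_EE N) = 2 ^ (N + N)" "dim_col (Psi_EE N) = 2 ^ (N + N)"
  "dim_row (Psi_EO N) = 2 ^ (N + N)" "dim_col (Psi_EO N) = 2 ^ (N + N)"
  by (simp_all add: I_EE_def I_OO_def H_EE_def H_OO_def Psi_EE_def Psi_EO_def partial_transpose_def)

text \<open>The partial transpose of the swap is the unnormalised projector onto the sum of all x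
  \<and> x; here it is restricted to rows and columns of equal parity.\<close>

lemma Psi_EE_index:
  assumes rc: "r < 2 ^ (N + N)" "c < 2 ^ (N + N)"
  shows "Psi_EE N $$ (r, c) = (if r mod 2 ^ N = r div 2 ^ N \<and> c mod 2 ^ N = c div 2 ^ N \<and>
    (even_weight (r mod 2 ^ N) \<longleftrightarrow> even_weight (c mod 2 ^ N)) then 1 else 0)"
proof -
  note b = mod_div_less[OF rc(1)] mod_div_less[OF rc(2)]
  note p = pair_index_less[OF b(1,4)] pair_index_less[OF b(3,2)]
  have "H_EE N \<in> operators (N + N)" by (auto intro: carrier_matI)
  thus ?thesis unfolding Psi_EE_def using b
    by (auto simp: partial_transpose_index[OF _ rc] H_EE_index[OF p])
qed

lemma Psi_EO_index:
  assumes rc: "r < 2 ^ (N + N)" "c < 2 ^ (N + N)"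
  shows "Psi_EO N $$ (r, c) = (if r mod 2 ^ N = r div 2 ^ N \<and> c mod 2 ^ N = c div 2 ^ N \<and>
    (even_weight (r mod 2 ^ N) \<longleftrightarrow> \<not> even_weight (c mod 2 ^ N)) then 1 else 0)"
proof -
  note b = mod_div_less[OF rc(1)] mod_div_less[OF rc(2)]
  note p = pair_index_less[OF b(1,4)] pair_index_less[OF b(3,2)]
  have "H_OO N \<in> operators (N + N)" by (auto intro: carrier_matI)
  thus ?thesis unfolding Psi_EO_def using b
    by (auto simp: partial_transpose_index[OF _ rc] H_OO_index[OF p])
qed

text \<open>
  The unnormalised maximally entangled vectors \<open>\<Sum>\<^sub>x |x\<rangle> \<and> |x\<rangle>\<close> and
  \<open>\<Sum>\<^sub>x (- 1)\<^bsup>|x|\<^esup> |x\<rangle> \<and> |x\<rangle>\<close>, as one-column matrices.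
\<close>

definition pair_vec :: "nat \<Rightarrow> complex mat" where
  "pair_vec N = mat (2 ^ (N + N)) 1 (\<lambda>(r, c). if r mod 2 ^ N = r div 2 ^ N then 1 else 0)"

definition signed_pair_vec :: "nat \<Rightarrow> complex mat" where
  "signed_pair_vec N = wedge N N (parity_string N) (1\<^sub>m (2 ^ N)) * pair_vec N"

lemma pair_vec_dims [simp]:
  "dim_row (pair_vec N) = 2 ^ (N + N)" "dim_col (pair_vec N) = 1"
  "dim_row (signed_pair_vec N) = 2 ^ (N + N)" "dim_col (signed_pair_vec N) = 1"
  by (simp_all add: pair_vec_def signed_pair_vec_def)

lemma wedge_pair_vec_index:
  assumes "r < 2 ^ (N + N)"
  shows "(wedge N N A B * pair_vec N) $$ (r, 0) = (\<Sum>x<2 ^ N. A $$ (r mod 2 ^ N, x) * B $$ (r div 2 ^ N, x))"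
proof -
  have "(wedge N N A B * pair_vec N) $$ (r, 0)
      = (\<Sum>k<2 ^ N * 2 ^ N. A $$ (r mod 2 ^ N, k mod 2 ^ N) * B $$ (r div 2 ^ N, k div 2 ^ N)
          * (if k mod 2 ^ N = k div 2 ^ N then 1 else 0))"
    using assms by (subst mult_mat_entry) (auto simp: wedge_index pair_vec_def power_add intro!: sum.cong)
  also have "\<dots> = (\<Sum>x<2 ^ N. \<Sum>y<2 ^ N. A $$ (r mod 2 ^ N, x) * B $$ (r div 2 ^ N, y) * (if x = y then 1 else 0))"
    by (subst sum_mod_div[symmetric]) simp_all
  also have "\<dots> = (\<Sum>x<2 ^ N. A $$ (r mod 2 ^ N, x) * B $$ (r div 2 ^ N, x))"
    by (intro sum.cong refl) (simp add: if_distrib[of "\<lambda>z. _ * z"] cong: if_cong)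
  finally show ?thesis .
qed

text \<open>The coefficients of the image at the pairs (x, y) are the entries of c times its
  adjoint, so invariance of the vector is unitarity of c.\<close>

lemma doubled_pair_vec:
  assumes "c \<in> unitary_group N"
  shows "doubled N c * pair_vec N = pair_vec N"
proof (rule eq_matI)
  fix r s assume "r < dim_row (pair_vec N)" "s < dim_col (pair_vec N)"
  hence rs: "r < 2 ^ (N + N)" "s = 0" by simp_all
  note b = mod_div_less[OF rs(1)] and u = unitary_groupD[OF assms]
  have "(doubled N c * pair_vec N) $$ (r, 0)
      = (\<Sum>x<2 ^ N. c $$ (r mod 2 ^ N, x) * mat_adjoint c $$ (x, r div 2 ^ N))"
    unfolding doubled_def wedge_pair_vec_index[OF rs(1)] using u(1,2) b by (simp add: mat_adjoint_index)
  also have "\<dots> = (c * mat_adjoint c) $$ (r mod 2 ^ N, r div 2 ^ N)"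
    using u(1,2) b by (subst mult_mat_entry) simp_all
  also have "\<dots> = pair_vec N $$ (r, 0)" using u(3) b rs(1) by (simp add: pair_vec_def)
  finally show "(doubled N c * pair_vec N) $$ (r, s) = pair_vec N $$ (r, s)" by (simp add: rs(2))
qed simp_all

text \<open>The signed vector is S \<and> 1 applied to the fixed vector, and conjugation by the
  doubled c multiplies S \<and> 1 by s.\<close>

lemma doubled_signed_pair_vec:
  assumes c: "c \<in> unitary_group N" and s: "conjugate_by c (parity_string N) = s \<cdot>\<^sub>m parity_string N"
  shows "doubled N c * signed_pair_vec N = s \<cdot>\<^sub>m signed_pair_vec N"
proof -
  note dc = doubled_unitary[OF c]
  have S: "parity_string N \<in> operators N" by (rule pauli_word_operator[OF parity_string_word])
  let ?W = "wedge N N (parity_string N) (1\<^sub>m (2 ^ N))"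
  have "doubled N c * ?W * mat_adjoint (doubled N c) = s \<cdot>\<^sub>m ?W"
    using conjugate_by_wedge[OF unitary_operator[OF c] S one_carrier_mat] s S conjugate_by_one[OF c]
      wedge_smult[OF S one_carrier_mat, where a = s and b = 1]
    by (simp add: conjugate_by_def[of "doubled N c"])
  hence "doubled N c * ?W * mat_adjoint (doubled N c) * (doubled N c * pair_vec N)
      = s \<cdot>\<^sub>m ?W * pair_vec N"
    using doubled_pair_vec[OF c] by simp
  thus ?thesis using unitary_cancel[OF dc]
    by (simp add: signed_pair_vec_def mat_mult_assoc mat_mult_smult)
qed

lemma signed_pair_vec_index:
  assumes r: "r < 2 ^ (N + N)"
  shows "signed_pair_vec N $$ (r, 0) =
    (if r mod 2 ^ N = r div 2 ^ N then if even_weight (r mod 2 ^ N) then 1 else - 1 else 0)"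
proof -
  note b = mod_div_less[OF r]
  have "signed_pair_vec N $$ (r, 0)
      = (\<Sum>x<2 ^ N. parity_string N $$ (r mod 2 ^ N, x) * 1\<^sub>m (2 ^ N) $$ (r div 2 ^ N, x))"
    unfolding signed_pair_vec_def by (rule wedge_pair_vec_index[OF r])
  also have "\<dots> = (\<Sum>x<2 ^ N. if x = r div 2 ^ N then parity_string N $$ (r mod 2 ^ N, r div 2 ^ N) else 0)"
    using b by (intro sum.cong) auto
  also have "\<dots> = parity_string N $$ (r mod 2 ^ N, r div 2 ^ N)" using b by simp
  finally show ?thesis using b by (simp add: parity_string_index)
qed

lemma column_projector_index:
  assumes "dim_col v = 1" "r < dim_row v" "c < dim_row v"
  shows "(v * mat_adjoint v) $$ (r, c) = v $$ (r, 0) * cnj (v $$ (c, 0))"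
  using assms by (subst mult_mat_entry) (simp_all add: mat_adjoint_index)

section \<open>Passage between the invariants and the parity-resolved operators\<close>

lemma identity_parity_decomposition:
  "wedge N N (1\<^sub>m (2 ^ N)) (1\<^sub>m (2 ^ N)) = I_EE N + I_OO N"
  by (rule eq_matI) (auto simp: I_EE_index I_OO_index)

lemma parity_string_parity_decomposition:
  "wedge N N (parity_string N) (parity_string N) = I_EE N + (- 1) \<cdot>\<^sub>m I_OO N"
proof (rule eq_matI)
  fix r c assume "r < dim_row (I_EE N + (- 1) \<cdot>\<^sub>m I_OO N)" "c < dim_col (I_EE N + (- 1) \<cdot>\<^sub>m I_OO N)"
  hence rc: "r < 2 ^ (N + N)" "c < 2 ^ (N + N)" by simp_all
  have eq: "r = c \<longleftrightarrow> r mod 2 ^ N = c mod 2 ^ N \<and> r div 2 ^ N = c div 2 ^ N"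
    by (metis div_mult_mod_eq)
  show "wedge N N (parity_string N) (parity_string N) $$ (r, c) = (I_EE N + (- 1) \<cdot>\<^sub>m I_OO N) $$ (r, c)"
    using rc mod_div_less[OF rc(1)] mod_div_less[OF rc(2)] eq
    by (auto simp: wedge_index parity_string_index I_EE_index I_OO_index)
qed simp_all

lemma pair_projector_parity_decomposition:
  "pair_vec N * mat_adjoint (pair_vec N) = Psi_EE N + Psi_EO N"
proof (rule eq_matI)
  fix r c assume "r < dim_row (Psi_EE N + Psi_EO N)" "c < dim_col (Psi_EE N + Psi_EO N)"
  hence rc: "r < 2 ^ (N + N)" "c < 2 ^ (N + N)" by simp_all
  have "(pair_vec N * mat_adjoint (pair_vec N)) $$ (r, c) = pair_vec N $$ (r, 0) * cnj (pair_vec N $$ (c, 0))"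
    using rc by (intro column_projector_index) simp_all
  thus "(pair_vec N * mat_adjoint (pair_vec N)) $$ (r, c) = (Psi_EE N + Psi_EO N) $$ (r, c)"
    using rc by (auto simp: Psi_EE_index Psi_EO_index pair_vec_def)
qed simp_all

text \<open>At row x \<and> x and column y \<and> y the entry is the product of the two parity
  signs: 1 for equal and - 1 for opposite parities.\<close>

lemma signed_pair_projector_parity_decomposition:
  "signed_pair_vec N * mat_adjoint (signed_pair_vec N) = Psi_EE N + (- 1) \<cdot>\<^sub>m Psi_EO N"
proof (rule eq_matI)
  fix r c assume "r < dim_row (Psi_EE N + (- 1) \<cdot>\<^sub>m Psi_EO N)" "c < dim_col (Psi_EE N + (- 1) \<cdot>\<^sub>m Psi_EO N)"
  hence rc: "r < 2 ^ (N + N)" "c < 2 ^ (N + N)" by simp_all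
  have "(signed_pair_vec N * mat_adjoint (signed_pair_vec N)) $$ (r, c)
      = signed_pair_vec N $$ (r, 0) * cnj (signed_pair_vec N $$ (c, 0))"
    using rc by (intro column_projector_index) simp_all
  thus "(signed_pair_vec N * mat_adjoint (signed_pair_vec N)) $$ (r, c) = (Psi_EE N + (- 1) \<cdot>\<^sub>m Psi_EO N) $$ (r, c)"
    using rc by (auto simp: Psi_EE_index Psi_EO_index signed_pair_vec_index)
qed simp_all

lemma conjugate_by_column_projector:
  assumes "dim_col U = dim_row v" "U * v = s \<cdot>\<^sub>m v"
  shows "conjugate_by U (v * mat_adjoint v) = (s * cnj s) \<cdot>\<^sub>m (v * mat_adjoint v)"
proof -
  have "conjugate_by U (v * mat_adjoint v) = (U * v) * mat_adjoint (U * v)"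
    using assms(1) by (simp add: conjugate_by_def adjoint_mult mat_mult_assoc)
  thus ?thesis by (simp add: assms(2) adjoint_smult mat_mult_smult smult_smult_mat mult.commute)
qed

lemma twirl_invariant_one: "twirl_invariant N (wedge N N (1\<^sub>m (2 ^ N)) (1\<^sub>m (2 ^ N)))"
  unfolding twirl_invariant_def
proof (intro conjI ballI wedge_dim)
  fix c assume "c \<in> restricted_clifford N"
  hence "doubled N c \<in> unitary_group (N + N)" by (intro doubled_unitary restricted_cliffordD(1))
  thus "conjugate_by (doubled N c) (wedge N N (1\<^sub>m (2 ^ N)) (1\<^sub>m (2 ^ N))) = wedge N N (1\<^sub>m (2 ^ N)) (1\<^sub>m (2 ^ N))"
    unfolding wedge_one by (rule conjugate_by_one)
qed

lemma conj_parity_string: "conj_mat (parity_string N) = parity_string N"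
  by (rule eq_matI) (auto simp: parity_string_index)

lemma doubled_parity_string: "doubled N (parity_string N) = wedge N N (parity_string N) (parity_string N)"
  by (simp add: doubled_def conj_parity_string)

lemma twirl_invariant_parity_string:
  assumes N: "N \<ge> 1"
  shows "twirl_invariant N (wedge N N (parity_string N) (parity_string N))"
  unfolding twirl_invariant_def
proof (intro conjI ballI wedge_dim)
  fix c assume c: "c \<in> restricted_clifford N"
  obtain s where s: "s * cnj s = 1" "conjugate_by c (parity_string N) = s \<cdot>\<^sub>m parity_string N"
    using conjugate_by_parity_string[OF N c] by blast
  have S: "parity_string N \<in> operators N" by (rule pauli_word_operator[OF parity_string_word])
  have "conjugate_by (doubled N c) (doubled N (parity_string N)) = doubled N (conjugate_by c (parity_string N))"
    using conjugate_by_wedge[OF unitary_operator[OF restricted_cliffordD(1)[OF c]] S S]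
    by (simp add: doubled_def)
  also have "\<dots> = doubled N (parity_string N)" unfolding s(2) doubled_smult[OF S] s(1) by simp
  finally show "conjugate_by (doubled N c) (wedge N N (parity_string N) (parity_string N))
      = wedge N N (parity_string N) (parity_string N)" unfolding doubled_parity_string .
qed

lemma twirl_invariant_pair_projector:
  "twirl_invariant N (pair_vec N * mat_adjoint (pair_vec N))"
  unfolding twirl_invariant_def
proof (intro conjI ballI)
  fix c assume c: "c \<in> restricted_clifford N"
  have "doubled N c * pair_vec N = 1 \<cdot>\<^sub>m pair_vec N"
    using doubled_pair_vec[OF restricted_cliffordD(1)[OF c]] by simp
  from conjugate_by_column_projector[OF _ this]
  show "conjugate_by (doubled N c) (pair_vec N * mat_adjoint (pair_vec N)) = pair_vec N * mat_adjoint (pair_vec N)"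
    by simp
qed (auto intro: carrier_matI)

lemma twirl_invariant_signed_pair_projector:
  assumes N: "N \<ge> 1"
  shows "twirl_invariant N (signed_pair_vec N * mat_adjoint (signed_pair_vec N))"
  unfolding twirl_invariant_def
proof (intro conjI ballI)
  fix c assume c: "c \<in> restricted_clifford N"
  obtain s where s: "s * cnj s = 1" "conjugate_by c (parity_string N) = s \<cdot>\<^sub>m parity_string N"
    using conjugate_by_parity_string[OF N c] by blast
  from conjugate_by_column_projector[OF _ doubled_signed_pair_vec[OF restricted_cliffordD(1)[OF c] s(2)]]
  show "conjugate_by (doubled N c) (signed_pair_vec N * mat_adjoint (signed_pair_vec N))
      = signed_pair_vec N * mat_adjoint (signed_pair_vec N)"
    by (simp add: s(1))
qed (auto intro: carrier_matI)

lemma twirl_invariant_Psi: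
  assumes N: "N \<ge> 1"
  shows "twirl_invariant N (Psi_EE N)" "twirl_invariant N (Psi_EO N)"
proof -
  note i = twirl_invariant_pair_projector[of N, unfolded pair_projector_parity_decomposition]
    twirl_invariant_signed_pair_projector[OF N, unfolded signed_pair_projector_parity_decomposition]
  have "Psi_EE N = (1 / 2) \<cdot>\<^sub>m ((Psi_EE N + Psi_EO N) + (Psi_EE N + (- 1) \<cdot>\<^sub>m Psi_EO N))"
    by (rule eq_matI) simp_all
  thus "twirl_invariant N (Psi_EE N)" using i twirl_invariant_add twirl_invariant_smult by metis
  have "Psi_EO N = (1 / 2) \<cdot>\<^sub>m ((Psi_EE N + Psi_EO N) + (- 1) \<cdot>\<^sub>m (Psi_EE N + (- 1) \<cdot>\<^sub>m Psi_EO N))"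
    by (rule eq_matI) simp_all
  thus "twirl_invariant N (Psi_EO N)" using i twirl_invariant_add twirl_invariant_smult by metis
qed

section \<open>Pauli coefficients of the four invariants\<close>

lemma mat_trace_column_projector:
  assumes "dim_col v = 1"
  shows "mat_trace (v * mat_adjoint v) = (\<Sum>r<dim_row v. v $$ (r, 0) * cnj (v $$ (r, 0)))"
  using assms by (simp add: mat_trace_def column_projector_index del: index_mult_mat(1))

lemma sum_diagonal_pairs:
  "(\<Sum>r<(2 :: nat) ^ (N + N). if r mod 2 ^ N = r div 2 ^ N then 1 else 0 :: complex) = 2 ^ N"
proof -
  have "(\<Sum>r<(2 :: nat) ^ N * 2 ^ N. if r mod 2 ^ N = r div 2 ^ N then 1 else 0 :: complex)
      = (\<Sum>x<(2 :: nat) ^ N. \<Sum>y<(2 :: nat) ^ N. if x = y then 1 else 0)"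
    by (rule sum_mod_div[where g = "\<lambda>x y. if x = y then 1 else 0"]) simp
  also have "\<dots> = 2 ^ N" by simp
  finally show ?thesis by (simp add: power_add)
qed

lemma mat_trace_pair_projector: "mat_trace (pair_vec N * mat_adjoint (pair_vec N)) = 2 ^ N"
proof -
  have "mat_trace (pair_vec N * mat_adjoint (pair_vec N))
      = (\<Sum>r<(2 :: nat) ^ (N + N). if r mod 2 ^ N = r div 2 ^ N then 1 else 0)"
    by (subst mat_trace_column_projector) (auto simp: pair_vec_def intro!: sum.cong)
  thus ?thesis by (simp only: sum_diagonal_pairs)
qed

lemma mat_trace_signed_pair_projector:
  "mat_trace (signed_pair_vec N * mat_adjoint (signed_pair_vec N)) = 2 ^ N"
proof -
  have "mat_trace (signed_pair_vec N * mat_adjoint (signed_pair_vec N))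
      = (\<Sum>r<(2 :: nat) ^ (N + N). if r mod 2 ^ N = r div 2 ^ N then 1 else 0)"
    by (subst mat_trace_column_projector) (auto simp: signed_pair_vec_index intro!: sum.cong)
  thus ?thesis by (simp only: sum_diagonal_pairs)
qed

text \<open>Every doubled Pauli operator fixes the vector, so the coefficient is the trace of the
  projector, whatever A is.\<close>

lemma pauli_coeff_pair_projector:
  assumes "A \<in> pauli_group N"
  shows "pauli_coeff N (pair_vec N * mat_adjoint (pair_vec N)) A = 2 ^ N"
proof -
  have "doubled N A * (pair_vec N * mat_adjoint (pair_vec N)) = (doubled N A * pair_vec N) * mat_adjoint (pair_vec N)"
    by (simp add: mat_mult_assoc)
  thus ?thesis
    using doubled_pair_vec[OF pauli_group_unitary[OF assms]] mat_trace_pair_projector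
    by (simp add: pauli_coeff_def)
qed

text \<open>Here the vector is an eigenvector whose eigenvalue is the parity sign of A; this is the
  invariant that tells the two parities apart.\<close>

lemma pauli_coeff_signed_pair_projector:
  assumes A: "A \<in> pauli_group N"
  shows "pauli_coeff N (signed_pair_vec N * mat_adjoint (signed_pair_vec N)) A
       = comm_sign (parity_string N) A * 2 ^ N"
proof -
  have "conjugate_by A (parity_string N) = comm_sign (parity_string N) A \<cdot>\<^sub>m parity_string N"
    using conjugate_by_pauli[OF A parity_string_group] by (simp add: comm_sign_sym)
  from doubled_signed_pair_vec[OF pauli_group_unitary[OF A] this]
  have "(doubled N A * signed_pair_vec N) * mat_adjoint (signed_pair_vec N)
      = comm_sign (parity_string N) A \<cdot>\<^sub>m (signed_pair_vec N * mat_adjoint (signed_pair_vec N))"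
    by (simp add: mat_mult_smult)
  moreover have "doubled N A * (signed_pair_vec N * mat_adjoint (signed_pair_vec N))
      = (doubled N A * signed_pair_vec N) * mat_adjoint (signed_pair_vec N)"
    by (simp add: mat_mult_assoc)
  ultimately show ?thesis
    using mat_trace_signed_pair_projector[of N] by (simp add: pauli_coeff_def mat_trace_smult)
qed

lemma mat_trace_doubled: "A \<in> operators N \<Longrightarrow> mat_trace (doubled N A) = mat_trace A * cnj (mat_trace A)"
  by (simp add: doubled_def mat_trace_wedge mat_trace_conj carrier_matD)

text \<open>On Pauli operators this squared modulus vanishes off the scalars, so 1 \<and> 1 adjusts
  the coefficient of the identity alone. In the same way S \<and> S adjusts that of S.\<close>

lemma pauli_coeff_one:
  assumes "A \<in> operators N"
  shows "pauli_coeff N (wedge N N (1\<^sub>m (2 ^ N)) (1\<^sub>m (2 ^ N))) A = mat_trace A * cnj (mat_trace A)"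
  unfolding pauli_coeff_def wedge_one using mat_trace_doubled[OF assms] by simp

lemma pauli_coeff_parity_string:
  assumes "A \<in> operators N"
  shows "pauli_coeff N (wedge N N (parity_string N) (parity_string N)) A
       = mat_trace (A * parity_string N) * cnj (mat_trace (A * parity_string N))"
proof -
  have S: "parity_string N \<in> operators N" by (rule pauli_word_operator[OF parity_string_word])
  show ?thesis
    unfolding pauli_coeff_def doubled_parity_string[symmetric] doubled_mult[OF assms S]
    by (rule mat_trace_doubled[OF mult_carrier_mat[OF assms S]])
qed

lemma pauli_coeff_add:
  "X \<in> operators (N + N) \<Longrightarrow> Y \<in> operators (N + N) \<Longrightarrow>
   pauli_coeff N (X + Y) A = pauli_coeff N X A + pauli_coeff N Y A"
  by (simp add: pauli_coeff_def mat_mult_add mat_trace_add carrier_matD)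

lemma pauli_coeff_smult:
  "X \<in> operators (N + N) \<Longrightarrow> pauli_coeff N (k \<cdot>\<^sub>m X) A = k * pauli_coeff N X A"
  by (simp add: pauli_coeff_def mat_mult_smult mat_trace_smult carrier_matD)

text \<open>Subtract the combination of the four invariants that has the same coefficients as X on
  each class; the remainder is invariant with all coefficients zero.\<close>

lemma twirl_invariant_span:
  assumes N: "N \<ge> 1" and X: "twirl_invariant N X"
  shows "\<exists>a b c d. X = a \<cdot>\<^sub>m I_EE N + b \<cdot>\<^sub>m I_OO N + c \<cdot>\<^sub>m Psi_EE N + d \<cdot>\<^sub>m Psi_EO N"
proof -
  let ?S = "parity_string N" and ?\<mu> = "pauli_coeff N X" and ?d = "2 ^ N :: complex"
  note S = parity_string_group[of N] and one = pauli_group_one[of N]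
  have \<mu>: "?\<mu> (\<alpha> \<cdot>\<^sub>m A) = ?\<mu> A" if "\<alpha> \<in> phases" "A \<in> pauli_group N" for \<alpha> A
    by (rule pauli_coeff_phase[OF pauli_group_operator[OF that(2)] that(1)])
  have \<mu>': "?\<mu> (conjugate_by c A) = ?\<mu> A" if "c \<in> restricted_clifford N" "A \<in> pauli_group N" for c A
    by (rule pauli_coeff_invariant[OF X that(1) pauli_group_operator[OF that(2)]])
  have "\<exists>x. \<forall>A\<in>pauli_ABD N. ?\<mu> A = x"
  proof (cases "pauli_ABD N = {}")
    case False
    then obtain B where B: "B \<in> pauli_ABD N" by blast
    have "?\<mu> A = ?\<mu> B" if "A \<in> pauli_ABD N" for A
      using orbit_ABD[of N ?\<mu> A B] \<mu> \<mu>' that B by blast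
    thus ?thesis by blast
  qed simp
  then obtain xO where xO: "\<And>A. A \<in> pauli_ABD N \<Longrightarrow> ?\<mu> A = xO" by blast
  \<comment> \<open>The condition on R excludes the phase multiples of 1 and S. If no anticommuting
    pair exists, as for N = 1, any x will do.\<close>
  have "\<exists>x. \<forall>A\<in>pauli_BD N. \<forall>R\<in>pauli_BD N. comm_sign A R = - 1 \<longrightarrow> ?\<mu> A = x"
  proof (cases "\<exists>B\<in>pauli_BD N. \<exists>T\<in>pauli_BD N. comm_sign B T = - 1")
    case True
    then obtain B T where BT: "B \<in> pauli_BD N" "T \<in> pauli_BD N" "comm_sign B T = - 1" by blast
    have "?\<mu> A = ?\<mu> B" if "A \<in> pauli_BD N" "R \<in> pauli_BD N" "comm_sign A R = - 1" for A R
      using orbit_BD[of N ?\<mu> A R B T] \<mu> \<mu>' that BT by blast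
    thus ?thesis by blast
  qed blast
  then obtain xE where xE: "\<And>A R. A \<in> pauli_BD N \<Longrightarrow> R \<in> pauli_BD N \<Longrightarrow> comm_sign A R = - 1 \<Longrightarrow> ?\<mu> A = xE"
    by blast
  \<comment> \<open>The pair projectors contribute (p + q) 2^N on block-diagonal and (p - q) 2^N on
    anti-block-diagonal operators; these are set to \<open>xE\<close> and \<open>xO\<close>. Then a
    and b correct the values at 1 and S, where the relevant squared trace is 4^N.\<close>
  define p where "p = (xE + xO) / (2 * ?d)"
  define q where "q = (xE - xO) / (2 * ?d)"
  define a where "a = (?\<mu> (1\<^sub>m (2 ^ N)) - xE) / (?d * ?d)"
  define b where "b = (?\<mu> ?S - xE) / (?d * ?d)"
  have pq: "p * ?d + q * ?d = xE" "p * ?d - q * ?d = xO"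
    by (simp_all add: p_def q_def field_simps)
  have ab: "a * (?d * ?d) = ?\<mu> (1\<^sub>m (2 ^ N)) - xE" "b * (?d * ?d) = ?\<mu> ?S - xE"
    by (simp_all add: a_def b_def)
  let ?M1 = "wedge N N (1\<^sub>m (2 ^ N)) (1\<^sub>m (2 ^ N))" and ?M2 = "wedge N N ?S ?S"
    and ?M3 = "pair_vec N * mat_adjoint (pair_vec N)"
    and ?M4 = "signed_pair_vec N * mat_adjoint (signed_pair_vec N)"
  define Y where "Y = X + ((- a) \<cdot>\<^sub>m ?M1 + ((- b) \<cdot>\<^sub>m ?M2 + ((- p) \<cdot>\<^sub>m ?M3 + (- q) \<cdot>\<^sub>m ?M4)))"
  have Xo: "X \<in> operators (N + N)" using X by (simp add: twirl_invariant_def)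
  have Y: "twirl_invariant N Y"
    unfolding Y_def using X N
    by (intro twirl_invariant_add twirl_invariant_smult twirl_invariant_one twirl_invariant_parity_string
        twirl_invariant_pair_projector twirl_invariant_signed_pair_projector)
  have o: "?M3 \<in> operators (N + N)" "?M4 \<in> operators (N + N)" by (auto intro: carrier_matI)
  have \<mu>Y: "pauli_coeff N Y A = ?\<mu> A - a * (mat_trace A * cnj (mat_trace A))
      - b * (mat_trace (A * ?S) * cnj (mat_trace (A * ?S))) - p * ?d - q * (comm_sign ?S A * ?d)"
    if A: "A \<in> pauli_group N" for A
    using Xo o wedge_dim unfolding Y_def
    by (simp add: pauli_coeff_add pauli_coeff_smult pauli_coeff_one pauli_coeff_parity_string
        pauli_coeff_pair_projector pauli_coeff_signed_pair_projector A pauli_group_operator del: wedge_one)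
  have t1: "mat_trace (1\<^sub>m (2 ^ N)) = ?d" by (simp add: mat_trace_one)
  have SS: "?S * ?S = 1\<^sub>m (2 ^ N)" by (rule pauli_words_square[OF parity_string_word])
  \<comment> \<open>S is not scalar, hence traceless, so the corrections at 1 and at S do not
    disturb each other.\<close>
  obtain R where R: "R \<in> pauli_group N" "comm_sign ?S R = - 1"
    using nonscalar_comm_sign[OF S] parity_string_nonscalar[OF N] by metis
  have tS: "mat_trace ?S = 0" by (rule pauli_group_trace[OF S R])
  have "Y = 0\<^sub>m (2 ^ (N + N)) (2 ^ (N + N))"
  proof (rule twirl_invariant_eq_zero[OF Y])
    have "comm_sign ?S (1\<^sub>m (2 ^ N)) = 1" by (simp add: comm_sign_def)
    thus "pauli_coeff N Y (1\<^sub>m (2 ^ N)) = 0"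
      using \<mu>Y[OF one] ab(1) pq(1) tS by (simp add: t1 algebra_simps)
    show "pauli_coeff N Y ?S = 0"
      using \<mu>Y[OF S] ab(2) pq(1) tS by (simp add: t1 SS algebra_simps)
  next
    fix A assume A: "A \<in> pauli_ABD N"
    hence G: "A \<in> pauli_group N" "comm_sign ?S A = - 1" by (simp_all add: pauli_ABD_iff)
    \<comment> \<open>S itself anticommutes with A and with A S, so both are traceless.\<close>
    have "comm_sign A ?S = - 1" "comm_sign (A * ?S) ?S = - 1"
      using G comm_sign_mult_left[OF G(1) S S] by (simp_all add: comm_sign_sym[of A])
    hence "mat_trace A = 0" "mat_trace (A * ?S) = 0"
      using pauli_group_trace S G pauli_group_mult by blast+
    thus "pauli_coeff N Y A = 0" using \<mu>Y[OF G(1)] xO[OF A] pq(2) G(2) by (simp add: algebra_simps)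
  next
    fix A R assume A: "A \<in> pauli_BD N" and R: "R \<in> pauli_BD N" and AR: "comm_sign A R = - 1"
    hence G: "A \<in> pauli_group N" "comm_sign ?S A = 1" "R \<in> pauli_group N" "comm_sign ?S R = 1"
      by (simp_all add: pauli_BD_iff)
    \<comment> \<open>R commutes with S, so it anticommutes with A S as well as with A, and both are
      traceless.\<close>
    have "comm_sign (A * ?S) R = - 1"
      using AR G comm_sign_mult_left[OF G(1) S G(3)] by simp
    hence "mat_trace A = 0" "mat_trace (A * ?S) = 0"
      using pauli_group_trace S G AR pauli_group_mult by blast+
    thus "pauli_coeff N Y A = 0" using \<mu>Y[OF G(1)] xE[OF A R AR] pq(1) G(2) by (simp add: algebra_simps)
  qed
  hence Y0: "Y $$ (r, s) = 0" if "r < 2 ^ (N + N)" "s < 2 ^ (N + N)" for r s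
    using that by simp
  \<comment> \<open>The invariants are sums and differences of the parity-resolved operators, whence
    the coefficients a + b, a - b, p + q and p - q.\<close>
  have "X = (a + b) \<cdot>\<^sub>m I_EE N + (a - b) \<cdot>\<^sub>m I_OO N + (p + q) \<cdot>\<^sub>m Psi_EE N + (p - q) \<cdot>\<^sub>m Psi_EO N"
  proof (rule eq_matI)
    fix r s assume "r < dim_row ((a + b) \<cdot>\<^sub>m I_EE N + (a - b) \<cdot>\<^sub>m I_OO N + (p + q) \<cdot>\<^sub>m Psi_EE N + (p - q) \<cdot>\<^sub>m Psi_EO N)"
      "s < dim_col ((a + b) \<cdot>\<^sub>m I_EE N + (a - b) \<cdot>\<^sub>m I_OO N + (p + q) \<cdot>\<^sub>m Psi_EE N + (p - q) \<cdot>\<^sub>m Psi_EO N)"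
    hence rs: "r < 2 ^ (N + N)" "s < 2 ^ (N + N)" by simp_all
    from Y0[OF rs] rs Xo
    have "X $$ (r, s) - a * (I_EE N $$ (r, s) + I_OO N $$ (r, s)) - b * (I_EE N $$ (r, s) - I_OO N $$ (r, s))
       - p * (Psi_EE N $$ (r, s) + Psi_EO N $$ (r, s)) - q * (Psi_EE N $$ (r, s) - Psi_EO N $$ (r, s)) = 0"
      unfolding Y_def identity_parity_decomposition parity_string_parity_decomposition
        pair_projector_parity_decomposition signed_pair_projector_parity_decomposition
      by (simp add: algebra_simps)
    thus "X $$ (r, s) = ((a + b) \<cdot>\<^sub>m I_EE N + (a - b) \<cdot>\<^sub>m I_OO N + (p + q) \<cdot>\<^sub>m Psi_EE N + (p - q) \<cdot>\<^sub>m Psi_EO N) $$ (r, s)"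
      using rs by (simp add: algebra_simps)
  qed (use Xo in auto)
  thus ?thesis by blast
qed

theorem corollary1p2:
  fixes N :: nat
  assumes "N \<ge> 1"
  shows
    "(\<forall>\<rho> \<in> operators (N + N). twirl N \<rho> = twirl_adj N \<rho>) \<and>
     twirl N (wedge N N (1\<^sub>m (2 ^ N)) (1\<^sub>m (2 ^ N))) = wedge N N (1\<^sub>m (2 ^ N)) (1\<^sub>m (2 ^ N)) \<and>
     twirl N (wedge N N (parity_string N) (parity_string N))
       = wedge N N (parity_string N) (parity_string N) \<and>
     twirl N (Psi_EE N) = Psi_EE N \<and>
     twirl N (Psi_EO N) = Psi_EO N \<and>
     (\<forall>\<rho>. fermionic_state (N + N) \<rho> \<longrightarrow>
       (\<exists>a b c d :: complex. twirl N \<rho> =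
          a \<cdot>\<^sub>m I_EE N + b \<cdot>\<^sub>m I_OO N + c \<cdot>\<^sub>m Psi_EE N + d \<cdot>\<^sub>m Psi_EO N))"
proof (intro conjI ballI allI impI)
  show "twirl N \<rho> = twirl_adj N \<rho>" for \<rho> by (rule twirl_selfadjoint)
  show "twirl N (wedge N N (1\<^sub>m (2 ^ N)) (1\<^sub>m (2 ^ N))) = wedge N N (1\<^sub>m (2 ^ N)) (1\<^sub>m (2 ^ N))"
    by (rule twirl_fixes_invariant[OF twirl_invariant_one])
  show "twirl N (wedge N N (parity_string N) (parity_string N))
      = wedge N N (parity_string N) (parity_string N)"
    by (rule twirl_fixes_invariant[OF twirl_invariant_parity_string[OF assms]])
  show "twirl N (Psi_EE N) = Psi_EE N" "twirl N (Psi_EO N) = Psi_EO N"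
    by (rule twirl_fixes_invariant, rule twirl_invariant_Psi[OF assms])+
  fix \<rho> assume "fermionic_state (N + N) \<rho>"
  hence "\<rho> \<in> operators (N + N)" by (simp add: fermionic_state_def)
  thus "\<exists>a b c d. twirl N \<rho> = a \<cdot>\<^sub>m I_EE N + b \<cdot>\<^sub>m I_OO N + c \<cdot>\<^sub>m Psi_EE N + d \<cdot>\<^sub>m Psi_EO N"
    by (intro twirl_invariant_span[OF assms] twirl_is_invariant)
qed

end
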